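(* Let $n\in\mathbb{N}$, let $s_0<s_1$ be real numbers, and let $\mathscr{S}$ be a Hilbert space. The following are equivalent: (i) $\mathscr{S}$ is an interpolation space with respect to the pair $[H^{(s_0)}(\mathbb{Z}^n),H^{(s_1)}(\mathbb{Z}^n)]$. (ii) Up to norm equivalence, $\mathscr{S}=H^{\varphi}(\mathbb{Z}^n)$ for some function $\varphi\in RO$ satisfying, with some constant $c\geq 1$, $$c^{-1}\lambda^{s_0}\leq\frac{\varphi(\lambda t)}{\varphi(t)}\leq c\lambda^{s_1}\qquad\text{for all }t\geq 1,\ \lambda\geq 1.$$
   Context: Notation on $\mathbb{Z}^n$: $|k|=\sqrt{k_1^2+\dots+k_n^2}$ and $\langle k\rangle=(1+|k|^2)^{1/2}$. $\ell^2(\mathbb{Z}^n)$ is the Hilbert space of square summable functions $u\colon\mathbb{Z}^n\to\mathbb{C}$ with inner product $(u,v)=\sum_{k\in\mathbb{Z}^n}u(k)\overline{v(k)}$ and norm $\|\cdot\|$. $\mathcal{S}(\mathbb{Z}^n)$ is the Schwartz space of functions $u\colon\mathbb{Z}^n\to\mathbb{C}$ with $\sup_{k}|k^{\alpha}(\Delta_k^{\beta}u)(k)|<\infty$ for all $\alpha,\beta\in\mathbb{N}_0^n$, where $\Delta_{k_j}u(k)=u(k+e_j)-u(k)$ and $\Delta_k^\beta=\Delta_{k_1}^{\beta_1}\cdots\Delta_{k_n}^{\beta_n}$. $\mathcal{S}'(\mathbb{Z}^n)$ is the space of continuous linear functionals on $\mathcal{S}(\mathbb{Z}^n)$, identified with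 functions $u\colon\mathbb{Z}^n\to\mathbb{C}$ of at most polynomial growth acting by $v\mapsto\sum_k u(k)v(k)$. $RO$-varying functions: $\varphi\in RO$ means that $\varphi\colon[1,\infty)\to(0,\infty)$ is Borel measurable and there exist $a>1$, $c\geq1$ with $c^{-1}\leq\varphi(\lambda t)/\varphi(t)\leq c$ for all $t\geq1$, $\lambda\in[1,a]$. Sobolev spaces: for $s\in\mathbb{R}$, $H^{(s)}(\mathbb{Z}^n)=\{u\in\mathcal{S}'(\mathbb{Z}^n):\langle k\rangle^su\in\ell^2(\mathbb{Z}^n)\}$ with norm $\|u\|_{H^{(s)}}=\|\langle k\rangle^su\|$. For $\varphi\in RO$, $H^{\varphi}(\mathbb{Z}^n)=\{u\in\mathcal{S}'(\mathbb{Z}^n):\varphi(\langle k\rangle)u\in\ell^2(\mathbb{Z}^n)\}$ with inner product $(u,v)_{H^{\varphi}(\mathbb{Z}^n)}=\sum_{k\in\mathbb{Z}^n}[\varphi(\langle k\rangle)]^2u(k)\overline{v(k)}$. Interpolation space: let $[\mathscr{H}_0,\mathscr{H}_1]$ be an ordered pair of separable complex Hilbert spaces with continuous embedding $\mathscr{H}_1\hookrightarrow\mathscr{H}_0$. A Hilbert space $\mathscr{S}$ is an interpolation space with respect to $[\mathscr{H}_0,\mathscr{H}_1]$ if (i) there are continuous embeddings $\mathscr{H}_1\hookrightarrow\mathscr{S}\hookrightarrow\mathscr{H}_0$; and (ii) any linear operator $T$ in $\mathscr{H}_0$ which acts as a bounded linear operator $T\colon\mathscr{H}_0\to\mathscr{H}_0$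 and $T\colon\mathscr{H}_1\to\mathscr{H}_1$ also acts as a bounded linear operator $T\colon\mathscr{S}\to\mathscr{S}$. "Up to norm equivalence" means the two spaces coincide as vector spaces and their norms are equivalent. *)

theory Defs
  imports "HOL-Analysis.Analysis"
begin

section \<open>Complex Hilbert spaces with explicit carriers\<close>

text \<open>
  The spaces compared below are different subsets of one type, so they are carrier-based
  rather than type-class based. Each space brings its own vector operations; nothing is
  assumed about their values outside the carrier.
\<close>

record 'a inner_space =
  hcarrier :: "'a set"
  hadd :: "'a \<Rightarrow> 'a \<Rightarrow> 'a"
  hzero :: 'a
  hscale :: "complex \<Rightarrow> 'a \<Rightarrow> 'a"
  hinner :: "'a \<Rightarrow> 'a \<Rightarrow> complex"

locale complex_vector_space =
  fixes V :: "'a inner_space"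
  assumes add_closed: "\<lbrakk>x \<in> hcarrier V; y \<in> hcarrier V\<rbrakk> \<Longrightarrow> hadd V x y \<in> hcarrier V"
    and zero_closed: "hzero V \<in> hcarrier V"
    and scale_closed: "x \<in> hcarrier V \<Longrightarrow> hscale V c x \<in> hcarrier V"
    and add_assoc: "\<lbrakk>x \<in> hcarrier V; y \<in> hcarrier V; z \<in> hcarrier V\<rbrakk>
        \<Longrightarrow> hadd V (hadd V x y) z = hadd V x (hadd V y z)"
    and add_commute: "\<lbrakk>x \<in> hcarrier V; y \<in> hcarrier V\<rbrakk> \<Longrightarrow> hadd V x y = hadd V y x"
    and add_zero: "x \<in> hcarrier V \<Longrightarrow> hadd V x (hzero V) = x"
    and add_inverse: "x \<in> hcarrier V \<Longrightarrow> hadd V x (hscale V (-1) x) = hzero V"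
    and scale_one: "x \<in> hcarrier V \<Longrightarrow> hscale V 1 x = x"
    and scale_scale: "x \<in> hcarrier V \<Longrightarrow> hscale V a (hscale V b x) = hscale V (a * b) x"
    and scale_add_right: "\<lbrakk>x \<in> hcarrier V; y \<in> hcarrier V\<rbrakk>
        \<Longrightarrow> hscale V a (hadd V x y) = hadd V (hscale V a x) (hscale V a y)"
    and scale_add_left: "x \<in> hcarrier V
        \<Longrightarrow> hscale V (a + b) x = hadd V (hscale V a x) (hscale V b x)"

locale complex_inner_product_space = complex_vector_space +
  assumes inner_add_left: "\<lbrakk>x \<in> hcarrier V; y \<in> hcarrier V; z \<in> hcarrier V\<rbrakk>
        \<Longrightarrow> hinner V (hadd V x y) z = hinner V x z + hinner V y z"
    and inner_scale_left: "\<lbrakk>x \<in> hcarrier V; y \<in> hcarrier V\<rbrakk>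
        \<Longrightarrow> hinner V (hscale V c x) y = c * hinner V x y"
    and inner_commute: "\<lbrakk>x \<in> hcarrier V; y \<in> hcarrier V\<rbrakk>
        \<Longrightarrow> hinner V x y = cnj (hinner V y x)"
    and inner_nonneg: "x \<in> hcarrier V \<Longrightarrow> 0 \<le> Re (hinner V x x)"
    and inner_eq_zero: "x \<in> hcarrier V \<Longrightarrow> hinner V x x = 0 \<longleftrightarrow> x = hzero V"

definition hnorm :: "'a inner_space \<Rightarrow> 'a \<Rightarrow> real" where
  "hnorm V x = sqrt (Re (hinner V x x))"

text \<open>
  The locale \<^locale>\<open>Metric_space\<close> asks for a nonnegative symmetric function on the
  whole type, hence the value 0 off the carrier.
\<close>

definition hdist :: "'a inner_space \<Rightarrow> 'a \<Rightarrow> 'a \<Rightarrow> real" where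
  "hdist V x y =
     (if x \<in> hcarrier V \<and> y \<in> hcarrier V then hnorm V (hadd V x (hscale V (-1) y)) else 0)"

locale hilbert_space = complex_inner_product_space +
  assumes complete: "Metric_space.mcomplete (hcarrier V) (hdist V)"

definition separable_hilbert_space :: "'a inner_space \<Rightarrow> bool" where
  "separable_hilbert_space V \<longleftrightarrow>
     hilbert_space V \<and> separable_space (Metric_space.mtopology (hcarrier V) (hdist V))"

definition bounded_linear_operator ::
    "'a inner_space \<Rightarrow> 'b inner_space \<Rightarrow> ('a \<Rightarrow> 'b) \<Rightarrow> bool" where
  "bounded_linear_operator V W T \<longleftrightarrow>
     T \<in> hcarrier V \<rightarrow> hcarrier W \<and>
     (\<forall>x\<in>hcarrier V. \<forall>y\<in>hcarrier V. T (hadd V x y) = hadd W (T x) (T y)) \<and>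
     (\<forall>c. \<forall>x\<in>hcarrier V. T (hscale V c x) = hscale W c (T x)) \<and>
     (\<exists>C. \<forall>x\<in>hcarrier V. hnorm W (T x) \<le> C * hnorm V x)"

text \<open>Embeddings are inclusions; being a bounded operator contains \<open>hcarrier V \<subseteq> hcarrier W\<close>.\<close>

definition continuous_embedding :: "'a inner_space \<Rightarrow> 'a inner_space \<Rightarrow> bool" where
  "continuous_embedding V W \<longleftrightarrow> bounded_linear_operator V W (\<lambda>x. x)"

definition admissible_pair :: "'a inner_space \<Rightarrow> 'a inner_space \<Rightarrow> bool" where
  "admissible_pair H0 H1 \<longleftrightarrow>
     separable_hilbert_space H0 \<and> separable_hilbert_space H1 \<and> continuous_embedding H1 H0"

definition interpolation_space ::
    "'a inner_space \<Rightarrow> 'a inner_space \<Rightarrow> 'a inner_space \<Rightarrow> bool" where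
  "interpolation_space H0 H1 S \<longleftrightarrow>
     admissible_pair H0 H1 \<and> hilbert_space S \<and>
     continuous_embedding H1 S \<and> continuous_embedding S H0 \<and>
     (\<forall>T. bounded_linear_operator H0 H0 T \<and> bounded_linear_operator H1 H1 T
          \<longrightarrow> bounded_linear_operator S S T)"

definition same_vector_space :: "'a inner_space \<Rightarrow> 'a inner_space \<Rightarrow> bool" where
  "same_vector_space V W \<longleftrightarrow>
     hcarrier V = hcarrier W \<and> hzero V = hzero W \<and>
     (\<forall>x\<in>hcarrier V. \<forall>y\<in>hcarrier V. hadd V x y = hadd W x y) \<and>
     (\<forall>c. \<forall>x\<in>hcarrier V. hscale V c x = hscale W c x)"

definition equal_up_to_norm_equivalence :: "'a inner_space \<Rightarrow> 'a inner_space \<Rightarrow> bool" where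
  "equal_up_to_norm_equivalence V W \<longleftrightarrow>
     same_vector_space V W \<and>
     (\<exists>c>0. \<exists>C>0. \<forall>x\<in>hcarrier V. c * hnorm W x \<le> hnorm V x \<and> hnorm V x \<le> C * hnorm W x)"

section \<open>Function spaces on the integer lattice\<close>

definition lattice_norm :: "int ^ 'n \<Rightarrow> real" where
  "lattice_norm k = sqrt (\<Sum>i\<in>UNIV. (real_of_int (k $ i))\<^sup>2)"

definition jbracket :: "int ^ 'n \<Rightarrow> real" where
  "jbracket k = (1 + (lattice_norm k)\<^sup>2) powr (1/2)"

definition ell2 :: "(int ^ 'n \<Rightarrow> complex) set" where
  "ell2 = {u. (\<lambda>k. (cmod (u k))\<^sup>2) summable_on UNIV}"

definition ell2_inner :: "(int ^ 'n \<Rightarrow> complex) \<Rightarrow> (int ^ 'n \<Rightarrow> complex) \<Rightarrow> complex" where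
  "ell2_inner u v = (\<Sum>\<^sub>\<infinity>k. u k * cnj (v k))"

text \<open>
  The tempered distributions on the lattice, the dual of the Schwartz space, under their
  identification with the functions of at most polynomial growth, \<open>u\<close> acting by
  \<open>v \<mapsto> (\<Sum>k. u k * v k)\<close>.
\<close>

definition tempered :: "(int ^ 'n \<Rightarrow> complex) set" where
  "tempered = {u. \<exists>C. \<exists>N::nat. \<forall>k. cmod (u k) \<le> C * jbracket k ^ N}"

definition function_inner_space ::
    "('k \<Rightarrow> complex) set \<Rightarrow> (('k \<Rightarrow> complex) \<Rightarrow> ('k \<Rightarrow> complex) \<Rightarrow> complex)
      \<Rightarrow> ('k \<Rightarrow> complex) inner_space" where
  "function_inner_space A ip =
     \<lparr>hcarrier = A, hadd = (\<lambda>u v k. u k + v k), hzero = (\<lambda>k. 0),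
      hscale = (\<lambda>c u k. c * u k), hinner = ip\<rparr>"

definition Sobolev :: "real \<Rightarrow> (int ^ 'n \<Rightarrow> complex) inner_space" where
  "Sobolev s =
     function_inner_space
       {u \<in> tempered. (\<lambda>k. complex_of_real (jbracket k powr s) * u k) \<in> ell2}
       (\<lambda>u v. ell2_inner (\<lambda>k. complex_of_real (jbracket k powr s) * u k)
                         (\<lambda>k. complex_of_real (jbracket k powr s) * v k))"

text \<open>A function on \<open>[1,\<infinity>)\<close> is a total function of which only the values on \<open>{1..}\<close> matter.\<close>

definition RO :: "(real \<Rightarrow> real) set" where
  "RO = {\<phi>. \<phi> \<in> borel_measurable (restrict_space borel {1..}) \<and>
            (\<forall>t\<ge>1. 0 < \<phi> t) \<and>
            (\<exists>a>1. \<exists>c\<ge>1. \<forall>t\<ge>1. \<forall>l\<in>{1..a}.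
               inverse c \<le> \<phi> (l * t) / \<phi> t \<and> \<phi> (l * t) / \<phi> t \<le> c)}"

definition Hoermander :: "(real \<Rightarrow> real) \<Rightarrow> (int ^ 'n \<Rightarrow> complex) inner_space" where
  "Hoermander \<phi> =
     function_inner_space
       {u \<in> tempered. (\<lambda>k. complex_of_real (\<phi> (jbracket k)) * u k) \<in> ell2}
       (\<lambda>u v. \<Sum>\<^sub>\<infinity>k. complex_of_real ((\<phi> (jbracket k))\<^sup>2) * u k * cnj (v k))"

end

theory Submission
  imports Defs
begin

text \<open>
  Both end spaces are weighted \<open>\<ell>\<^sup>2\<close> spaces, with weights \<open>w0 k = \<langle>k\<rangle> powr s0\<close> and
  \<open>w1 k = \<langle>k\<rangle> powr s1\<close>. The theorem factors through a condition on weights: \<open>w\<close> is an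
  \<^emph>\<open>interpolated weight\<close> if \<open>w k \<le> c * max (w0 k / w0 j) (w1 k / w1 j) * w j\<close> for all \<open>j\<close>
  and \<open>k\<close>. It is shown that \<open>S\<close> is an interpolation space iff, up to norm equivalence, it is the
  weighted space of an interpolated weight, and that the interpolated weights are, up to
  constants, the functions \<open>\<phi> \<langle>k\<rangle>\<close> with \<open>\<phi>\<close> of the growth in the statement.

  \<^emph>\<open>Interpolated weights give interpolation spaces\<close> (\<open>interpolation_weighted_ell2\<close>). Put
  \<open>\<rho> = (w1 / w0)\<^sup>2\<close>. Let \<open>T\<close> be bounded on both end spaces, and split \<open>u\<close> at the level \<open>\<rho> = r\<close>.
  This bounds \<open>\<Sum>k. h k * \<bar>w0 k * T u k\<bar>\<^sup>2\<close> by a fixed multiple of \<open>\<Sum>k. h k * \<bar>w0 k * u k\<bar>\<^sup>2\<close>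
  for \<open>h = min \<rho> r\<close>, with a constant that does not depend on \<open>r\<close>. The functions \<open>h\<close> with such a
  bound form a convex cone that contains the constants and is closed under monotone limits.
  As \<open>\<rho>\<close> takes its values in a discrete sequence, summation by parts puts \<open>f \<rho>\<close> into the cone for
  every concave nondecreasing nonnegative \<open>f\<close> on \<open>[0,\<infinity>)\<close>. For an interpolated weight \<open>w\<close>,
  \<open>(w / w0)\<^sup>2\<close> is comparable to the infimum of the affine functions
  \<open>(w j / w0 j)\<^sup>2 * (1 + \<rho> / \<rho> j)\<close> of \<open>\<rho>\<close>, and such an infimum is concave.

  \<^emph>\<open>Interpolation spaces are weighted spaces\<close> (\<open>S_equal_weighted_ell2\<close>). Multiplication by a
  bounded function is bounded on both end spaces, hence on \<open>S\<close>, and a category argument makes the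
  bound uniform over all multipliers of modulus at most 1. By the parallelogram law the signs in
  \<open>\<Sum>k. \<plusminus> u k * e k\<close> can be chosen so that the squared norm is at most, or at least,
  \<open>\<Sum>k. \<bar>u k\<bar>\<^sup>2 * \<parallel>e k\<parallel>\<^sup>2\<close>, and changing signs costs only a constant. So \<open>S\<close> is the weighted
  space of \<open>w k = \<parallel>e k\<parallel>\<close>.

  \<^emph>\<open>The weight is interpolated\<close> (\<open>interpolated_weight_necessary\<close>). The operator that sends \<open>e j\<close>
  to \<open>e k\<close> and all other unit vectors to 0 has the norms \<open>w0 k / w0 j\<close> and \<open>w1 k / w1 j\<close> on the
  end spaces and \<open>w k / w j\<close> on \<open>S\<close>. If no constant \<open>c\<close> worked, a geometric series of such
  operators would be bounded on the end spaces but not on \<open>S\<close>.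

  \<^emph>\<open>The function \<open>\<phi>\<close>\<close> (\<open>growth_function_of_interpolated_weight\<close>). It is obtained as
  \<open>\<phi> t = (INF j. w j * max ((t / \<langle>j\<rangle>) powr s0) ((t / \<langle>j\<rangle>) powr s1))\<close>: every function in this
  infimum obeys the growth condition with constant 1, and the infimum inherits it.
\<close>

section \<open>Inner product spaces of functions with pointwise operations\<close>

text \<open>
  The Sobolev and Hoermander spaces have pointwise operations by definition. An interpolation space
  inherits them from the end spaces, because its embeddings are linear inclusions. With pointwise
  operations on the carrier, vector identities become identities between functions.
\<close>

locale function_inner_product_space = complex_inner_product_space V
  for V :: "('k \<Rightarrow> complex) inner_space" +
  assumes hadd_pointwise: "\<lbrakk>x \<in> hcarrier V; y \<in> hcarrier V\<rbrakk> \<Longrightarrow> hadd V x y = (\<lambda>k. x k + y k)"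
    and hscale_pointwise: "x \<in> hcarrier V \<Longrightarrow> hscale V c x = (\<lambda>k. c * x k)"
begin

abbreviation nrm :: "('k \<Rightarrow> complex) \<Rightarrow> real" where "nrm \<equiv> hnorm V"

lemma hzero_pointwise: "hzero V = (\<lambda>k. 0)"
proof -
  have "hzero V = hadd V (hzero V) (hscale V (-1) (hzero V))"
    using add_inverse[OF zero_closed] by simp
  also have "\<dots> = (\<lambda>k. hzero V k + hscale V (-1) (hzero V) k)"
    by (rule hadd_pointwise[OF zero_closed scale_closed[OF zero_closed]])
  also have "\<dots> = (\<lambda>k. 0)"
    by (simp add: hscale_pointwise[OF zero_closed])
  finally show ?thesis .
qed

lemma zero_mem: "(\<lambda>k. 0) \<in> hcarrier V"
  using zero_closed by (simp add: hzero_pointwise)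

lemma add_mem: "\<lbrakk>x \<in> hcarrier V; y \<in> hcarrier V\<rbrakk> \<Longrightarrow> (\<lambda>k. x k + y k) \<in> hcarrier V"
  using add_closed hadd_pointwise by metis

lemma scale_mem: "x \<in> hcarrier V \<Longrightarrow> (\<lambda>k. c * x k) \<in> hcarrier V"
  using scale_closed hscale_pointwise by metis

lemma diff_mem: "\<lbrakk>x \<in> hcarrier V; y \<in> hcarrier V\<rbrakk> \<Longrightarrow> (\<lambda>k. x k - y k) \<in> hcarrier V"
  using add_mem[OF _ scale_mem[of y "-1"]] by simp

lemma sum_mem:
  "(\<And>i. i \<in> I \<Longrightarrow> f i \<in> hcarrier V) \<Longrightarrow> (\<lambda>k. \<Sum>i\<in>I. f i k) \<in> hcarrier V"
  by (induction I rule: infinite_finite_induct) (auto intro: zero_mem add_mem)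

lemma nrm_nonneg: "x \<in> hcarrier V \<Longrightarrow> 0 \<le> nrm x"
  by (simp add: hnorm_def inner_nonneg)

lemma nrm_sq: "x \<in> hcarrier V \<Longrightarrow> (nrm x)\<^sup>2 = Re (hinner V x x)"
  by (simp add: hnorm_def inner_nonneg)

lemma inner_add: "\<lbrakk>x \<in> hcarrier V; y \<in> hcarrier V; z \<in> hcarrier V\<rbrakk>
    \<Longrightarrow> hinner V (\<lambda>k. x k + y k) z = hinner V x z + hinner V y z"
  using inner_add_left[of x y z] by (simp add: hadd_pointwise)

lemma inner_scale: "\<lbrakk>x \<in> hcarrier V; y \<in> hcarrier V\<rbrakk>
    \<Longrightarrow> hinner V (\<lambda>k. c * x k) y = c * hinner V x y"
  using inner_scale_left[of x y c] by (simp add: hscale_pointwise)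

lemma nrm_eq_0: "x \<in> hcarrier V \<Longrightarrow> nrm x = 0 \<longleftrightarrow> x = (\<lambda>k. 0)"
proof -
  assume x: "x \<in> hcarrier V"
  have "Im (hinner V x x) = 0"
    using inner_commute[OF x x] by (metis add.inverse_neutral complex_cnj complex_surj
        complex.sel(2) neg_equal_zero)
  then have "nrm x = 0 \<longleftrightarrow> hinner V x x = 0"
    by (simp add: hnorm_def complex_eq_iff)
  then show ?thesis
    using inner_eq_zero[OF x] by (simp add: hzero_pointwise)
qed

lemma nrm_zero: "nrm (\<lambda>k. 0) = 0"
  using nrm_eq_0 zero_mem by blast

lemma nrm_scale: "x \<in> hcarrier V \<Longrightarrow> nrm (\<lambda>k. c * x k) = cmod c * nrm x"
proof -
  assume x: "x \<in> hcarrier V"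
  have "hinner V x (\<lambda>k. c * x k) = cnj c * hinner V x x"
    using inner_commute[OF x scale_mem[OF x]] inner_scale[OF x x] inner_commute[OF x x]
    by (metis complex_cnj_mult)
  then have "hinner V (\<lambda>k. c * x k) (\<lambda>k. c * x k) = c * (cnj c * hinner V x x)"
    using inner_scale[OF x scale_mem[OF x]] by simp
  also have "\<dots> = complex_of_real ((cmod c)\<^sup>2) * hinner V x x"
    by (metis complex_norm_square mult.assoc)
  finally have "(nrm (\<lambda>k. c * x k))\<^sup>2 = (cmod c * nrm x)\<^sup>2"
    by (simp add: nrm_sq x scale_mem power_mult_distrib Re_complex_of_real flip: of_real_power)
  then show ?thesis
    by (metis mult_nonneg_nonneg norm_ge_zero nrm_nonneg power2_eq_iff_nonneg scale_mem x)
qed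

lemma nrm_minus: "\<lbrakk>x \<in> hcarrier V; y \<in> hcarrier V\<rbrakk> \<Longrightarrow> nrm (\<lambda>k. y k - x k) = nrm (\<lambda>k. x k - y k)"
  using nrm_scale[OF diff_mem, of x y "-1"] by (simp add: algebra_simps)

lemma nrm_add_sq:
  assumes x: "x \<in> hcarrier V" and y: "y \<in> hcarrier V"
  shows "(nrm (\<lambda>k. x k + y k))\<^sup>2 = (nrm x)\<^sup>2 + (nrm y)\<^sup>2 + 2 * Re (hinner V x y)"
proof -
  note xy = add_mem[OF x y]
  have *: "hinner V z (\<lambda>k. x k + y k) = hinner V z x + hinner V z y" if z: "z \<in> hcarrier V" for z
    using inner_commute[OF z xy] inner_add[OF x y z] inner_commute[OF z x] inner_commute[OF z y]
    by (metis complex_cnj_add)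
  have "Re (hinner V y x) = Re (hinner V x y)"
    using inner_commute[OF x y] by simp
  then show ?thesis
    by (simp add: nrm_sq x y xy inner_add * )
qed

lemma parallelogram:
  assumes x: "x \<in> hcarrier V" and y: "y \<in> hcarrier V"
  shows "(nrm (\<lambda>k. x k + y k))\<^sup>2 + (nrm (\<lambda>k. x k - y k))\<^sup>2 = 2 * (nrm x)\<^sup>2 + 2 * (nrm y)\<^sup>2"
proof -
  have "Re (hinner V x (\<lambda>k. -1 * y k)) = - Re (hinner V x y)"
    using inner_commute[OF x scale_mem[OF y, of "-1"]] inner_scale[OF y x, of "-1"]
      inner_commute[OF x y] by simp
  then show ?thesis
    using nrm_add_sq[OF x y] nrm_add_sq[OF x scale_mem[OF y, of "-1"]] nrm_scale[OF y, of "-1"]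
    by simp
qed

lemma Cauchy_Schwarz:
  assumes x: "x \<in> hcarrier V" and y: "y \<in> hcarrier V"
  shows "Re (hinner V x y) \<le> nrm x * nrm y"
proof (cases "nrm y = 0")
  case True
  then have "y = (\<lambda>k. 0 * x k)"
    using nrm_eq_0[OF y] by simp
  then show ?thesis
    using inner_scale[OF x x, of 0] inner_commute[OF x y] True by simp
next
  case False
  then have pos: "nrm y > 0" using nrm_nonneg[OF y] by simp
  \<comment> \<open>the minimizer of \<open>\<parallel>x - t y\<parallel>\<close> in the case of equality\<close>
  define t where "t = nrm x / nrm y"
  have "Re (hinner V x (\<lambda>k. of_real (-t) * y k)) = - t * Re (hinner V x y)"
    using inner_commute[OF x scale_mem[OF y, of "of_real (-t)"]] inner_scale[OF y x, of "of_real (-t)"]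
      inner_commute[OF x y] by simp
  then have "0 \<le> (nrm x)\<^sup>2 + (cmod (of_real (-t)) * nrm y)\<^sup>2 - 2 * t * Re (hinner V x y)"
    using nrm_add_sq[OF x scale_mem[OF y, of "of_real (-t)"]] nrm_scale[OF y, of "of_real (-t)"]
    by (metis (no_types, lifting) ab_group_add_class.ab_diff_conv_add_uminus mult.assoc
        mult_minus_left mult_minus_right zero_le_power2)
  also have "cmod (of_real (-t)) * nrm y = nrm x"
    unfolding norm_of_real using pos nrm_nonneg[OF x] by (simp add: t_def)
  finally have "t * Re (hinner V x y) \<le> (nrm x)\<^sup>2" by simp
  then have *: "nrm x * Re (hinner V x y) \<le> nrm x * (nrm x * nrm y)"
    using pos by (simp add: t_def field_simps power2_eq_square)
  show ?thesis
  proof (cases "nrm x = 0")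
    case True
    then have "x = (\<lambda>k. 0 * y k)"
      using nrm_eq_0[OF x] by simp
    then show ?thesis
      using inner_scale[OF y y, of 0] True by simp
  next
    case False
    then show ?thesis using * nrm_nonneg[OF x] by simp
  qed
qed

lemma triangle:
  assumes x: "x \<in> hcarrier V" and y: "y \<in> hcarrier V"
  shows "nrm (\<lambda>k. x k + y k) \<le> nrm x + nrm y"
proof (rule power2_le_imp_le)
  show "(nrm (\<lambda>k. x k + y k))\<^sup>2 \<le> (nrm x + nrm y)\<^sup>2"
    using nrm_add_sq[OF x y] Cauchy_Schwarz[OF x y] by (simp add: power2_sum)
qed (simp add: nrm_nonneg x y)

lemma triangle_diff:
  assumes x: "x \<in> hcarrier V" and y: "y \<in> hcarrier V"
  shows "nrm x \<le> nrm y + nrm (\<lambda>k. x k - y k)"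
  using triangle[OF y diff_mem[OF x y]] by simp

lemma hdist_pointwise: "\<lbrakk>x \<in> hcarrier V; y \<in> hcarrier V\<rbrakk> \<Longrightarrow> hdist V x y = nrm (\<lambda>k. x k - y k)"
  by (simp add: hdist_def hadd_pointwise scale_closed) (simp add: hscale_pointwise)

lemma Metric_space_hdist: "Metric_space (hcarrier V) (hdist V)"
proof
  show "0 \<le> hdist V x y" for x y
    by (cases "x \<in> hcarrier V \<and> y \<in> hcarrier V")
       (auto simp: hdist_pointwise nrm_nonneg diff_mem, auto simp: hdist_def)
  show "hdist V x y = hdist V y x" for x y
    by (cases "x \<in> hcarrier V \<and> y \<in> hcarrier V")
       (auto simp: hdist_pointwise intro: nrm_minus, auto simp: hdist_def)
  show "hdist V x y = 0 \<longleftrightarrow> x = y" if "x \<in> hcarrier V" "y \<in> hcarrier V" for x y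
    using that by (simp add: hdist_pointwise nrm_eq_0 diff_mem) (auto simp: fun_eq_iff)
  show "hdist V x z \<le> hdist V x y + hdist V y z"
    if "x \<in> hcarrier V" "y \<in> hcarrier V" "z \<in> hcarrier V" for x y z
    using triangle[OF diff_mem[OF that(1,2)] diff_mem[OF that(2,3)]] that
    by (simp add: hdist_pointwise)
qed

sublocale metric: Metric_space "hcarrier V" "hdist V"
  by (rule Metric_space_hdist)

text \<open>
  By completeness a Cauchy sequence has a limit in norm. If the evaluations are continuous, this
  limit can only be the pointwise limit, which thereby belongs to the space.
\<close>

lemma limit_is_pointwise_limit:
  assumes complete: "metric.mcomplete"
    and eval: "\<And>k. \<exists>C. \<forall>x\<in>hcarrier V. cmod (x k) \<le> C * nrm x"
    and mem: "\<And>n. f n \<in> hcarrier V"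
    and cauchy: "\<And>e. e > 0 \<Longrightarrow> \<exists>N. \<forall>m\<ge>N. \<forall>n\<ge>m. nrm (\<lambda>k. f n k - f m k) \<le> e"
    and lim: "\<And>k. (\<lambda>n. f n k) \<longlonglongrightarrow> u k"
  shows "u \<in> hcarrier V" and "(\<lambda>n. nrm (\<lambda>k. f n k - u k)) \<longlonglongrightarrow> 0"
proof -
  have "metric.MCauchy f"
    unfolding metric.MCauchy_def
  proof (intro conjI allI impI)
    fix e :: real assume "e > 0"
    then obtain N where N: "\<And>m n. m \<ge> N \<Longrightarrow> n \<ge> m \<Longrightarrow> nrm (\<lambda>k. f n k - f m k) \<le> e / 2"
      using cauchy[of "e/2"] by auto
    have "hdist V (f n) (f n') < e" if "N \<le> n" "N \<le> n'" for n n'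
    proof (cases "n \<le> n'")
      case True
      then show ?thesis
        using N[OF that(1) True] \<open>e > 0\<close> nrm_minus[OF mem mem, of n n'] by (simp add: hdist_pointwise mem)
    next
      case False
      then show ?thesis
        using N[OF that(2), of n] \<open>e > 0\<close> by (simp add: hdist_pointwise mem)
    qed
    then show "\<exists>N. \<forall>n n'. N \<le> n \<longrightarrow> N \<le> n' \<longrightarrow> hdist V (f n) (f n') < e" by blast
  qed (use mem in auto)
  then obtain v where v: "limitin metric.mtopology f v sequentially"
    using complete metric.mcomplete_def by blast
  then have vmem: "v \<in> hcarrier V"
    by (simp add: metric.limitin_mspace)
  have to0: "(\<lambda>n. nrm (\<lambda>k. f n k - v k)) \<longlonglongrightarrow> 0"
    using v vmem mem by (simp add: metric.limitin_metric_dist_null hdist_pointwise)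
  have "v k = u k" for k
  proof -
    obtain C where C: "\<And>x. x \<in> hcarrier V \<Longrightarrow> cmod (x k) \<le> C * nrm x"
      using eval by blast
    have "(\<lambda>n. f n k - v k) \<longlonglongrightarrow> 0"
    proof (rule Lim_null_comparison)
      show "\<forall>\<^sub>F n in sequentially. norm (f n k - v k) \<le> C * nrm (\<lambda>k. f n k - v k)"
        using C[OF diff_mem[OF mem vmem]] by simp
      show "(\<lambda>n. C * nrm (\<lambda>k. f n k - v k)) \<longlonglongrightarrow> 0"
        using tendsto_mult_right_zero[OF to0] by simp
    qed
    then have "(\<lambda>n. f n k) \<longlonglongrightarrow> v k"
      by (simp add: LIM_zero_iff)
    then show ?thesis
      using lim LIMSEQ_unique by blast
  qed
  then have "v = u" by (simp add: fun_eq_iff)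
  then show "u \<in> hcarrier V" and "(\<lambda>n. nrm (\<lambda>k. f n k - u k)) \<longlonglongrightarrow> 0"
    using vmem to0 by auto
qed

end

section \<open>Weighted square summable functions\<close>

definition weighted_ell2 :: "('k \<Rightarrow> real) \<Rightarrow> ('k \<Rightarrow> complex) inner_space" where
  "weighted_ell2 w = function_inner_space
     {u. (\<lambda>k. (w k * cmod (u k))\<^sup>2) summable_on UNIV}
     (\<lambda>u v. \<Sum>\<^sub>\<infinity>k. complex_of_real ((w k)\<^sup>2) * u k * cnj (v k))"

lemma weighted_ell2_simps [simp]:
  "u \<in> hcarrier (weighted_ell2 w) \<longleftrightarrow> (\<lambda>k. (w k * cmod (u k))\<^sup>2) summable_on UNIV"
  "hadd (weighted_ell2 w) u v = (\<lambda>k. u k + v k)"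
  "hscale (weighted_ell2 w) c u = (\<lambda>k. c * u k)"
  "hzero (weighted_ell2 w) = (\<lambda>k. 0)"
  "hinner (weighted_ell2 w) u v = (\<Sum>\<^sub>\<infinity>k. complex_of_real ((w k)\<^sup>2) * u k * cnj (v k))"
  by (auto simp: weighted_ell2_def function_inner_space_def)

lemma nonneg_summable_if_partial_sums_le:
  fixes f :: "'k \<Rightarrow> real"
  assumes "\<And>k. 0 \<le> f k" and "\<And>F. finite F \<Longrightarrow> sum f F \<le> B"
  shows "f summable_on UNIV" and "infsum f UNIV \<le> B"
proof -
  show "f summable_on UNIV"
    using assms by (intro nonneg_bdd_above_summable_on bdd_aboveI2) auto
  then show "infsum f UNIV \<le> B"
    using assms by (intro infsum_le_finite_sums) auto
qed

lemma sq_sum_le: "((x::real) + y)\<^sup>2 \<le> 2 * x\<^sup>2 + 2 * y\<^sup>2"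
  using zero_le_power2[of "x - y"] by (simp add: power2_eq_square algebra_simps)

lemma weighted_sq_add_le:
  fixes w :: real and a b :: complex
  assumes "0 \<le> w"
  shows "(w * cmod (a + b))\<^sup>2 \<le> 2 * (w * cmod a)\<^sup>2 + 2 * (w * cmod b)\<^sup>2"
proof -
  have "(w * cmod (a + b))\<^sup>2 \<le> (w * cmod a + w * cmod b)\<^sup>2"
    using assms by (intro power_mono) (auto simp: norm_triangle_ineq mult_left_mono simp flip: distrib_left)
  also note sq_sum_le
  finally show ?thesis .
qed

lemma weighted_ell2_add_mem:
  assumes "\<And>k. 0 \<le> w k" "u \<in> hcarrier (weighted_ell2 w)" "v \<in> hcarrier (weighted_ell2 w)"
  shows "(\<lambda>k. u k + v k) \<in> hcarrier (weighted_ell2 w)"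
  unfolding weighted_ell2_simps
proof (rule summable_on_comparison_test)
  show "(\<lambda>k. 2 * (w k * cmod (u k))\<^sup>2 + 2 * (w k * cmod (v k))\<^sup>2) summable_on UNIV"
    using assms by (intro summable_on_add summable_on_cmult_right) auto
qed (simp_all add: weighted_sq_add_le assms(1))

lemma weighted_ell2_inner_summable:
  assumes "u \<in> hcarrier (weighted_ell2 w)" "v \<in> hcarrier (weighted_ell2 w)"
  shows "(\<lambda>k. complex_of_real ((w k)\<^sup>2) * u k * cnj (v k)) summable_on UNIV"
proof (rule Infinite_Sum.abs_summable_summable, rule Infinite_Sum.abs_summable_on_comparison_test')
  show "(\<lambda>k. (w k * cmod (u k))\<^sup>2 + (w k * cmod (v k))\<^sup>2) summable_on UNIV"
    using assms by (intro summable_on_add) auto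
  fix k
  have "2 * cmod (complex_of_real ((w k)\<^sup>2) * u k * cnj (v k)) \<le> (w k * cmod (u k))\<^sup>2 + (w k * cmod (v k))\<^sup>2"
    using zero_le_power2[of "w k * cmod (u k) - w k * cmod (v k)"]
    by (simp add: norm_mult norm_power power2_eq_square algebra_simps)
  then show "cmod (complex_of_real ((w k)\<^sup>2) * u k * cnj (v k)) \<le> (w k * cmod (u k))\<^sup>2 + (w k * cmod (v k))\<^sup>2"
    using norm_ge_zero[of "complex_of_real ((w k)\<^sup>2) * u k * cnj (v k)"] by linarith
qed

text \<open>
  A real family and its complex image are summable together, and otherwise both sums are 0.
\<close>

lemma infsum_complex_of_real: "(\<Sum>\<^sub>\<infinity>x\<in>A. complex_of_real (f x)) = complex_of_real (infsum f A)"
proof (rule infsum_bounded_linear_strong)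
  show "(\<lambda>x. complex_of_real (f x)) summable_on A \<longleftrightarrow> f summable_on A"
    using summable_on_Re[of "\<lambda>x. complex_of_real (f x)" A] summable_on_of_real[of f A] by auto
qed (rule bounded_linear_of_real)

lemma weighted_ell2_inner_self:
  "hinner (weighted_ell2 w) u u = complex_of_real (\<Sum>\<^sub>\<infinity>k. (w k * cmod (u k))\<^sup>2)"
proof -
  have "complex_of_real ((w k)\<^sup>2) * u k * cnj (u k) = complex_of_real ((w k * cmod (u k))\<^sup>2)" for k
    using complex_norm_square[of "u k"] by (simp add: power_mult_distrib mult.assoc)
  then show ?thesis
    unfolding weighted_ell2_simps by (simp only: infsum_complex_of_real)
qed

lemma hnorm_weighted_ell2_sq:
  "(hnorm (weighted_ell2 w) u)\<^sup>2 = (\<Sum>\<^sub>\<infinity>k. (w k * cmod (u k))\<^sup>2)"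
  by (simp add: hnorm_def weighted_ell2_inner_self infsum_nonneg del: weighted_ell2_simps)

lemma hnorm_weighted_ell2_nonneg: "0 \<le> hnorm (weighted_ell2 w) u"
  by (simp add: hnorm_def weighted_ell2_inner_self infsum_nonneg del: weighted_ell2_simps)

lemma weighted_ell2_sum_le:
  assumes "u \<in> hcarrier (weighted_ell2 w)" "finite F"
  shows "(\<Sum>k\<in>F. (w k * cmod (u k))\<^sup>2) \<le> (hnorm (weighted_ell2 w) u)\<^sup>2"
  using assms unfolding hnorm_weighted_ell2_sq by (intro finite_sum_le_infsum) auto

text \<open>
  Together with \<open>weighted_ell2_sum_le\<close> this replaces infinite sums by uniform bounds on finite
  ones, which is how membership and norm bounds are obtained below.
\<close>

lemma weighted_ell2_memI:
  assumes "0 \<le> B" and "\<And>F. finite F \<Longrightarrow> (\<Sum>k\<in>F. (w k * cmod (u k))\<^sup>2) \<le> B\<^sup>2"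
  shows "u \<in> hcarrier (weighted_ell2 w)" and "hnorm (weighted_ell2 w) u \<le> B"
proof -
  have *: "(\<lambda>k. (w k * cmod (u k))\<^sup>2) summable_on UNIV" "(\<Sum>\<^sub>\<infinity>k. (w k * cmod (u k))\<^sup>2) \<le> B\<^sup>2"
    using nonneg_summable_if_partial_sums_le[of "\<lambda>k. (w k * cmod (u k))\<^sup>2" "B\<^sup>2"] assms(2) by simp_all
  show "u \<in> hcarrier (weighted_ell2 w)" using *(1) by simp
  show "hnorm (weighted_ell2 w) u \<le> B"
    by (rule power2_le_imp_le[OF _ assms(1)]) (simp only: hnorm_weighted_ell2_sq *(2))
qed

lemma weighted_ell2_eval_le:
  assumes "u \<in> hcarrier (weighted_ell2 w)"
  shows "w k * cmod (u k) \<le> hnorm (weighted_ell2 w) u"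
  using weighted_ell2_sum_le[OF assms, of "{k}"]
  by (intro power2_le_imp_le[OF _ hnorm_weighted_ell2_nonneg]) simp

locale positive_weight =
  fixes w :: "'k \<Rightarrow> real"
  assumes weight_pos: "\<And>k. 0 < w k"
begin

lemma weight_nonneg: "0 \<le> w k"
  using weight_pos less_imp_le by blast

lemma complex_inner_product_space_weighted_ell2: "complex_inner_product_space (weighted_ell2 w)"
proof
  fix x y z :: "'k \<Rightarrow> complex" and a c :: complex
  let ?C = "hcarrier (weighted_ell2 w)"
  show "hzero (weighted_ell2 w) \<in> ?C" by simp
  show "hadd (weighted_ell2 w) x y \<in> ?C" if "x \<in> ?C" "y \<in> ?C"
    using weighted_ell2_add_mem[OF weight_nonneg that] by simp
  show "hscale (weighted_ell2 w) c x \<in> ?C" if "x \<in> ?C"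
    using summable_on_cmult_right[of "\<lambda>k. (w k * cmod (x k))\<^sup>2" UNIV "(cmod c)\<^sup>2"] that
    by (simp add: norm_mult power_mult_distrib mult_ac)
  show "hinner (weighted_ell2 w) (hadd (weighted_ell2 w) x y) z =
      hinner (weighted_ell2 w) x z + hinner (weighted_ell2 w) y z"
    if "x \<in> ?C" "y \<in> ?C" "z \<in> ?C"
    using infsum_add[OF weighted_ell2_inner_summable[OF that(1,3)] weighted_ell2_inner_summable[OF that(2,3)]]
    by (simp add: algebra_simps)
  show "hinner (weighted_ell2 w) (hscale (weighted_ell2 w) c x) y = c * hinner (weighted_ell2 w) x y"
    if "x \<in> ?C" "y \<in> ?C"
    unfolding weighted_ell2_simps by (subst infsum_cmult_right'[symmetric]) (simp add: mult_ac)
  show "hinner (weighted_ell2 w) x y = cnj (hinner (weighted_ell2 w) y x)"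
    if "x \<in> ?C" "y \<in> ?C"
    unfolding weighted_ell2_simps by (subst infsum_cnj[symmetric]) (simp add: mult_ac)
  show "0 \<le> Re (hinner (weighted_ell2 w) x x)"
    by (simp add: weighted_ell2_inner_self infsum_nonneg del: weighted_ell2_simps)
  show "hinner (weighted_ell2 w) x x = 0 \<longleftrightarrow> x = hzero (weighted_ell2 w)" if "x \<in> ?C"
  proof
    assume "hinner (weighted_ell2 w) x x = 0"
    then have "(w k * cmod (x k))\<^sup>2 = 0" for k
      using that by (intro nonneg_infsum_le_0D[of "\<lambda>k. (w k * cmod (x k))\<^sup>2" UNIV])
        (auto simp: weighted_ell2_inner_self simp del: weighted_ell2_simps(5))
    then show "x = hzero (weighted_ell2 w)"
      using weight_pos by (auto simp: fun_eq_iff less_le)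
  qed simp
  show "hscale (weighted_ell2 w) (a + c) x = hadd (weighted_ell2 w) (hscale (weighted_ell2 w) a x) (hscale (weighted_ell2 w) c x)"
    by (simp add: distrib_right)
  show "hscale (weighted_ell2 w) a (hadd (weighted_ell2 w) x y) = hadd (weighted_ell2 w) (hscale (weighted_ell2 w) a x) (hscale (weighted_ell2 w) a y)"
    by (simp add: distrib_left)
  show "hadd (weighted_ell2 w) (hadd (weighted_ell2 w) x y) z = hadd (weighted_ell2 w) x (hadd (weighted_ell2 w) y z)"
    by (simp add: add.assoc)
  show "hadd (weighted_ell2 w) x y = hadd (weighted_ell2 w) y x"
    by (simp add: add.commute)
  show "hscale (weighted_ell2 w) a (hscale (weighted_ell2 w) c x) = hscale (weighted_ell2 w) (a * c) x"
    by (simp add: mult.assoc)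
  show "hadd (weighted_ell2 w) x (hzero (weighted_ell2 w)) = x"
    by simp
  show "hadd (weighted_ell2 w) x (hscale (weighted_ell2 w) (-1) x) = hzero (weighted_ell2 w)"
    by simp
  show "hscale (weighted_ell2 w) 1 x = x"
    by simp
qed

sublocale H: function_inner_product_space "weighted_ell2 w"
  unfolding function_inner_product_space_def function_inner_product_space_axioms_def
  by (intro conjI complex_inner_product_space_weighted_ell2) simp_all

lemma mcomplete_weighted_ell2: "H.metric.mcomplete"
  unfolding H.metric.mcomplete_def
proof (intro allI impI)
  fix f assume f: "H.metric.MCauchy f"
  have mem: "f n \<in> hcarrier (weighted_ell2 w)" for n
    using f unfolding H.metric.MCauchy_def by blast
  have close: "\<exists>N. \<forall>m\<ge>N. \<forall>n\<ge>N. H.nrm (\<lambda>k. f n k - f m k) < e" if e: "e > 0" for e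
  proof -
    obtain N where N: "\<And>n n'. N \<le> n \<Longrightarrow> N \<le> n' \<Longrightarrow> hdist (weighted_ell2 w) (f n) (f n') < e"
      using f e unfolding H.metric.MCauchy_def by blast
    have "H.nrm (\<lambda>k. f n k - f m k) < e" if "m \<ge> N" "n \<ge> N" for m n
      using N[OF that(2,1)] H.hdist_pointwise[OF mem mem, of n m] by simp
    then show ?thesis by blast
  qed
  have "Cauchy (\<lambda>n. f n k)" for k
    unfolding Cauchy_def dist_norm
  proof (intro allI impI)
    fix e :: real assume "e > 0"
    then have "w k * e > 0" using weight_pos by simp
    then obtain N where N: "\<forall>m\<ge>N. \<forall>n\<ge>N. H.nrm (\<lambda>k. f n k - f m k) < w k * e"
      using close by blast
    have "cmod (f m k - f n k) < e" if "m \<ge> N" "n \<ge> N" for m n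
    proof -
      have "w k * cmod (f m k - f n k) < w k * e"
        using weighted_ell2_eval_le[OF H.diff_mem[OF mem mem], where k = k] N that
        by (meson le_less_trans)
      then show ?thesis using weight_pos mult_less_cancel_left_pos by blast
    qed
    then show "\<exists>M. \<forall>m\<ge>M. \<forall>n\<ge>M. cmod (f m k - f n k) < e" by blast
  qed
  then have "\<exists>l. (\<lambda>n. f n k) \<longlonglongrightarrow> l" for k
    using Cauchy_convergent[of "\<lambda>n. f n k"] by (simp add: convergent_def)
  then obtain u where u: "\<And>k. (\<lambda>n. f n k) \<longlonglongrightarrow> u k"
    by metis
  \<comment> \<open>Fatou's argument: in a finite sum the second index of the Cauchy condition tends to infinity\<close>
  have tail: "\<exists>N. \<forall>m\<ge>N. (\<lambda>k. u k - f m k) \<in> hcarrier (weighted_ell2 w) \<and> H.nrm (\<lambda>k. u k - f m k) \<le> e"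
    if e: "e > 0" for e
  proof -
    obtain N where N: "\<And>m n. m \<ge> N \<Longrightarrow> n \<ge> N \<Longrightarrow> H.nrm (\<lambda>k. f n k - f m k) < e"
      using close[OF e] by blast
    have "(\<Sum>k\<in>F. (w k * cmod (u k - f m k))\<^sup>2) \<le> e\<^sup>2" if m: "m \<ge> N" and F: "finite F" for m F
    proof (rule LIMSEQ_le_const2)
      show "(\<lambda>n. \<Sum>k\<in>F. (w k * cmod (f n k - f m k))\<^sup>2) \<longlonglongrightarrow> (\<Sum>k\<in>F. (w k * cmod (u k - f m k))\<^sup>2)"
        by (intro tendsto_sum tendsto_power tendsto_mult tendsto_norm tendsto_diff tendsto_const u)
      have "(\<Sum>k\<in>F. (w k * cmod (f n k - f m k))\<^sup>2) \<le> e\<^sup>2" if "n \<ge> N" for n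
        using weighted_ell2_sum_le[OF H.diff_mem[OF mem mem] F, of n m]
          power_mono[OF less_imp_le[OF N[OF m that]] H.nrm_nonneg[OF H.diff_mem[OF mem mem]], of 2]
        by linarith
      then show "\<exists>N. \<forall>n\<ge>N. (\<Sum>k\<in>F. (w k * cmod (f n k - f m k))\<^sup>2) \<le> e\<^sup>2" by blast
    qed
    note bound = this
    have "(\<lambda>k. u k - f m k) \<in> hcarrier (weighted_ell2 w) \<and> H.nrm (\<lambda>k. u k - f m k) \<le> e"
      if "m \<ge> N" for m
      by (intro conjI weighted_ell2_memI[OF less_imp_le[OF e]] bound[OF that])
    then show ?thesis by (intro exI[of _ N]) simp
  qed
  from tail[OF zero_less_one] obtain N
    where "\<forall>m\<ge>N. (\<lambda>k. u k - f m k) \<in> hcarrier (weighted_ell2 w) \<and> H.nrm (\<lambda>k. u k - f m k) \<le> 1" ..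
  then have "(\<lambda>k. u k - f N k) \<in> hcarrier (weighted_ell2 w)"
    by (meson order_refl)
  then have "(\<lambda>k. (u k - f N k) + f N k) \<in> hcarrier (weighted_ell2 w)"
    by (rule H.add_mem[OF _ mem])
  then have umem: "u \<in> hcarrier (weighted_ell2 w)" by simp
  have "limitin H.metric.mtopology f u sequentially"
    unfolding H.metric.limit_metric_sequentially
  proof (intro conjI allI impI umem)
    fix e :: real assume "e > 0"
    then obtain N where N: "\<And>m. m \<ge> N \<Longrightarrow> H.nrm (\<lambda>k. u k - f m k) \<le> e / 2"
      using tail[OF half_gt_zero] by blast
    then have "hdist (weighted_ell2 w) (f m) u < e" if "m \<ge> N" for m
      using N[OF that] \<open>e > 0\<close> H.nrm_minus[OF umem mem, of m]
      by (simp add: H.hdist_pointwise mem umem del: weighted_ell2_simps)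
    then show "\<exists>N. \<forall>n\<ge>N. f n \<in> hcarrier (weighted_ell2 w) \<and> hdist (weighted_ell2 w) (f n) u < e"
      using mem by blast
  qed
  then show "\<exists>x. limitin H.metric.mtopology f x sequentially" by (rule exI[where x = u])
qed

lemma hilbert_space_weighted_ell2: "hilbert_space (weighted_ell2 w)"
  unfolding hilbert_space_def hilbert_space_axioms_def
  by (intro conjI complex_inner_product_space_weighted_ell2 mcomplete_weighted_ell2)

end

text \<open>
  A finite part of \<open>u\<close> carries all but \<open>e\<^sup>2 / 2\<close> of the squared norm, and its values are moved
  into \<open>D\<close> with a total squared error of at most \<open>e\<^sup>2 / 4\<close>.
\<close>

lemma (in positive_weight) finitely_supported_dense:
  assumes dense: "\<And>X. open X \<Longrightarrow> X \<noteq> {} \<Longrightarrow> \<exists>d\<in>D. d \<in> X"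
    and u: "u \<in> hcarrier (weighted_ell2 w)" and e: "e > 0"
  shows "\<exists>v F. finite F \<and> (\<forall>k\<in>F. v k \<in> D) \<and> (\<forall>k. k \<notin> F \<longrightarrow> v k = 0) \<and>
      (\<lambda>k. u k - v k) \<in> hcarrier (weighted_ell2 w) \<and> H.nrm (\<lambda>k. u k - v k) \<le> e"
proof -
  let ?f = "\<lambda>k. (w k * cmod (u k))\<^sup>2"
  have summ: "?f summable_on UNIV" using u by simp
  have e2: "e\<^sup>2/2 > 0" using e by simp
  obtain F where F: "finite F" and "dist (sum ?f F) (infsum ?f UNIV) \<le> e\<^sup>2/2"
    using infsum_finite_approximation[OF summ e2] by blast
  then have tail: "infsum ?f UNIV \<le> sum ?f F + e\<^sup>2/2"
    unfolding dist_real_def by linarith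
  define r where "r k = e / (2 * w k * sqrt (card F + 1))" for k
  have r_pos: "r k > 0" for k
    using e weight_pos by (simp add: r_def)
  have "\<exists>d\<in>D. cmod (u k - d) < r k" for k
  proof -
    have "ball (u k) (r k) \<noteq> {}" using r_pos[of k] by simp
    then have "\<exists>d\<in>D. d \<in> ball (u k) (r k)" by (intro dense open_ball)
    then show ?thesis by (simp add: dist_norm)
  qed
  then obtain d where d: "\<And>k. d k \<in> D" "\<And>k. cmod (u k - d k) < r k"
    by metis
  define v where "v k = (if k \<in> F then d k else 0)" for k
  have "(\<Sum>k\<in>G. (w k * cmod (u k - v k))\<^sup>2) \<le> e\<^sup>2" if "finite G" for G
  proof -
    have "(w k * cmod (u k - d k))\<^sup>2 \<le> (e\<^sup>2 / 4) / (card F + 1)" for k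
    proof -
      have "w k * cmod (u k - d k) \<le> w k * r k"
        using d(2)[of k] weight_pos[of k] by (simp add: mult_left_mono)
      also have "\<dots> = e / (2 * sqrt (card F + 1))"
        using weight_pos[of k] by (simp add: r_def)
      finally have "(w k * cmod (u k - d k))\<^sup>2 \<le> (e / (2 * sqrt (card F + 1)))\<^sup>2"
        using weight_pos[of k] by (intro power_mono) auto
      then show ?thesis by (simp add: power_divide power_mult_distrib)
    qed
    then have "(\<Sum>k\<in>G \<inter> F. (w k * cmod (u k - v k))\<^sup>2) \<le> of_nat (card (G \<inter> F)) * ((e\<^sup>2 / 4) / (card F + 1))"
      by (intro sum_bounded_above) (auto simp: v_def)
    also have "\<dots> \<le> of_nat (card F + 1) * ((e\<^sup>2 / 4) / (card F + 1))"
      using card_mono[OF F, of "G \<inter> F"] by (intro mult_right_mono) auto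
    also have "\<dots> = e\<^sup>2 / 4" by (simp add: field_simps)
    finally have 1: "(\<Sum>k\<in>G \<inter> F. (w k * cmod (u k - v k))\<^sup>2) \<le> e\<^sup>2 / 4" .
    have "(\<Sum>k\<in>G - F. (w k * cmod (u k - v k))\<^sup>2) + sum ?f F = sum ?f ((G - F) \<union> F)"
      using that F by (subst sum.union_disjoint) (auto simp: v_def)
    also have "\<dots> \<le> infsum ?f UNIV"
      using that F by (intro finite_sum_le_infsum summ) auto
    finally have "(\<Sum>k\<in>G - F. (w k * cmod (u k - v k))\<^sup>2) \<le> e\<^sup>2 / 2"
      using tail by linarith
    then have "(\<Sum>k\<in>G. (w k * cmod (u k - v k))\<^sup>2) \<le> e\<^sup>2 / 4 + e\<^sup>2 / 2"
      using 1 that by (subst sum.Int_Diff[of _ _ F]) auto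
    then show ?thesis using e2 by linarith
  qed
  note vb = this
  show ?thesis
  proof (intro exI[of _ v] exI[of _ F] conjI)
    show "(\<lambda>k. u k - v k) \<in> hcarrier (weighted_ell2 w)"
      by (rule weighted_ell2_memI(1)[OF less_imp_le[OF e]]) (rule vb)
    show "H.nrm (\<lambda>k. u k - v k) \<le> e"
      by (rule weighted_ell2_memI(2)[OF less_imp_le[OF e]]) (rule vb)
  qed (auto simp: F v_def d)
qed

lemma separable_hilbert_space_weighted_ell2:
  fixes w :: "'k::countable \<Rightarrow> real"
  assumes "\<And>k. 0 < w k"
  shows "separable_hilbert_space (weighted_ell2 w)"
proof -
  interpret positive_weight w by unfold_locales (rule assms)
  obtain D :: "complex set" where D: "countable D" "\<And>X. open X \<Longrightarrow> X \<noteq> {} \<Longrightarrow> \<exists>d\<in>D. d \<in> X"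
    by (rule countable_dense_setE) blast
  \<comment> \<open>association lists encode the finitely supported functions, which shows that these are countable\<close>
  define fn where "fn l = (\<lambda>k::'k. case map_of l k of None \<Rightarrow> 0 | Some d \<Rightarrow> (d::complex))" for l
  define U where "U = fn ` lists (UNIV \<times> D) \<inter> hcarrier (weighted_ell2 w)"
  have "countable U"
    using D(1) unfolding U_def by (intro countable_Int1 countable_image countable_lists) auto
  moreover have "U \<subseteq> topspace H.metric.mtopology"
    unfolding U_def H.metric.topspace_mtopology by (rule Int_lower2)
  moreover have "H.metric.mtopology closure_of U = topspace H.metric.mtopology"
  proof
    show "topspace H.metric.mtopology \<subseteq> H.metric.mtopology closure_of U"
    proof
      fix u assume "u \<in> topspace H.metric.mtopology"
      then have u: "u \<in> hcarrier (weighted_ell2 w)"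
        by (simp only: H.metric.topspace_mtopology)
      have "\<exists>v\<in>U. v \<in> H.metric.mball u r" if r: "r > 0" for r
      proof -
        obtain v F where v: "finite F" "\<forall>k\<in>F. v k \<in> D" "\<forall>k. k \<notin> F \<longrightarrow> v k = 0"
          "(\<lambda>k. u k - v k) \<in> hcarrier (weighted_ell2 w)" "H.nrm (\<lambda>k. u k - v k) \<le> r / 2"
          using finitely_supported_dense[OF D(2) u half_gt_zero[OF r]] by blast
        obtain l where l: "set l = F" using v(1) finite_list by blast
        have "map_of (map (\<lambda>k. (k, v k)) l) = (\<lambda>k. if k \<in> F then Some (v k) else None)"
          by (simp add: map_of_map_restrict l restrict_map_def fun_eq_iff)
        then have "v = fn (map (\<lambda>k. (k, v k)) l)"
          using v(3) by (auto simp: fn_def fun_eq_iff)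
        moreover have "map (\<lambda>k. (k, v k)) l \<in> lists (UNIV \<times> D)"
          using v(2) l by auto
        moreover have "v \<in> hcarrier (weighted_ell2 w)"
          using H.diff_mem[OF u v(4)] by simp
        ultimately show ?thesis
          using v(5) r u
          by (intro bexI[of _ v]) (auto simp: U_def H.hdist_pointwise simp del: weighted_ell2_simps)
      qed
      then show "u \<in> H.metric.mtopology closure_of U"
        using u unfolding H.metric.metric_closure_of by blast
    qed
  qed (rule closure_of_subset_topspace)
  ultimately show ?thesis
    using hilbert_space_weighted_ell2 unfolding separable_hilbert_space_def separable_space_def by blast
qed

section \<open>Norm equivalence and embeddings\<close>

lemma equal_up_to_norm_equivalence_refl: "equal_up_to_norm_equivalence V V"
  unfolding equal_up_to_norm_equivalence_def same_vector_space_def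
  by (intro conjI exI[of _ 1]) auto

lemma equal_up_to_norm_equivalence_sym:
  assumes "equal_up_to_norm_equivalence V W"
  shows "equal_up_to_norm_equivalence W V"
proof -
  obtain c C where cC: "c > 0" "C > 0"
    "\<And>x. x \<in> hcarrier V \<Longrightarrow> c * hnorm W x \<le> hnorm V x \<and> hnorm V x \<le> C * hnorm W x"
    using assms unfolding equal_up_to_norm_equivalence_def by blast
  have eq: "hcarrier W = hcarrier V"
    using assms by (simp add: equal_up_to_norm_equivalence_def same_vector_space_def)
  have "inverse C * hnorm V x \<le> hnorm W x \<and> hnorm W x \<le> inverse c * hnorm V x"
    if "x \<in> hcarrier W" for x
    using cC(1,2) cC(3)[of x] that eq by (simp add: field_simps)
  then have "\<exists>c>0. \<exists>C>0. \<forall>x\<in>hcarrier W. c * hnorm V x \<le> hnorm W x \<and> hnorm W x \<le> C * hnorm V x"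
    using cC(1,2) by (intro exI[of _ "inverse C"] exI[of _ "inverse c"] conjI ballI) auto
  then show ?thesis
    using assms by (simp add: equal_up_to_norm_equivalence_def same_vector_space_def)
qed

text \<open>
  Nonnegativity of the norm of \<open>V\<close> serves to replace the bound of \<open>T\<close>, whose sign is arbitrary,
  by its absolute value before the norms are exchanged.
\<close>

lemma bounded_linear_operator_norm_equivalence:
  assumes V: "complex_inner_product_space V"
    and eqV: "equal_up_to_norm_equivalence V V'" and eqW: "equal_up_to_norm_equivalence W W'"
    and T: "bounded_linear_operator V W T"
  shows "bounded_linear_operator V' W' T"
proof -
  obtain a where a: "a > 0" "\<And>x. x \<in> hcarrier V \<Longrightarrow> hnorm V x \<le> a * hnorm V' x"
    using eqV unfolding equal_up_to_norm_equivalence_def by blast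
  obtain b where b: "b > 0" "\<And>x. x \<in> hcarrier W \<Longrightarrow> b * hnorm W' x \<le> hnorm W x"
    using eqW unfolding equal_up_to_norm_equivalence_def by blast
  have eqs: "hcarrier V' = hcarrier V" "hcarrier W' = hcarrier W"
    "\<And>x y. x \<in> hcarrier V \<Longrightarrow> y \<in> hcarrier V \<Longrightarrow> hadd V' x y = hadd V x y"
    "\<And>x y. x \<in> hcarrier W \<Longrightarrow> y \<in> hcarrier W \<Longrightarrow> hadd W' x y = hadd W x y"
    "\<And>c x. x \<in> hcarrier V \<Longrightarrow> hscale V' c x = hscale V c x"
    "\<And>c x. x \<in> hcarrier W \<Longrightarrow> hscale W' c x = hscale W c x"
    using eqV eqW by (auto simp: equal_up_to_norm_equivalence_def same_vector_space_def)
  obtain C where C: "\<And>x. x \<in> hcarrier V \<Longrightarrow> hnorm W (T x) \<le> C * hnorm V x"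
    using T unfolding bounded_linear_operator_def by blast
  have Tmem: "T x \<in> hcarrier W" if "x \<in> hcarrier V" for x
    using T that unfolding bounded_linear_operator_def by blast
  have "hnorm W' (T x) \<le> (\<bar>C\<bar> * a / b) * hnorm V' x" if x: "x \<in> hcarrier V" for x
  proof -
    have "0 \<le> hnorm V x"
      using complex_inner_product_space.inner_nonneg[OF V x] by (simp add: hnorm_def)
    then have "C * hnorm V x \<le> \<bar>C\<bar> * hnorm V x"
      by (intro mult_right_mono) auto
    also have "\<dots> \<le> \<bar>C\<bar> * (a * hnorm V' x)"
      using a(2)[OF x] by (intro mult_left_mono) auto
    finally have "b * hnorm W' (T x) \<le> \<bar>C\<bar> * (a * hnorm V' x)"
      using b(2)[OF Tmem[OF x]] C[OF x] by linarith
    then show ?thesis using b(1) by (simp add: field_simps)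
  qed
  then have "\<exists>C. \<forall>x\<in>hcarrier V. hnorm W' (T x) \<le> C * hnorm V' x" by blast
  then show ?thesis
    using T unfolding bounded_linear_operator_def by (simp add: eqs Pi_iff)
qed

lemma equal_up_to_norm_equivalence_trans:
  assumes UV: "equal_up_to_norm_equivalence U V" and VW: "equal_up_to_norm_equivalence V W"
  shows "equal_up_to_norm_equivalence U W"
proof -
  obtain a A where A: "a > 0" "A > 0"
    "\<And>x. x \<in> hcarrier U \<Longrightarrow> a * hnorm V x \<le> hnorm U x \<and> hnorm U x \<le> A * hnorm V x"
    using UV unfolding equal_up_to_norm_equivalence_def by blast
  obtain b B where B: "b > 0" "B > 0"
    "\<And>x. x \<in> hcarrier V \<Longrightarrow> b * hnorm W x \<le> hnorm V x \<and> hnorm V x \<le> B * hnorm W x"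
    using VW unfolding equal_up_to_norm_equivalence_def by blast
  have carrier: "hcarrier U = hcarrier V"
    using UV by (simp add: equal_up_to_norm_equivalence_def same_vector_space_def)
  have "(a * b) * hnorm W x \<le> hnorm U x \<and> hnorm U x \<le> (A * B) * hnorm W x"
    if x: "x \<in> hcarrier U" for x
  proof -
    have xV: "x \<in> hcarrier V" using x carrier by simp
    show ?thesis
      using A(3)[OF x] mult_left_mono[OF conjunct1[OF B(3)[OF xV]] less_imp_le[OF A(1)]]
        mult_left_mono[OF conjunct2[OF B(3)[OF xV]] less_imp_le[OF A(2)]]
      by (simp add: mult.assoc)
  qed
  moreover have "0 < a * b" "0 < A * B" using A B by simp_all
  ultimately have "\<exists>c>0. \<exists>C>0. \<forall>x\<in>hcarrier U. c * hnorm W x \<le> hnorm U x \<and> hnorm U x \<le> C * hnorm W x"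
    by blast
  moreover have "same_vector_space U W"
    using UV VW by (simp add: equal_up_to_norm_equivalence_def same_vector_space_def)
  ultimately show ?thesis
    unfolding equal_up_to_norm_equivalence_def by blast
qed

lemma interpolation_space_norm_equivalence:
  assumes W: "interpolation_space H0 H1 W" and S: "hilbert_space S"
    and eq: "equal_up_to_norm_equivalence W S"
  shows "interpolation_space H0 H1 S"
proof -
  have H1: "hilbert_space H1" and Wh: "hilbert_space W"
    using W by (auto simp: interpolation_space_def admissible_pair_def separable_hilbert_space_def)
  note inner = hilbert_space.axioms(1)[OF H1] hilbert_space.axioms(1)[OF Wh]
  have "continuous_embedding H1 S"
    using W bounded_linear_operator_norm_equivalence[OF inner(1) equal_up_to_norm_equivalence_refl eq]
    unfolding interpolation_space_def continuous_embedding_def by blast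
  moreover have "continuous_embedding S H0"
    using W bounded_linear_operator_norm_equivalence[OF inner(2) eq equal_up_to_norm_equivalence_refl]
    unfolding interpolation_space_def continuous_embedding_def by blast
  moreover have "bounded_linear_operator S S T" if "bounded_linear_operator W W T" for T
    by (rule bounded_linear_operator_norm_equivalence[OF inner(2) eq eq that])
  ultimately show ?thesis
    using W S unfolding interpolation_space_def by blast
qed

lemma continuous_embedding_weighted_ell2:
  assumes v: "\<And>k. 0 \<le> v k" and le: "\<And>k. v k \<le> C * w k" and C: "0 \<le> C"
  shows "continuous_embedding (weighted_ell2 w) (weighted_ell2 v)"
proof -
  have bound: "(\<Sum>k\<in>F. (v k * cmod (u k))\<^sup>2) \<le> (C * hnorm (weighted_ell2 w) u)\<^sup>2"
    if u: "u \<in> hcarrier (weighted_ell2 w)" and F: "finite F" for u F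
  proof -
    have "(\<Sum>k\<in>F. (v k * cmod (u k))\<^sup>2) \<le> (\<Sum>k\<in>F. C\<^sup>2 * (w k * cmod (u k))\<^sup>2)"
    proof (intro sum_mono)
      fix k
      have "v k * cmod (u k) \<le> C * (w k * cmod (u k))"
        using mult_right_mono[OF le[of k], of "cmod (u k)"] by (simp add: mult.assoc)
      then have "(v k * cmod (u k))\<^sup>2 \<le> (C * (w k * cmod (u k)))\<^sup>2"
        using v[of k] by (intro power_mono) auto
      then show "(v k * cmod (u k))\<^sup>2 \<le> C\<^sup>2 * (w k * cmod (u k))\<^sup>2"
        by (simp only: power_mult_distrib)
    qed
    also have "\<dots> = C\<^sup>2 * (\<Sum>k\<in>F. (w k * cmod (u k))\<^sup>2)"
      by (simp only: sum_distrib_left)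
    also have "\<dots> \<le> C\<^sup>2 * (hnorm (weighted_ell2 w) u)\<^sup>2"
      by (intro mult_left_mono weighted_ell2_sum_le[OF u F]) simp
    finally show ?thesis by (simp only: power_mult_distrib)
  qed
  have "u \<in> hcarrier (weighted_ell2 v) \<and> hnorm (weighted_ell2 v) u \<le> C * hnorm (weighted_ell2 w) u"
    if u: "u \<in> hcarrier (weighted_ell2 w)" for u
    by (intro conjI weighted_ell2_memI[where B = "C * hnorm (weighted_ell2 w) u"] mult_nonneg_nonneg C hnorm_weighted_ell2_nonneg bound[OF u])
  then have "(\<lambda>x. x) \<in> hcarrier (weighted_ell2 w) \<rightarrow> hcarrier (weighted_ell2 v)"
    "\<exists>C. \<forall>x\<in>hcarrier (weighted_ell2 w). hnorm (weighted_ell2 v) x \<le> C * hnorm (weighted_ell2 w) x"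
    by blast+
  then show ?thesis
    unfolding continuous_embedding_def bounded_linear_operator_def
    by (simp add: weighted_ell2_simps(2,3) del: weighted_ell2_simps(1))
qed

lemma equal_up_to_norm_equivalence_weighted_ell2:
  assumes v: "\<And>k. 0 \<le> v k" and w: "\<And>k. 0 \<le> w k" and C: "0 < C" and D: "0 < D"
    and vw: "\<And>k. v k \<le> C * w k" and wv: "\<And>k. w k \<le> D * v k"
  shows "equal_up_to_norm_equivalence (weighted_ell2 v) (weighted_ell2 w)"
proof -
  have emb: "continuous_embedding (weighted_ell2 w) (weighted_ell2 v)"
    "continuous_embedding (weighted_ell2 v) (weighted_ell2 w)"
    by (rule continuous_embedding_weighted_ell2[OF v vw less_imp_le[OF C]],
        rule continuous_embedding_weighted_ell2[OF w wv less_imp_le[OF D]])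
  then have carrier: "hcarrier (weighted_ell2 v) = hcarrier (weighted_ell2 w)"
    unfolding continuous_embedding_def bounded_linear_operator_def by blast
  obtain A where A: "\<And>u. u \<in> hcarrier (weighted_ell2 w) \<Longrightarrow> hnorm (weighted_ell2 v) u \<le> A * hnorm (weighted_ell2 w) u"
    using emb(1) unfolding continuous_embedding_def bounded_linear_operator_def by blast
  obtain B where B: "\<And>u. u \<in> hcarrier (weighted_ell2 v) \<Longrightarrow> hnorm (weighted_ell2 w) u \<le> B * hnorm (weighted_ell2 v) u"
    using emb(2) unfolding continuous_embedding_def bounded_linear_operator_def by blast
  have "inverse (\<bar>B\<bar> + 1) * hnorm (weighted_ell2 w) u \<le> hnorm (weighted_ell2 v) u \<and>
      hnorm (weighted_ell2 v) u \<le> (\<bar>A\<bar> + 1) * hnorm (weighted_ell2 w) u"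
    if u: "u \<in> hcarrier (weighted_ell2 v)" for u
  proof
    have "A * hnorm (weighted_ell2 w) u \<le> (\<bar>A\<bar> + 1) * hnorm (weighted_ell2 w) u"
      by (intro mult_right_mono hnorm_weighted_ell2_nonneg) simp
    then show "hnorm (weighted_ell2 v) u \<le> (\<bar>A\<bar> + 1) * hnorm (weighted_ell2 w) u"
      using A[of u] u unfolding carrier by linarith
    have "B * hnorm (weighted_ell2 v) u \<le> (\<bar>B\<bar> + 1) * hnorm (weighted_ell2 v) u"
      by (intro mult_right_mono hnorm_weighted_ell2_nonneg) simp
    then have "hnorm (weighted_ell2 w) u \<le> (\<bar>B\<bar> + 1) * hnorm (weighted_ell2 v) u"
      using B[OF u] by linarith
    moreover have "0 < \<bar>B\<bar> + 1" by simp
    ultimately show "inverse (\<bar>B\<bar> + 1) * hnorm (weighted_ell2 w) u \<le> hnorm (weighted_ell2 v) u"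
      by (simp add: field_simps)
  qed
  moreover have "0 < inverse (\<bar>B\<bar> + 1)" "0 < \<bar>A\<bar> + 1" by (auto simp: add_nonneg_pos)
  ultimately have "\<exists>c>0. \<exists>C>0. \<forall>u\<in>hcarrier (weighted_ell2 v).
      c * hnorm (weighted_ell2 w) u \<le> hnorm (weighted_ell2 v) u \<and>
      hnorm (weighted_ell2 v) u \<le> C * hnorm (weighted_ell2 w) u"
    by blast
  then show ?thesis
    unfolding equal_up_to_norm_equivalence_def same_vector_space_def
    by (intro conjI carrier) simp_all
qed

section \<open>Operators bounded on both end spaces\<close>

text \<open>
  The operator norm for the weight \<open>sqrt h * w\<close> is at most \<open>sqrt B\<close>. In this squared form the
  bounds for different \<open>h\<close> can be added. Only functions that also lie in the space of weight \<open>w\<close>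
  are considered, since \<open>T\<close> is linear there, and the left side consists of finite sums, so that a
  bound implies the summability of the image.
\<close>

definition energy_dominated ::
    "('k \<Rightarrow> real) \<Rightarrow> (('k \<Rightarrow> complex) \<Rightarrow> ('k \<Rightarrow> complex)) \<Rightarrow> real \<Rightarrow> ('k \<Rightarrow> real) \<Rightarrow> bool" where
  "energy_dominated w T B h \<longleftrightarrow> (\<forall>k. 0 \<le> h k) \<and>
     (\<forall>u\<in>hcarrier (weighted_ell2 w). (\<lambda>k. h k * (w k * cmod (u k))\<^sup>2) summable_on UNIV \<longrightarrow>
       (\<forall>F. finite F \<longrightarrow> (\<Sum>k\<in>F. h k * (w k * cmod (T u k))\<^sup>2)
          \<le> B * (\<Sum>\<^sub>\<infinity>k. h k * (w k * cmod (u k))\<^sup>2)))"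

lemma energy_dominatedI:
  assumes "\<And>k. 0 \<le> h k"
    and "\<And>u F. u \<in> hcarrier (weighted_ell2 w) \<Longrightarrow> (\<lambda>k. h k * (w k * cmod (u k))\<^sup>2) summable_on UNIV
        \<Longrightarrow> finite F \<Longrightarrow> (\<Sum>k\<in>F. h k * (w k * cmod (T u k))\<^sup>2)
          \<le> B * (\<Sum>\<^sub>\<infinity>k. h k * (w k * cmod (u k))\<^sup>2)"
  shows "energy_dominated w T B h"
  unfolding energy_dominated_def using assms by blast

lemma energy_dominatedD:
  assumes "energy_dominated w T B h"
  shows "0 \<le> h k"
    and "u \<in> hcarrier (weighted_ell2 w) \<Longrightarrow> (\<lambda>k. h k * (w k * cmod (u k))\<^sup>2) summable_on UNIV
        \<Longrightarrow> finite F \<Longrightarrow> (\<Sum>k\<in>F. h k * (w k * cmod (T u k))\<^sup>2)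
          \<le> B * (\<Sum>\<^sub>\<infinity>k. h k * (w k * cmod (u k))\<^sup>2)"
  using assms unfolding energy_dominated_def by blast+

lemma energy_dominated_add:
  assumes h: "energy_dominated w T B h" and h': "energy_dominated w T B h'"
  shows "energy_dominated w T B (\<lambda>k. h k + h' k)"
proof (rule energy_dominatedI)
  note nonneg = energy_dominatedD(1)[OF h] energy_dominatedD(1)[OF h']
  show "0 \<le> h k + h' k" for k using nonneg by simp
  fix u F
  assume u: "u \<in> hcarrier (weighted_ell2 w)" and F: "finite (F :: 'a set)"
    and s: "(\<lambda>k. (h k + h' k) * (w k * cmod (u k))\<^sup>2) summable_on UNIV"
  have s1: "(\<lambda>k. h k * (w k * cmod (u k))\<^sup>2) summable_on UNIV"
    by (rule summable_on_comparison_test[OF s]) (auto intro!: mult_right_mono mult_nonneg_nonneg simp: nonneg)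
  have s2: "(\<lambda>k. h' k * (w k * cmod (u k))\<^sup>2) summable_on UNIV"
    by (rule summable_on_comparison_test[OF s]) (auto intro!: mult_right_mono mult_nonneg_nonneg simp: nonneg)
  show "(\<Sum>k\<in>F. (h k + h' k) * (w k * cmod (T u k))\<^sup>2)
      \<le> B * (\<Sum>\<^sub>\<infinity>k. (h k + h' k) * (w k * cmod (u k))\<^sup>2)"
    using energy_dominatedD(2)[OF h u s1 F] energy_dominatedD(2)[OF h' u s2 F] infsum_add[OF s1 s2]
    by (simp add: distrib_right sum.distrib distrib_left)
qed

lemma energy_dominated_scale:
  assumes h: "energy_dominated w T B h" and a: "0 \<le> a"
  shows "energy_dominated w T B (\<lambda>k. a * h k)"
proof (rule energy_dominatedI)
  show "0 \<le> a * h k" for k using energy_dominatedD(1)[OF h] a by simp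
  fix u F
  assume u: "u \<in> hcarrier (weighted_ell2 w)" and F: "finite (F :: 'a set)"
    and s: "(\<lambda>k. a * h k * (w k * cmod (u k))\<^sup>2) summable_on UNIV"
  show "(\<Sum>k\<in>F. a * h k * (w k * cmod (T u k))\<^sup>2) \<le> B * (\<Sum>\<^sub>\<infinity>k. a * h k * (w k * cmod (u k))\<^sup>2)"
  proof (cases "a = 0")
    case False
    then have "(\<lambda>k. h k * (w k * cmod (u k))\<^sup>2) summable_on UNIV"
      using s summable_on_cmult_right'[OF False, of "\<lambda>k. h k * (w k * cmod (u k))\<^sup>2"]
      by (simp add: mult.assoc)
    from mult_left_mono[OF energy_dominatedD(2)[OF h u this F] a] show ?thesis
      by (simp add: mult.assoc infsum_cmult_right' mult.left_commute[of B a] flip: sum_distrib_left)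
  qed simp
qed

text \<open>
  For \<open>h n\<close> that increase to \<open>g\<close> it is enough that each value becomes stationary, because the left
  side of the bound only involves finitely many points.
\<close>

lemma energy_dominated_limit:
  fixes h :: "nat \<Rightarrow> 'k \<Rightarrow> real"
  assumes h: "\<And>n. energy_dominated w T B (h n)" and B: "0 \<le> B"
    and le: "\<And>n k. h n k \<le> g k" and eq: "\<And>n k. \<iota> k \<le> n \<Longrightarrow> h n k = g k"
  shows "energy_dominated w T B g"
proof (rule energy_dominatedI)
  show g: "0 \<le> g k" for k using energy_dominatedD(1)[OF h] le order_trans by blast
  fix u F
  assume u: "u \<in> hcarrier (weighted_ell2 w)" and F: "finite (F :: 'k set)"
    and s: "(\<lambda>k. g k * (w k * cmod (u k))\<^sup>2) summable_on UNIV"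
  define N where "N = Max (insert 0 (\<iota> ` F))"
  have N: "\<iota> k \<le> N" if "k \<in> F" for k
    unfolding N_def using F that by (intro Max_ge) auto
  have sN: "(\<lambda>k. h N k * (w k * cmod (u k))\<^sup>2) summable_on UNIV"
    by (rule summable_on_comparison_test[OF s])
      (auto intro!: mult_right_mono mult_nonneg_nonneg le energy_dominatedD(1)[OF h])
  have "(\<Sum>k\<in>F. g k * (w k * cmod (T u k))\<^sup>2) = (\<Sum>k\<in>F. h N k * (w k * cmod (T u k))\<^sup>2)"
    by (intro sum.cong refl) (simp add: eq[OF N])
  also have "\<dots> \<le> B * (\<Sum>\<^sub>\<infinity>k. h N k * (w k * cmod (u k))\<^sup>2)"
    by (rule energy_dominatedD(2)[OF h u sN F])
  also have "\<dots> \<le> B * (\<Sum>\<^sub>\<infinity>k. g k * (w k * cmod (u k))\<^sup>2)"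
    by (intro mult_left_mono infsum_mono sN s B mult_right_mono le) auto
  finally show "(\<Sum>k\<in>F. g k * (w k * cmod (T u k))\<^sup>2) \<le> B * (\<Sum>\<^sub>\<infinity>k. g k * (w k * cmod (u k))\<^sup>2)" .
qed

lemma bounded_linear_operator_weighted_sum_le:
  assumes T: "bounded_linear_operator (weighted_ell2 w) (weighted_ell2 w) T"
  obtains M where "0 \<le> M"
    "\<And>u F. u \<in> hcarrier (weighted_ell2 w) \<Longrightarrow> finite F \<Longrightarrow>
       (\<Sum>k\<in>F. (w k * cmod (T u k))\<^sup>2) \<le> M * (\<Sum>\<^sub>\<infinity>k. (w k * cmod (u k))\<^sup>2)"
proof -
  obtain C where C: "\<And>u. u \<in> hcarrier (weighted_ell2 w) \<Longrightarrow>
      hnorm (weighted_ell2 w) (T u) \<le> C * hnorm (weighted_ell2 w) u"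
    using T unfolding bounded_linear_operator_def by blast
  have "(\<Sum>k\<in>F. (w k * cmod (T u k))\<^sup>2) \<le> C\<^sup>2 * (\<Sum>\<^sub>\<infinity>k. (w k * cmod (u k))\<^sup>2)"
    if u: "u \<in> hcarrier (weighted_ell2 w)" and F: "finite F" for u F
  proof -
    have "T u \<in> hcarrier (weighted_ell2 w)"
      using T u unfolding bounded_linear_operator_def by blast
    then have "(\<Sum>k\<in>F. (w k * cmod (T u k))\<^sup>2) \<le> (hnorm (weighted_ell2 w) (T u))\<^sup>2"
      by (rule weighted_ell2_sum_le[OF _ F])
    also have "\<dots> \<le> (C * hnorm (weighted_ell2 w) u)\<^sup>2"
      by (rule power_mono[OF C[OF u] hnorm_weighted_ell2_nonneg])
    finally show ?thesis by (simp only: power_mult_distrib hnorm_weighted_ell2_sq)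
  qed
  then show thesis by (rule that[OF zero_le_power2])
qed

text \<open>
  For \<open>h = min \<rho> r\<close> with \<open>\<rho> = (w1 / w0)\<^sup>2\<close>, the part \<open>p\<close> of \<open>u\<close> where \<open>\<rho> \<le> r\<close> lies in
  the space of weight \<open>w1\<close>, and there \<open>h * w0\<^sup>2 = w1\<^sup>2\<close>; on the rest \<open>q\<close> of \<open>u\<close> one has
  \<open>h * w0\<^sup>2 = r * w0\<^sup>2\<close>. So the energy of \<open>u\<close> is exactly \<open>\<parallel>p\<parallel>\<^sup>2 + r * \<parallel>q\<parallel>\<^sup>2\<close> in the norms
  of the two end spaces, while the energy of \<open>T u = T p + T q\<close> is at most twice the corresponding
  sum for \<open>T p\<close> and \<open>T q\<close>, as \<open>h \<le> \<rho>\<close> and \<open>h \<le> r\<close>. The constant is independent of \<open>r\<close>.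
\<close>

lemma energy_dominated_one_and_min:
  assumes w0: "\<And>k. 0 < w0 k" and w1: "\<And>k. 0 < w1 k"
    and T0: "bounded_linear_operator (weighted_ell2 w0) (weighted_ell2 w0) T"
    and T1: "bounded_linear_operator (weighted_ell2 w1) (weighted_ell2 w1) T"
  obtains B where "0 \<le> B" "energy_dominated w0 T B (\<lambda>k. 1)"
    "\<And>r. 0 < r \<Longrightarrow> energy_dominated w0 T B (\<lambda>k. min ((w1 k / w0 k)\<^sup>2) r)"
proof -
  obtain M0 where M0: "0 \<le> M0" "\<And>u F. u \<in> hcarrier (weighted_ell2 w0) \<Longrightarrow> finite F \<Longrightarrow>
       (\<Sum>k\<in>F. (w0 k * cmod (T u k))\<^sup>2) \<le> M0 * (\<Sum>\<^sub>\<infinity>k. (w0 k * cmod (u k))\<^sup>2)"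
    using bounded_linear_operator_weighted_sum_le[OF T0] by blast
  obtain M1 where M1: "0 \<le> M1" "\<And>u F. u \<in> hcarrier (weighted_ell2 w1) \<Longrightarrow> finite F \<Longrightarrow>
       (\<Sum>k\<in>F. (w1 k * cmod (T u k))\<^sup>2) \<le> M1 * (\<Sum>\<^sub>\<infinity>k. (w1 k * cmod (u k))\<^sup>2)"
    using bounded_linear_operator_weighted_sum_le[OF T1] by blast
  define B where "B = 2 * max M0 M1"
  have B: "0 \<le> B" "M0 \<le> B" "2 * M0 \<le> B" "2 * M1 \<le> B"
    using M0(1) M1(1) by (auto simp: B_def)
  have one: "energy_dominated w0 T B (\<lambda>k. 1)"
  proof (rule energy_dominatedI)
    fix u F assume u: "u \<in> hcarrier (weighted_ell2 w0)" and F: "finite (F :: 'a set)"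
    have "M0 * (\<Sum>\<^sub>\<infinity>k. (w0 k * cmod (u k))\<^sup>2) \<le> B * (\<Sum>\<^sub>\<infinity>k. (w0 k * cmod (u k))\<^sup>2)"
      by (intro mult_right_mono B infsum_nonneg) auto
    then show "(\<Sum>k\<in>F. 1 * (w0 k * cmod (T u k))\<^sup>2) \<le> B * (\<Sum>\<^sub>\<infinity>k. 1 * (w0 k * cmod (u k))\<^sup>2)"
      using M0(2)[OF u F] by simp
  qed simp
  have "energy_dominated w0 T B (\<lambda>k. min ((w1 k / w0 k)\<^sup>2) r)" if r: "0 < r" for r
  proof (rule energy_dominatedI)
    let ?\<rho> = "\<lambda>k. (w1 k / w0 k)\<^sup>2"
    fix u F assume u: "u \<in> hcarrier (weighted_ell2 w0)" and F: "finite (F :: 'a set)"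
    have \<rho>: "?\<rho> k * (w0 k * a)\<^sup>2 = (w1 k * a)\<^sup>2" for k a
      using w0[of k] by (simp add: power_mult_distrib power_divide)
    define p where "p k = (if ?\<rho> k \<le> r then u k else 0)" for k
    define q where "q k = (if ?\<rho> k \<le> r then 0 else u k)" for k
    have u_sum: "u = (\<lambda>k. p k + q k)"
      by (auto simp: p_def q_def)
    have s0: "(\<lambda>k. (w0 k * cmod (u k))\<^sup>2) summable_on UNIV" using u by simp
    have p0: "p \<in> hcarrier (weighted_ell2 w0)" and q0: "q \<in> hcarrier (weighted_ell2 w0)"
      unfolding weighted_ell2_simps
      by (rule summable_on_comparison_test[OF s0]; simp add: p_def q_def)+
    have p1: "p \<in> hcarrier (weighted_ell2 w1)"
      unfolding weighted_ell2_simps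
    proof (rule summable_on_comparison_test[OF summable_on_cmult_right[OF s0, of r]])
      fix k
      have "(w1 k * cmod (u k))\<^sup>2 \<le> r * (w0 k * cmod (u k))\<^sup>2" if "?\<rho> k \<le> r"
        using mult_right_mono[OF that, of "(w0 k * cmod (u k))\<^sup>2"] \<rho>[of k "cmod (u k)"] by simp
      then show "(w1 k * cmod (p k))\<^sup>2 \<le> r * (w0 k * cmod (u k))\<^sup>2"
        using r by (auto simp: p_def)
    qed simp
    have "T u = (\<lambda>k. T p k + T q k)"
    proof -
      have "T (hadd (weighted_ell2 w0) p q) = hadd (weighted_ell2 w0) (T p) (T q)"
        using T0 p0 q0 unfolding bounded_linear_operator_def by blast
      then show ?thesis by (simp add: u_sum)
    qed
    then have pointwise: "min (?\<rho> k) r * (w0 k * cmod (T u k))\<^sup>2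
        \<le> 2 * (w1 k * cmod (T p k))\<^sup>2 + 2 * r * (w0 k * cmod (T q k))\<^sup>2" for k
    proof -
      let ?m = "min (?\<rho> k) r"
      have m: "0 \<le> ?m" using r by simp
      have "?m * (w0 k * cmod (T u k))\<^sup>2 \<le> ?m * (2 * (w0 k * cmod (T p k))\<^sup>2 + 2 * (w0 k * cmod (T q k))\<^sup>2)"
        using \<open>T u = _\<close> weighted_sq_add_le[of "w0 k" "T p k" "T q k"] w0[of k]
        by (intro mult_left_mono m) (auto simp: less_imp_le)
      also have "\<dots> = 2 * (?m * (w0 k * cmod (T p k))\<^sup>2) + 2 * (?m * (w0 k * cmod (T q k))\<^sup>2)"
        by (simp add: algebra_simps)
      also have "\<dots> \<le> 2 * (?\<rho> k * (w0 k * cmod (T p k))\<^sup>2) + 2 * (r * (w0 k * cmod (T q k))\<^sup>2)"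
        by (intro add_mono mult_left_mono mult_right_mono) auto
      finally show ?thesis by (simp only: \<rho> mult.assoc)
    qed
    have sp: "(\<lambda>k. (w1 k * cmod (p k))\<^sup>2) summable_on UNIV" using p1 by simp
    have sq: "(\<lambda>k. r * (w0 k * cmod (q k))\<^sup>2) summable_on UNIV"
      using q0 by (intro summable_on_cmult_right) simp
    have "(\<Sum>k\<in>F. min (?\<rho> k) r * (w0 k * cmod (T u k))\<^sup>2)
        \<le> 2 * (\<Sum>k\<in>F. (w1 k * cmod (T p k))\<^sup>2) + 2 * r * (\<Sum>k\<in>F. (w0 k * cmod (T q k))\<^sup>2)"
      using sum_mono[where K = F, OF pointwise] by (simp add: sum.distrib sum_distrib_left)
    also have "\<dots> \<le> 2 * (M1 * (\<Sum>\<^sub>\<infinity>k. (w1 k * cmod (p k))\<^sup>2)) + 2 * r * (M0 * (\<Sum>\<^sub>\<infinity>k. (w0 k * cmod (q k))\<^sup>2))"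
      using r by (intro add_mono mult_left_mono M1(2)[OF p1 F] M0(2)[OF q0 F]) auto
    also have "\<dots> = (2 * M1) * (\<Sum>\<^sub>\<infinity>k. (w1 k * cmod (p k))\<^sup>2) + (2 * M0) * (\<Sum>\<^sub>\<infinity>k. r * (w0 k * cmod (q k))\<^sup>2)"
      by (simp add: infsum_cmult_right')
    also have "\<dots> \<le> B * (\<Sum>\<^sub>\<infinity>k. (w1 k * cmod (p k))\<^sup>2) + B * (\<Sum>\<^sub>\<infinity>k. r * (w0 k * cmod (q k))\<^sup>2)"
      using r by (intro add_mono mult_right_mono B infsum_nonneg) auto
    also have "\<dots> = B * (\<Sum>\<^sub>\<infinity>k. (w1 k * cmod (p k))\<^sup>2 + r * (w0 k * cmod (q k))\<^sup>2)"
      by (simp add: infsum_add[OF sp sq] distrib_left)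
    also have "(\<lambda>k. (w1 k * cmod (p k))\<^sup>2 + r * (w0 k * cmod (q k))\<^sup>2) = (\<lambda>k. min (?\<rho> k) r * (w0 k * cmod (u k))\<^sup>2)"
    proof
      fix k
      show "(w1 k * cmod (p k))\<^sup>2 + r * (w0 k * cmod (q k))\<^sup>2 = min (?\<rho> k) r * (w0 k * cmod (u k))\<^sup>2"
        using \<rho>[of k "cmod (u k)"] by (cases "?\<rho> k \<le> r") (simp_all add: p_def q_def min_def)
    qed
    finally show "(\<Sum>k\<in>F. min (?\<rho> k) r * (w0 k * cmod (T u k))\<^sup>2)
        \<le> B * (\<Sum>\<^sub>\<infinity>k. min (?\<rho> k) r * (w0 k * cmod (u k))\<^sup>2)" .
  qed (use r in auto)
  then show thesis using that[OF B(1) one] by blast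
qed

text \<open>
  A concave sequence \<open>a\<close> over the nodes \<open>x\<close>, frozen from the index \<open>n\<close> on, is a nonnegative
  combination of a constant and of the functions \<open>min (x i) (x m)\<close> with \<open>m \<le> n\<close>: the
  coefficients are the decrements of the slopes and, for \<open>m = n\<close>, the last slope. The constant is
  nonnegative by the hypothesis on \<open>a 0\<close> and \<open>a 1\<close>, which says that the line through the first
  two points meets the vertical axis at a nonnegative height.
\<close>

lemma energy_dominated_concave:
  fixes x a :: "nat \<Rightarrow> real" and \<iota> :: "'k \<Rightarrow> nat"
  assumes x0: "0 < x 0" and x: "strict_mono x"
    and one: "energy_dominated w T B (\<lambda>k. 1)" and B: "0 \<le> B"
    and min_r: "\<And>r. 0 < r \<Longrightarrow> energy_dominated w T B (\<lambda>k. min (x (\<iota> k)) r)"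
    and mono: "mono a"
    and concave: "\<And>n. (a (n + 2) - a (n + 1)) * (x (n + 1) - x n) \<le> (a (n + 1) - a n) * (x (n + 2) - x (n + 1))"
    and start: "a 1 * x 0 \<le> a 0 * x 1"
  shows "energy_dominated w T B (\<lambda>k. a (\<iota> k))"
proof -
  define slope where "slope n = (a (n + 1) - a n) / (x (n + 1) - x n)" for n
  have dx: "x n < x (n + 1)" for n using strict_monoD[OF x, of n "n + 1"] by simp
  have xpos: "0 < x n" for n using strict_mono_less_eq[OF x, of 0 n] x0 by simp
  have x_min: "min (x i) (x n) = x (min i n)" for i n
    using strict_mono_less_eq[OF x] by (simp add: min_def)
  have slope_nonneg: "0 \<le> slope n" for n
    unfolding slope_def using dx[of n] monoD[OF mono, of n "n + 1"] by simp
  have slope_dec: "slope (n + 1) \<le> slope n" for n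
    unfolding slope_def using dx[of n] dx[of "n + 1"] concave[of n] by (simp add: divide_simps mult_ac)
  have start': "0 \<le> a 0 - slope 0 * x 0"
    using start dx[of 0] by (simp add: slope_def field_simps)
  \<comment> \<open>Subtracting the linear piece with the next slope makes the induction work: passing from \<open>n\<close> to
    \<open>n + 1\<close> adds a nonnegative multiple of \<open>min (x i) (x (n + 1))\<close>.\<close>
  have aff: "energy_dominated w T B (\<lambda>k. a (min (\<iota> k) n) - slope n * min (x (\<iota> k)) (x n))" for n
  proof (induction n)
    case 0
    have "(\<lambda>k. a (min (\<iota> k) 0) - slope 0 * min (x (\<iota> k)) (x 0)) = (\<lambda>k. (a 0 - slope 0 * x 0) * 1)"
      by (simp add: x_min)
    then show ?case using energy_dominated_scale[OF one start'] by simp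
  next
    case (Suc n)
    have step: "a (min i (Suc n)) - slope (Suc n) * min (x i) (x (Suc n)) =
       (a (min i n) - slope n * min (x i) (x n)) + (slope n - slope (Suc n)) * min (x i) (x (Suc n))" for i
    proof (cases "i \<le> n")
      case True
      then have "min i n = i" "min i (Suc n) = i" by auto
      then show ?thesis by (simp add: x_min algebra_simps)
    next
      case False
      then have m: "min i n = n" "min i (Suc n) = Suc n" by auto
      have "a (Suc n) = a n + slope n * (x (Suc n) - x n)"
        using dx[of n] by (simp add: slope_def)
      then show ?thesis by (simp add: x_min m algebra_simps)
    qed
    have "energy_dominated w T B (\<lambda>k. (slope n - slope (Suc n)) * min (x (\<iota> k)) (x (Suc n)))"
      using slope_dec[of n] by (intro energy_dominated_scale min_r xpos) simp
    from energy_dominated_add[OF Suc this] show ?case unfolding step .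
  qed
  have "energy_dominated w T B (\<lambda>k. a (min (\<iota> k) n))" for n
    using energy_dominated_add[OF aff energy_dominated_scale[OF min_r[OF xpos] slope_nonneg], of n n n] by simp
  then show ?thesis
    by (rule energy_dominated_limit[where \<iota> = \<iota> and h = "\<lambda>n k. a (min (\<iota> k) n)"])
      (auto intro: B monoD[OF mono])
qed

text \<open>
  The maximum is the larger of the two end space norms of the rank-one operator that maps the unit
  vector at \<open>j\<close> to the one at \<open>k\<close>, and \<open>w k / w j\<close> is its norm in the space of weight \<open>w\<close>.
  Equivalently, \<open>w / w0\<close> is, up to a constant, a quasi-concave function of \<open>w1 / w0\<close>.
\<close>

definition interpolated_weight ::
    "('k \<Rightarrow> real) \<Rightarrow> ('k \<Rightarrow> real) \<Rightarrow> ('k \<Rightarrow> real) \<Rightarrow> bool" where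
  "interpolated_weight w0 w1 w \<longleftrightarrow>
     (\<exists>c>0. \<forall>j k. w k \<le> c * max (w0 k / w0 j) (w1 k / w1 j) * w j)"

text \<open>
  The squared quotient \<open>g = (w / w0)\<^sup>2\<close> satisfies \<open>g k \<le> c\<^sup>2 * (1 + \<rho> k / \<rho> j) * g j\<close> with
  \<open>\<rho> = (w1 / w0)\<^sup>2\<close>. Therefore the infimum over \<open>j\<close> of the affine functions
  \<open>g j * (1 + t / \<rho> j)\<close>, taken at \<open>t = \<rho> k\<close>, lies between \<open>g k / c\<^sup>2\<close> and \<open>2 * g k\<close>.
  It is concave in \<open>t\<close>, so its energies are dominated.
\<close>

lemma interpolation_weighted_ell2:
  fixes w0 w1 w :: "'k::countable \<Rightarrow> real" and x :: "nat \<Rightarrow> real" and \<iota> :: "'k \<Rightarrow> nat"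
  assumes w0: "\<And>k. 0 < w0 k" and le: "\<And>k. w0 k \<le> w1 k" and w: "\<And>k. 0 < w k"
    and x0: "0 < x 0" and x: "strict_mono x" and ratio: "\<And>k. (w1 k / w0 k)\<^sup>2 = x (\<iota> k)"
    and inter: "interpolated_weight w0 w1 w"
  shows "interpolation_space (weighted_ell2 w0) (weighted_ell2 w1) (weighted_ell2 w)"
proof -
  have w1: "0 < w1 k" for k using w0 le less_le_trans by blast
  obtain c where c: "c > 0" and cw: "\<And>j k. w k \<le> c * max (w0 k / w0 j) (w1 k / w1 j) * w j"
    using inter unfolding interpolated_weight_def by blast
  have cw': "w k \<le> c * (w1 k / w0 j) * w j" for j k
  proof -
    have "max (w0 k / w0 j) (w1 k / w1 j) \<le> w1 k / w0 j"
      using le[of k] le[of j] w0[of j] w1[of k] by (auto intro!: divide_right_mono divide_left_mono simp: less_imp_le w1)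
    then have "c * max (w0 k / w0 j) (w1 k / w1 j) * w j \<le> c * (w1 k / w0 j) * w j"
      using c w[of j] by (intro mult_right_mono mult_left_mono) auto
    then show ?thesis using cw[of k j] by linarith
  qed
  define g where "g k = (w k / w0 k)\<^sup>2" for k
  define aff where "aff j t = g j * (1 + t / x (\<iota> j))" for j t
  define a where "a i = (INF j. aff j (x i))" for i
  have xpos: "0 < x n" for n using strict_mono_less_eq[OF x, of 0 n] x0 by simp
  have gpos: "0 < g k" for k using w[of k] w0[of k] by (simp add: g_def)
  have aff_pos: "0 \<le> aff j (x i)" for i j
    unfolding aff_def using gpos[of j] xpos[of i] xpos[of "\<iota> j"] by simp
  have a_le: "a i \<le> aff j (x i)" for i j
    unfolding a_def using aff_pos by (intro cINF_lower bdd_belowI2[of _ 0]) auto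
  have a_ge: "(\<And>j. r \<le> aff j (x i)) \<Longrightarrow> r \<le> a i" for r i
    unfolding a_def by (intro cINF_greatest) auto
  have a_mono: "mono a"
  proof (rule monoI)
    fix m n :: nat assume "m \<le> n"
    then have "aff j (x m) \<le> aff j (x n)" for j
      unfolding aff_def using strict_mono_less_eq[OF x, of m n] gpos[of j] xpos[of "\<iota> j"]
      by (intro mult_left_mono add_left_mono divide_right_mono) auto
    then show "a m \<le> a n" using a_le a_ge order_trans by meson
  qed
  have a_concave: "(a (n + 2) - a (n + 1)) * (x (n + 1) - x n) \<le> (a (n + 1) - a n) * (x (n + 2) - x (n + 1))" for n
  proof -
    let ?p = "x (n + 1) - x n" and ?q = "x (n + 2) - x (n + 1)"
    have pq: "?p > 0" "?q > 0"
      using strict_monoD[OF x, of n "n+1"] strict_monoD[OF x, of "n+1" "n+2"] by auto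
    have "(a (n + 2) * ?p + a n * ?q) / (?p + ?q) \<le> a (n + 1)"
    proof (rule a_ge)
      fix j
      have "a (n + 2) * ?p + a n * ?q \<le> aff j (x (n + 2)) * ?p + aff j (x n) * ?q"
        using pq by (intro add_mono mult_right_mono a_le) auto
      also have "\<dots> = aff j (x (n + 1)) * (?p + ?q)"
        by (simp add: aff_def algebra_simps add_divide_distrib diff_divide_distrib)
      finally show "(a (n + 2) * ?p + a n * ?q) / (?p + ?q) \<le> aff j (x (n + 1))"
        using pq by (simp add: pos_divide_le_eq)
    qed
    then have "a (n + 2) * ?p + a n * ?q \<le> a (n + 1) * (?p + ?q)"
      using pq by (simp add: pos_divide_le_eq)
    then show ?thesis by (simp add: algebra_simps)
  qed
  have a_start: "a 1 * x 0 \<le> a 0 * x 1"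
  proof -
    have x01: "x 0 < x 1" using strict_monoD[OF x, of 0 1] by simp
    have "a 1 * x 0 / x 1 \<le> a 0"
    proof (rule a_ge)
      fix j
      have "a 1 * x 0 \<le> aff j (x 1) * x 0"
        using xpos[of 0] by (intro mult_right_mono a_le) auto
      also have "\<dots> = g j * (x 0 + x 0 * x 1 / x (\<iota> j))"
        by (simp add: aff_def algebra_simps)
      also have "\<dots> \<le> g j * (x 1 + x 0 * x 1 / x (\<iota> j))"
        using gpos[of j] x01 by (intro mult_left_mono) auto
      also have "\<dots> = aff j (x 0) * x 1"
        by (simp add: aff_def algebra_simps)
      finally show "a 1 * x 0 / x 1 \<le> aff j (x 0)"
        using xpos[of 1] by (simp add: pos_divide_le_eq)
    qed
    then show ?thesis using xpos[of 1] by (simp add: pos_divide_le_eq)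
  qed
  have a_upper: "a (\<iota> k) \<le> 2 * g k" for k
    using a_le[of "\<iota> k" k] xpos[of "\<iota> k"] by (simp add: aff_def)
  have a_lower: "g k \<le> c\<^sup>2 * a (\<iota> k)" for k
  proof -
    have "g k / c\<^sup>2 \<le> a (\<iota> k)"
    proof (rule a_ge)
      fix j
      let ?m = "max (w0 k / w0 j) (w1 k / w1 j)"
      have m: "0 \<le> ?m" using w0[of k] w0[of j] by (simp add: le_max_iff_disj)
      have "?m\<^sup>2 \<le> (w0 k / w0 j)\<^sup>2 + (w1 k / w1 j)\<^sup>2"
        by (cases "w0 k / w0 j \<le> w1 k / w1 j") (simp_all add: max_def)
      also have "\<dots> = (w0 k / w0 j)\<^sup>2 * (1 + (w1 k / w0 k)\<^sup>2 / (w1 j / w0 j)\<^sup>2)"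
        using w0[of k] w0[of j] w1[of j] by (simp add: field_simps power_divide)
      finally have mm: "?m\<^sup>2 \<le> (w0 k / w0 j)\<^sup>2 * (1 + x (\<iota> k) / x (\<iota> j))"
        by (simp only: ratio)
      have "(w k)\<^sup>2 \<le> (c * ?m * w j)\<^sup>2"
        using cw[of k j] w[of k] by (intro power_mono) auto
      also have "\<dots> = c\<^sup>2 * (w j)\<^sup>2 * ?m\<^sup>2"
        by (simp only: power_mult_distrib mult_ac)
      also have "\<dots> \<le> c\<^sup>2 * (w j)\<^sup>2 * ((w0 k / w0 j)\<^sup>2 * (1 + x (\<iota> k) / x (\<iota> j)))"
        by (intro mult_left_mono mm) auto
      also have "\<dots> = (w0 k)\<^sup>2 * c\<^sup>2 * aff j (x (\<iota> k))"
        by (simp add: aff_def g_def power_divide)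
      finally show "g k / c\<^sup>2 \<le> aff j (x (\<iota> k))"
        using c w0[of k] by (simp add: g_def power_divide divide_le_eq mult_ac)
    qed
    then show ?thesis using c by (simp add: divide_le_eq mult_ac)
  qed
  have weight: "g k * (w0 k * r)\<^sup>2 = (w k * r)\<^sup>2" for k r
    using w0[of k] by (simp add: g_def power_divide power_mult_distrib)
  interpret positive_weight w by unfold_locales (rule w)
  \<comment> \<open>any fixed point serves as base point for the comparison of \<open>w\<close> with \<open>w0\<close> and \<open>w1\<close>\<close>
  obtain k0 :: 'k where True by simp
  have emb0: "continuous_embedding (weighted_ell2 w) (weighted_ell2 w0)"
  proof (rule continuous_embedding_weighted_ell2)
    show "w0 k \<le> (c * w1 k0 / w k0) * w k" for k
      using cw'[of k0 k] w0[of k] w[of k0] by (simp add: field_simps)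
  qed (use w0 w1[of k0] w[of k0] c in \<open>auto simp: less_imp_le\<close>)
  have emb1: "continuous_embedding (weighted_ell2 w1) (weighted_ell2 w)"
  proof (rule continuous_embedding_weighted_ell2)
    show "w k \<le> (c * w k0 / w0 k0) * w1 k" for k
      using cw'[of k k0] by (simp add: field_simps)
  qed (use w w0[of k0] w[of k0] c in \<open>auto simp: less_imp_le\<close>)
  have emb01: "continuous_embedding (weighted_ell2 w1) (weighted_ell2 w0)"
    by (rule continuous_embedding_weighted_ell2[where C = 1]) (use w0 le in \<open>auto simp: less_imp_le\<close>)
  have "bounded_linear_operator (weighted_ell2 w) (weighted_ell2 w) T"
    if T0: "bounded_linear_operator (weighted_ell2 w0) (weighted_ell2 w0) T"
      and T1: "bounded_linear_operator (weighted_ell2 w1) (weighted_ell2 w1) T" for T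
  proof -
    obtain B where B: "0 \<le> B" "energy_dominated w0 T B (\<lambda>k. 1)"
      "\<And>r. 0 < r \<Longrightarrow> energy_dominated w0 T B (\<lambda>k. min ((w1 k / w0 k)\<^sup>2) r)"
      using energy_dominated_one_and_min[OF w0 w1 T0 T1] by blast
    have dom: "energy_dominated w0 T B (\<lambda>k. a (\<iota> k))"
      by (rule energy_dominated_concave[OF x0 x B(2,1) B(3)[unfolded ratio] a_mono a_concave a_start])
    have sub: "u \<in> hcarrier (weighted_ell2 w0)" if "u \<in> hcarrier (weighted_ell2 w)" for u
      using emb0 that unfolding continuous_embedding_def bounded_linear_operator_def by blast
    define C where "C = sqrt (2 * c\<^sup>2 * B)"
    have C: "0 \<le> C" "C\<^sup>2 = 2 * c\<^sup>2 * B" using B(1) by (auto simp: C_def)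
    have bound: "(\<Sum>k\<in>F. (w k * cmod (T u k))\<^sup>2) \<le> (C * hnorm (weighted_ell2 w) u)\<^sup>2"
      if u: "u \<in> hcarrier (weighted_ell2 w)" and F: "finite F" for u F
    proof -
      have le2: "a (\<iota> k) * (w0 k * cmod (u k))\<^sup>2 \<le> 2 * (w k * cmod (u k))\<^sup>2" for k
        using mult_right_mono[OF a_upper[of k], of "(w0 k * cmod (u k))\<^sup>2"] weight[of k "cmod (u k)"] by simp
      have s2: "(\<lambda>k. 2 * (w k * cmod (u k))\<^sup>2) summable_on UNIV"
        using u by (intro summable_on_cmult_right) simp
      have s: "(\<lambda>k. a (\<iota> k) * (w0 k * cmod (u k))\<^sup>2) summable_on UNIV"
        by (rule summable_on_comparison_test[OF s2 le2])
          (auto intro!: mult_nonneg_nonneg energy_dominatedD(1)[OF dom])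
      have "(\<Sum>k\<in>F. (w k * cmod (T u k))\<^sup>2) \<le> (\<Sum>k\<in>F. c\<^sup>2 * (a (\<iota> k) * (w0 k * cmod (T u k))\<^sup>2))"
      proof (intro sum_mono)
        fix k
        show "(w k * cmod (T u k))\<^sup>2 \<le> c\<^sup>2 * (a (\<iota> k) * (w0 k * cmod (T u k))\<^sup>2)"
          using mult_right_mono[OF a_lower[of k], of "(w0 k * cmod (T u k))\<^sup>2"] weight[of k "cmod (T u k)"]
          by (simp add: mult.assoc)
      qed
      also have "\<dots> \<le> c\<^sup>2 * (B * (\<Sum>\<^sub>\<infinity>k. a (\<iota> k) * (w0 k * cmod (u k))\<^sup>2))"
        unfolding sum_distrib_left[symmetric]
        by (intro mult_left_mono energy_dominatedD(2)[OF dom sub[OF u] s F]) simp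
      also have "\<dots> \<le> c\<^sup>2 * (B * (\<Sum>\<^sub>\<infinity>k. 2 * (w k * cmod (u k))\<^sup>2))"
        by (intro mult_left_mono infsum_mono s s2 le2 B(1)) simp
      also have "\<dots> = (C * hnorm (weighted_ell2 w) u)\<^sup>2"
        by (simp add: power_mult_distrib C hnorm_weighted_ell2_sq infsum_cmult_right')
      finally show ?thesis .
    qed
    have mem: "T u \<in> hcarrier (weighted_ell2 w) \<and> hnorm (weighted_ell2 w) (T u) \<le> C * hnorm (weighted_ell2 w) u"
      if u: "u \<in> hcarrier (weighted_ell2 w)" for u
      by (intro conjI weighted_ell2_memI[where B = "C * hnorm (weighted_ell2 w) u"] mult_nonneg_nonneg C hnorm_weighted_ell2_nonneg bound[OF u])
    have "T (hadd (weighted_ell2 w0) u v) = hadd (weighted_ell2 w0) (T u) (T v)"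
      if "u \<in> hcarrier (weighted_ell2 w)" "v \<in> hcarrier (weighted_ell2 w)" for u v
      using T0 sub[OF that(1)] sub[OF that(2)] unfolding bounded_linear_operator_def by blast
    moreover have "T (hscale (weighted_ell2 w0) b u) = hscale (weighted_ell2 w0) b (T u)"
      if "u \<in> hcarrier (weighted_ell2 w)" for u b
      using T0 sub[OF that] unfolding bounded_linear_operator_def by blast
    ultimately show ?thesis
      unfolding bounded_linear_operator_def weighted_ell2_simps(2,3) using mem by blast
  qed
  moreover have "separable_hilbert_space (weighted_ell2 w0)" "separable_hilbert_space (weighted_ell2 w1)"
    by (intro separable_hilbert_space_weighted_ell2 w0 w1)+
  ultimately show ?thesis
    unfolding interpolation_space_def admissible_pair_def
    by (intro conjI allI impI hilbert_space_weighted_ell2 emb0 emb1 emb01) blast+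
qed

section \<open>Hilbert interpolation spaces are weighted spaces\<close>

definition mult_fun :: "('k \<Rightarrow> complex) \<Rightarrow> ('k \<Rightarrow> complex) \<Rightarrow> 'k \<Rightarrow> complex" where
  "mult_fun m u = (\<lambda>k. m k * u k)"

definition unit_fun :: "'k \<Rightarrow> 'k \<Rightarrow> complex" where
  "unit_fun j = (\<lambda>k. if k = j then 1 else 0)"

definition cutoff :: "'k set \<Rightarrow> ('k \<Rightarrow> complex) \<Rightarrow> 'k \<Rightarrow> complex" where
  "cutoff F u = (\<lambda>k. if k \<in> F then u k else 0)"

context function_inner_product_space
begin

text \<open>
  One of the vectors \<open>s + v\<close> and \<open>s - v\<close> has squared norm at most \<open>\<parallel>s\<parallel>\<^sup>2 + \<parallel>v\<parallel>\<^sup>2\<close>, and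
  the other one at least that much, by the parallelogram law. The factor \<open>t\<close> treats both
  directions at once: \<open>t = 1\<close> gives an upper and \<open>t = -1\<close> a lower bound.
\<close>

lemma exists_signs:
  fixes t :: real
  assumes "finite F" and "\<And>k. k \<in> F \<Longrightarrow> v k \<in> hcarrier V"
  shows "\<exists>\<epsilon>. (\<forall>k. \<epsilon> k = 1 \<or> \<epsilon> k = (-1::complex)) \<and>
      t * (nrm (\<lambda>l. \<Sum>k\<in>F. \<epsilon> k * v k l))\<^sup>2 \<le> t * (\<Sum>k\<in>F. (nrm (v k))\<^sup>2)"
  using assms
proof (induction F rule: finite_induct)
  case empty
  then show ?case by (intro exI[of _ "\<lambda>_. 1"]) (simp add: nrm_zero)
next
  case (insert j F)
  then obtain \<epsilon> where \<epsilon>: "\<forall>k. \<epsilon> k = 1 \<or> \<epsilon> k = (-1::complex)"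
    "t * (nrm (\<lambda>l. \<Sum>k\<in>F. \<epsilon> k * v k l))\<^sup>2 \<le> t * (\<Sum>k\<in>F. (nrm (v k))\<^sup>2)"
    by blast
  define s where "s = (\<lambda>l. \<Sum>k\<in>F. \<epsilon> k * v k l)"
  have s: "s \<in> hcarrier V"
    unfolding s_def using insert.prems by (intro sum_mem scale_mem) auto
  have j: "v j \<in> hcarrier V" using insert.prems by simp
  have upd: "(\<lambda>l. \<Sum>k\<in>insert j F. (\<epsilon>(j := b)) k * v k l) = (\<lambda>l. s l + b * v j l)" for b
  proof
    fix l
    have "(\<Sum>k\<in>F. (\<epsilon>(j := b)) k * v k l) = s l"
      unfolding s_def using insert.hyps by (intro sum.cong) auto
    then show "(\<Sum>k\<in>insert j F. (\<epsilon>(j := b)) k * v k l) = s l + b * v j l"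
      using insert.hyps by simp
  qed
  have "t * (nrm (\<lambda>l. s l + v j l))\<^sup>2 + t * (nrm (\<lambda>l. s l - v j l))\<^sup>2
      = 2 * (t * ((nrm s)\<^sup>2 + (nrm (v j))\<^sup>2))"
    unfolding distrib_left[of t, symmetric] parallelogram[OF s j] by (simp add: distrib_left)
  then consider "t * (nrm (\<lambda>l. s l + v j l))\<^sup>2 \<le> t * ((nrm s)\<^sup>2 + (nrm (v j))\<^sup>2)"
    | "t * (nrm (\<lambda>l. s l - v j l))\<^sup>2 \<le> t * ((nrm s)\<^sup>2 + (nrm (v j))\<^sup>2)"
    by linarith
  then have "\<exists>b::complex. (b = 1 \<or> b = -1) \<and>
      t * (nrm (\<lambda>l. s l + b * v j l))\<^sup>2 \<le> t * ((nrm s)\<^sup>2 + (nrm (v j))\<^sup>2)"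
  proof cases
    case 1
    then show ?thesis by (intro exI[of _ 1]) simp
  next
    case 2
    then show ?thesis by (intro exI[of _ "-1"]) simp
  qed
  then obtain b :: complex where b: "b = 1 \<or> b = -1"
    "t * (nrm (\<lambda>l. s l + b * v j l))\<^sup>2 \<le> t * ((nrm s)\<^sup>2 + (nrm (v j))\<^sup>2)"
    by blast
  show ?case
  proof (intro exI[of _ "\<epsilon>(j := b)"] conjI)
    show "\<forall>k. (\<epsilon>(j := b)) k = 1 \<or> (\<epsilon>(j := b)) k = -1" using \<epsilon>(1) b(1) by simp
    show "t * (nrm (\<lambda>l. \<Sum>k\<in>insert j F. (\<epsilon>(j := b)) k * v k l))\<^sup>2 \<le> t * (\<Sum>k\<in>insert j F. (nrm (v k))\<^sup>2)"
      unfolding upd using b(2) \<epsilon>(2) insert.hyps by (simp add: s_def distrib_left)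
  qed
qed

end

locale weighted_interpolation =
  fixes w0 w1 :: "'k::countable \<Rightarrow> real" and S :: "('k \<Rightarrow> complex) inner_space"
  assumes w0_pos: "\<And>k. 0 < w0 k" and w1_pos: "\<And>k. 0 < w1 k"
    and inter: "interpolation_space (weighted_ell2 w0) (weighted_ell2 w1) S"
begin

lemma S_hilbert: "hilbert_space S"
  using inter by (simp add: interpolation_space_def)

lemma S_sub_H0: "u \<in> hcarrier S \<Longrightarrow> u \<in> hcarrier (weighted_ell2 w0)"
  using inter unfolding interpolation_space_def continuous_embedding_def bounded_linear_operator_def
  by blast

lemma H1_sub_S: "u \<in> hcarrier (weighted_ell2 w1) \<Longrightarrow> u \<in> hcarrier S"
  using inter unfolding interpolation_space_def continuous_embedding_def bounded_linear_operator_def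
  by blast

sublocale S: function_inner_product_space S
proof -
  interpret hilbert_space S by (rule S_hilbert)
  have emb: "bounded_linear_operator S (weighted_ell2 w0) (\<lambda>x. x)"
    using inter unfolding interpolation_space_def continuous_embedding_def by blast
  show "function_inner_product_space S"
  proof
    fix x y assume "x \<in> hcarrier S" "y \<in> hcarrier S"
    then have "hadd S x y = hadd (weighted_ell2 w0) x y"
      using emb unfolding bounded_linear_operator_def by blast
    then show "hadd S x y = (\<lambda>k. x k + y k)" by simp
  next
    fix x c assume "x \<in> hcarrier S"
    then have "hscale S c x = hscale (weighted_ell2 w0) c x"
      using emb unfolding bounded_linear_operator_def by blast
    then show "hscale S c x = (\<lambda>k. c * x k)" by simp
  qed
qed

lemma S_complete: "S.metric.mcomplete"
  using S_hilbert by (rule hilbert_space.complete)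

lemma S_eval: "\<exists>C. \<forall>x\<in>hcarrier S. cmod (x k) \<le> C * S.nrm x"
proof -
  have "bounded_linear_operator S (weighted_ell2 w0) (\<lambda>x. x)"
    using inter unfolding interpolation_space_def continuous_embedding_def by blast
  then obtain C where C: "\<And>x. x \<in> hcarrier S \<Longrightarrow> hnorm (weighted_ell2 w0) x \<le> C * S.nrm x"
    unfolding bounded_linear_operator_def by blast
  have "cmod (x k) \<le> (C / w0 k) * S.nrm x" if "x \<in> hcarrier S" for x
    using weighted_ell2_eval_le[OF S_sub_H0[OF that], of k] C[OF that] w0_pos[of k]
    by (simp add: field_simps)
  then show ?thesis by blast
qed

lemma operator_bounded_on_S:
  assumes "bounded_linear_operator (weighted_ell2 w0) (weighted_ell2 w0) T"
    and "bounded_linear_operator (weighted_ell2 w1) (weighted_ell2 w1) T"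
  shows "bounded_linear_operator S S T"
  using inter assms unfolding interpolation_space_def by blast

end

lemma bounded_linear_operator_mult_fun:
  assumes w: "\<And>k. 0 \<le> w k" and m: "\<And>k. cmod (m k) \<le> B"
  shows "bounded_linear_operator (weighted_ell2 w) (weighted_ell2 w) (mult_fun m)"
proof -
  have B: "0 \<le> B" using m norm_ge_zero order_trans by blast
  have bound: "(\<Sum>k\<in>F. (w k * cmod (mult_fun m u k))\<^sup>2) \<le> (B * hnorm (weighted_ell2 w) u)\<^sup>2"
    if u: "u \<in> hcarrier (weighted_ell2 w)" and F: "finite F" for u F
  proof -
    have "(w k * cmod (mult_fun m u k))\<^sup>2 \<le> B\<^sup>2 * (w k * cmod (u k))\<^sup>2" for k
    proof -
      have "cmod (m k) * (w k * cmod (u k)) \<le> B * (w k * cmod (u k))"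
        using w[of k] by (intro mult_right_mono m) auto
      then have "w k * cmod (mult_fun m u k) \<le> B * (w k * cmod (u k))"
        by (simp add: mult_fun_def norm_mult mult_ac)
      then have "(w k * cmod (mult_fun m u k))\<^sup>2 \<le> (B * (w k * cmod (u k)))\<^sup>2"
        using w[of k] by (intro power_mono) auto
      then show ?thesis by (simp only: power_mult_distrib)
    qed
    then have "(\<Sum>k\<in>F. (w k * cmod (mult_fun m u k))\<^sup>2) \<le> B\<^sup>2 * (\<Sum>k\<in>F. (w k * cmod (u k))\<^sup>2)"
      unfolding sum_distrib_left by (intro sum_mono)
    also have "\<dots> \<le> B\<^sup>2 * (hnorm (weighted_ell2 w) u)\<^sup>2"
      by (intro mult_left_mono weighted_ell2_sum_le[OF u F]) simp
    finally show ?thesis by (simp only: power_mult_distrib)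
  qed
  have "mult_fun m u \<in> hcarrier (weighted_ell2 w) \<and>
      hnorm (weighted_ell2 w) (mult_fun m u) \<le> B * hnorm (weighted_ell2 w) u"
    if u: "u \<in> hcarrier (weighted_ell2 w)" for u
    by (intro conjI weighted_ell2_memI[where B = "B * hnorm (weighted_ell2 w) u"]
        mult_nonneg_nonneg B hnorm_weighted_ell2_nonneg bound[OF u])
  then have "mult_fun m \<in> hcarrier (weighted_ell2 w) \<rightarrow> hcarrier (weighted_ell2 w)"
    "\<exists>C. \<forall>u\<in>hcarrier (weighted_ell2 w). hnorm (weighted_ell2 w) (mult_fun m u) \<le> C * hnorm (weighted_ell2 w) u"
    by blast+
  then show ?thesis
    unfolding bounded_linear_operator_def
    by (simp add: weighted_ell2_simps(2,3) mult_fun_def algebra_simps del: weighted_ell2_simps(1))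
qed

context weighted_interpolation
begin

lemma mult_fun_on_S:
  assumes "\<And>k. cmod (m k) \<le> B"
  shows "u \<in> hcarrier S \<Longrightarrow> mult_fun m u \<in> hcarrier S"
    and "\<exists>C. \<forall>u\<in>hcarrier S. S.nrm (mult_fun m u) \<le> C * S.nrm u"
proof -
  have "bounded_linear_operator S S (mult_fun m)"
    by (intro operator_bounded_on_S bounded_linear_operator_mult_fun[where B = B] assms
        less_imp_le[OF w0_pos] less_imp_le[OF w1_pos])
  then show "u \<in> hcarrier S \<Longrightarrow> mult_fun m u \<in> hcarrier S"
    and "\<exists>C. \<forall>u\<in>hcarrier S. S.nrm (mult_fun m u) \<le> C * S.nrm u"
    unfolding bounded_linear_operator_def by blast+
qed

text \<open>
  Bounded multipliers are parametrized by bounded continuous functions on the real line, read off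
  at the naturals that enumerate the index type. These functions form a Banach space, and by
  Tietze's theorem every bounded multiplier arises from one of them with the same bound.
\<close>

definition act :: "(real \<Rightarrow>\<^sub>C complex) \<Rightarrow> ('k \<Rightarrow> complex) \<Rightarrow> 'k \<Rightarrow> complex" where
  "act m = mult_fun (\<lambda>k. apply_bcontfun m (real (to_nat k)))"

lemma act_mem: "u \<in> hcarrier S \<Longrightarrow> act m u \<in> hcarrier S"
  unfolding act_def by (rule mult_fun_on_S(1)[OF norm_bounded])

lemma act_scale: "act (a *\<^sub>R m) u = (\<lambda>k. complex_of_real a * act m u k)"
  by (simp add: act_def mult_fun_def fun_eq_iff scaleR_conv_of_real)

lemma act_diff: "act (m - m') u = (\<lambda>k. act m u k - act m' u k)"
  by (simp add: act_def mult_fun_def fun_eq_iff algebra_simps)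

text \<open>
  The multipliers whose operator norm on \<open>S\<close> is at most \<open>n\<close> cover the whole space as \<open>n\<close>
  grows, so by Baire's theorem the closure of one of these sets contains a ball. The set is convex
  and symmetric, hence the ball may be centred at the origin.
\<close>

lemma approximable_ball:
  obtains n r where "(n::real) \<ge> 0" "r > 0"
    "\<And>y e. norm y < r \<Longrightarrow> e > 0 \<Longrightarrow>
       \<exists>a. (\<forall>u\<in>hcarrier S. S.nrm (act a u) \<le> n * S.nrm u) \<and> norm (y - a) < e"
proof -
  define A where "A n = {m. \<forall>u\<in>hcarrier S. S.nrm (act m u) \<le> real n * S.nrm u}" for n
  have cover: "(\<Union>n. closure (A n)) = UNIV"
  proof -
    have "\<exists>n. m \<in> A n" for m
    proof -
      obtain C where C: "\<And>u. u \<in> hcarrier S \<Longrightarrow> S.nrm (act m u) \<le> C * S.nrm u"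
        using mult_fun_on_S(2)[of "\<lambda>k. apply_bcontfun m (real (to_nat k))", OF norm_bounded]
        unfolding act_def by blast
      obtain n where n: "C \<le> real n" using real_arch_simple by blast
      have "S.nrm (act m u) \<le> real n * S.nrm u" if "u \<in> hcarrier S" for u
        using C[OF that] mult_right_mono[OF n S.nrm_nonneg[OF that]] by linarith
      then show ?thesis unfolding A_def by blast
    qed
    then show ?thesis using closure_subset by blast
  qed
  have "\<exists>n. interior (closure (A n)) \<noteq> {}"
  proof (rule ccontr)
    assume empty: "\<nexists>n. interior (closure (A n)) \<noteq> {}"
    have "euclidean interior_of (\<Union>(range (\<lambda>n. closure (A n)))) = {}"
    proof (rule Baire_category_alt)
      show "completely_metrizable_space (euclidean :: (real \<Rightarrow>\<^sub>C complex) topology) \<or>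
          locally_compact_space (euclidean :: (real \<Rightarrow>\<^sub>C complex) topology) \<and>
          regular_space (euclidean :: (real \<Rightarrow>\<^sub>C complex) topology)"
        by (intro disjI1 completely_metrizable_space_euclidean)
    qed (use empty in auto)
    then show False using cover by simp
  qed
  then obtain n x where "x \<in> interior (closure (A n))" by blast
  then obtain r where r: "r > 0" "ball x r \<subseteq> closure (A n)"
    by (auto simp: mem_interior)
  have "\<exists>a. (\<forall>u\<in>hcarrier S. S.nrm (act a u) \<le> real n * S.nrm u) \<and> norm (y - a) < e"
    if y: "norm y < r" and e: "e > 0" for y e
  proof -
    have "x + y \<in> closure (A n)" "x - y \<in> closure (A n)"
      using r(2) y by (auto simp: subset_iff dist_norm)
    then obtain a b where a: "a \<in> A n" "dist a (x + y) < e" and b: "b \<in> A n" "dist b (x - y) < e"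
      using e unfolding closure_approachable by blast
    \<comment> \<open>half the difference of the two approximations cancels the centre \<open>x\<close> and leaves \<open>y\<close>\<close>
    define d where "d = (1/2) *\<^sub>R (a - b)"
    have "S.nrm (act d u) \<le> real n * S.nrm u" if u: "u \<in> hcarrier S" for u
    proof -
      have "S.nrm (act d u) = (1/2) * S.nrm (\<lambda>k. act a u k - act b u k)"
        unfolding d_def act_scale act_diff S.nrm_scale[OF S.diff_mem[OF act_mem[OF u] act_mem[OF u]]]
        by simp
      also have "S.nrm (\<lambda>k. act a u k - act b u k) \<le> S.nrm (act a u) + S.nrm (act b u)"
        using S.triangle[OF act_mem[OF u, of a] S.scale_mem[OF act_mem[OF u, of b], of "-1"]]
          S.nrm_scale[OF act_mem[OF u, of b], of "-1"] by simp
      also have "\<dots> \<le> real n * S.nrm u + real n * S.nrm u"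
        using a(1) b(1) u unfolding A_def by (intro add_mono) auto
      finally show ?thesis by simp
    qed
    moreover have "norm (y - d) < e"
    proof -
      have "y - d = (1/2) *\<^sub>R ((b - (x - y)) - (a - (x + y)))"
      proof -
        have eq: "(b - (x - y)) - (a - (x + y)) = 2 *\<^sub>R y - (a - b)"
          by (simp add: scaleR_2)
        show ?thesis
          unfolding eq d_def scaleR_diff_right[of _ "2 *\<^sub>R y"] by simp
      qed
      then have "norm (y - d) \<le> (1/2) * (norm (b - (x - y)) + norm (a - (x + y)))"
        using norm_triangle_ineq4[of "b - (x - y)" "a - (x + y)"] by simp
      then show ?thesis using a(2) b(2) by (simp add: dist_norm)
    qed
    ultimately show ?thesis by blast
  qed
  then show thesis by (rule that[OF of_nat_0_le_iff r(1)])
qed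

text \<open>
  As in the open mapping theorem, successive approximation removes the closure: \<open>m\<close> is the sum of
  a series of multipliers whose norms on \<open>S\<close> decrease geometrically. The series applied to \<open>u\<close>
  converges in \<open>S\<close>, and its limit is \<open>m * u\<close> because it is so pointwise.
\<close>

lemma act_bounded_on_ball:
  obtains C r where "C \<ge> 0" "r > 0"
    "\<And>m u. norm m < r \<Longrightarrow> u \<in> hcarrier S \<Longrightarrow> S.nrm (act m u) \<le> C * S.nrm u"
proof -
  obtain n r where n: "(n::real) \<ge> 0" and r: "r > 0"
    and ap: "\<And>y e. norm y < r \<Longrightarrow> e > 0 \<Longrightarrow>
       \<exists>a. (\<forall>u\<in>hcarrier S. S.nrm (act a u) \<le> n * S.nrm u) \<and> norm (y - a) < e"
    using approximable_ball by metis
  have "\<exists>\<alpha>. \<forall>y. norm y < r \<longrightarrow> (\<forall>u\<in>hcarrier S. S.nrm (act (\<alpha> y) u) \<le> n * S.nrm u) \<and> norm (y - \<alpha> y) < r / 2"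
    using ap[OF _ half_gt_zero[OF r]] by (intro choice) blast
  then obtain \<alpha> where \<alpha>: "\<And>y u. norm y < r \<Longrightarrow> u \<in> hcarrier S \<Longrightarrow> S.nrm (act (\<alpha> y) u) \<le> n * S.nrm u"
    "\<And>y. norm y < r \<Longrightarrow> norm (y - \<alpha> y) < r / 2"
    by blast
  have "S.nrm (act m u) \<le> (2 * n) * S.nrm u" if m: "norm m < r" and u: "u \<in> hcarrier S" for m u
  proof -
    \<comment> \<open>the error after \<open>i\<close> steps, rescaled by \<open>2 ^ i\<close> so that it stays in the ball of radius \<open>r\<close>\<close>
    define z where "z i = ((\<lambda>y. 2 *\<^sub>R (y - \<alpha> y)) ^^ i) m" for i
    have z0: "z 0 = m" and zS: "z (Suc i) = 2 *\<^sub>R (z i - \<alpha> (z i))" for i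
      by (simp_all add: z_def)
    have zr: "norm (z i) < r" for i
    proof (induction i)
      case (Suc i)
      then show ?case using \<alpha>(2)[OF Suc] by (simp add: zS)
    qed (simp add: z0 m)
    define f where "f i = act (m - (1/2)^i *\<^sub>R z i) u" for i
    have fmem: "f i \<in> hcarrier S" for i unfolding f_def by (rule act_mem[OF u])
    have step: "S.nrm (\<lambda>k. f (Suc i) k - f i k) \<le> (1/2)^i * (n * S.nrm u)" for i
    proof -
      have "(m - (1/2)^(Suc i) *\<^sub>R z (Suc i)) - (m - (1/2)^i *\<^sub>R z i) = (1/2)^i *\<^sub>R \<alpha> (z i)"
        by (simp add: zS scaleR_diff_right)
      then have "(\<lambda>k. f (Suc i) k - f i k) = (\<lambda>k. complex_of_real ((1/2)^i) * act (\<alpha> (z i)) u k)"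
        unfolding f_def by (metis act_diff act_scale)
      then have "S.nrm (\<lambda>k. f (Suc i) k - f i k) = (1/2)^i * S.nrm (act (\<alpha> (z i)) u)"
        using S.nrm_scale[OF act_mem[OF u]] by (simp add: norm_power)
      then show ?thesis using \<alpha>(1)[OF zr u, of i] by (simp add: mult_left_mono)
    qed
    have dist: "S.nrm (\<lambda>k. f (i + p) k - f i k) \<le> 2 * (1/2)^i * (1 - (1/2)^p) * (n * S.nrm u)" for i p
    proof (induction p)
      case 0
      then show ?case by (simp add: S.nrm_zero)
    next
      case (Suc p)
      have "S.nrm (\<lambda>k. f (i + Suc p) k - f i k)
          \<le> S.nrm (\<lambda>k. f (Suc (i + p)) k - f (i + p) k) + S.nrm (\<lambda>k. f (i + p) k - f i k)"
        using S.triangle[OF S.diff_mem[OF fmem fmem] S.diff_mem[OF fmem fmem], of "Suc (i + p)" "i + p" "i + p" i]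
        by simp
      also have "\<dots> \<le> (1/2)^(i+p) * (n * S.nrm u) + 2 * (1/2)^i * (1 - (1/2)^p) * (n * S.nrm u)"
        by (intro add_mono step Suc)
      also have "\<dots> = 2 * (1/2)^i * (1 - (1/2)^(Suc p)) * (n * S.nrm u)"
        by (simp add: power_add algebra_simps)
      finally show ?case .
    qed
    have K: "0 \<le> n * S.nrm u" using n S.nrm_nonneg[OF u] by simp
    have dist': "S.nrm (\<lambda>k. f (i + p) k - f i k) \<le> 2 * (1/2)^i * (n * S.nrm u)" for i p
    proof -
      have "2 * (1/2)^i * (1 - (1/2)^p) * (n * S.nrm u) \<le> 2 * (1/2)^i * 1 * (n * S.nrm u)"
        using K by (intro mult_right_mono mult_left_mono) auto
      then show ?thesis using dist[of i p] by linarith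
    qed
    have half0: "(\<lambda>i. (1/2::real)^i) \<longlonglongrightarrow> 0" by (intro LIMSEQ_power_zero) simp
    have cauchy: "\<exists>N. \<forall>i\<ge>N. \<forall>j\<ge>i. S.nrm (\<lambda>k. f j k - f i k) \<le> e" if e: "e > 0" for e
    proof -
      have "(\<lambda>i. 2 * (1/2)^i * (n * S.nrm u)) \<longlonglongrightarrow> 2 * 0 * (n * S.nrm u)"
        by (intro tendsto_mult tendsto_const half0)
      then have "\<forall>\<^sub>F i in sequentially. 2 * (1/2)^i * (n * S.nrm u) < e"
        by (intro order_tendstoD(2)) (use e in auto)
      then obtain N where N: "\<And>i. i \<ge> N \<Longrightarrow> 2 * (1/2)^i * (n * S.nrm u) < e"
        by (auto simp: eventually_sequentially)
      have "S.nrm (\<lambda>k. f j k - f i k) \<le> e" if "i \<ge> N" "j \<ge> i" for i j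
        using dist'[of i "j - i"] N[OF that(1)] that(2) by simp
      then show ?thesis by blast
    qed
    have lim: "(\<lambda>i. f i k) \<longlonglongrightarrow> act m u k" for k
    proof (rule LIM_zero_cancel, rule Lim_null_comparison)
      show "(\<lambda>i. (1/2)^i * (r * cmod (u k))) \<longlonglongrightarrow> 0"
        using tendsto_mult_left_zero[OF half0] by simp
      have "cmod (f i k - act m u k) \<le> (1/2)^i * (r * cmod (u k))" for i
      proof -
        have "f i k - act m u k = - (complex_of_real ((1/2)^i) * act (z i) u k)"
          unfolding f_def act_diff act_scale by simp
        then have "cmod (f i k - act m u k) = (1/2)^i * (cmod (apply_bcontfun (z i) (real (to_nat k))) * cmod (u k))"
          by (simp add: norm_mult norm_power act_def mult_fun_def)
        also have "\<dots> \<le> (1/2)^i * (r * cmod (u k))"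
          using norm_bounded[of "z i" "real (to_nat k)"] zr[of i] by (intro mult_left_mono mult_right_mono) auto
        finally show ?thesis .
      qed
      then show "\<forall>\<^sub>F i in sequentially. norm (f i k - act m u k) \<le> (1/2)^i * (r * cmod (u k))"
        by simp
    qed
    have to0: "(\<lambda>i. S.nrm (\<lambda>k. f i k - act m u k)) \<longlonglongrightarrow> 0"
      by (rule S.limit_is_pointwise_limit(2)[OF S_complete S_eval fmem cauchy lim])
    have f0: "f 0 = (\<lambda>k. 0)"
      by (simp add: f_def z0 act_def mult_fun_def)
    have "S.nrm (act m u) \<le> 2 * (n * S.nrm u) + S.nrm (\<lambda>k. f i k - act m u k)" for i
      using S.triangle_diff[OF act_mem[OF u, of m] fmem[of i]] dist'[of 0 i]
        S.nrm_minus[OF fmem[of i] act_mem[OF u, of m]]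
      by (simp add: f0)
    then have "S.nrm (act m u) \<le> 2 * (n * S.nrm u) + 0"
      by (intro LIMSEQ_le_const[OF tendsto_add[OF tendsto_const to0]]) blast
    then show ?thesis by simp
  qed
  then show thesis using that[of "2 * n" r] n r by simp
qed

lemma uniform_multiplier_bound:
  obtains C where "C > 0"
    "\<And>m u. (\<And>k. cmod (m k) \<le> 1) \<Longrightarrow> u \<in> hcarrier S \<Longrightarrow> S.nrm (mult_fun m u) \<le> C * S.nrm u"
proof -
  obtain C r where C: "C \<ge> 0" and r: "r > 0" and bd:
    "\<And>m u. norm m < r \<Longrightarrow> u \<in> hcarrier S \<Longrightarrow> S.nrm (act m u) \<le> C * S.nrm u"
    using act_bounded_on_ball by metis
  have "S.nrm (mult_fun m u) \<le> (2 * C / r + 1) * S.nrm u"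
    if m: "\<And>k. cmod (m k) \<le> 1" and u: "u \<in> hcarrier S" for m u
  proof -
    \<comment> \<open>The factor \<open>r / 2\<close> moves the multiplier into the ball on which the bound is known.\<close>
    define h where "h x = complex_of_real (r / 2) *
      (if x \<in> range (\<lambda>k::'k. real (to_nat k)) then m (from_nat (nat \<lfloor>x\<rfloor>)) else 0)" for x
    have hle: "cmod (h x) \<le> r / 2" for x
      using m[of "from_nat (nat \<lfloor>x\<rfloor>)"] r by (auto simp: h_def norm_mult)
    have "continuous_on \<nat> h"
      unfolding continuous_on_iff
    proof (intro ballI allI impI)
      fix x e :: real assume x: "x \<in> \<nat>" and "e > 0"
      have "y = x" if "y \<in> \<nat>" "dist y x < 1" for y
        using that x by (auto simp: Nats_def dist_real_def)
      then show "\<exists>d>0. \<forall>y\<in>\<nat>. dist y x < d \<longrightarrow> dist (h y) (h x) < e"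
        using \<open>e > 0\<close> by (metis dist_self zero_less_one)
    qed
    then obtain g where g: "continuous_on UNIV g" "\<And>x. x \<in> \<nat> \<Longrightarrow> g x = h x" "\<And>x. cmod (g x) \<le> r / 2"
      using Tietze[of \<nat> h UNIV "r / 2"] hle r by auto
    have "g \<in> bcontfun"
      unfolding bcontfun_def bounded_iff using g(1,3) by blast
    then have app: "apply_bcontfun (Bcontfun g) = g" by (rule Bcontfun_inverse)
    have "norm (Bcontfun g) \<le> r / 2"
      by (rule norm_bound) (unfold app, rule g(3))
    then have "norm (Bcontfun g) < r" using r by linarith
    from bd[OF this u] have "S.nrm (act (Bcontfun g) u) \<le> C * S.nrm u" .
    moreover have "act (Bcontfun g) u = (\<lambda>k. complex_of_real (r / 2) * mult_fun m u k)"
      by (simp add: act_def mult_fun_def app g(2) h_def fun_eq_iff)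
    ultimately have "(r / 2) * S.nrm (mult_fun m u) \<le> C * S.nrm u"
      using S.nrm_scale[OF mult_fun_on_S(1)[of m, OF m u], of "complex_of_real (r/2)"] r by simp
    then have "S.nrm (mult_fun m u) \<le> (2 * C / r) * S.nrm u"
      using r by (simp add: field_simps)
    then show ?thesis using S.nrm_nonneg[OF u] by (simp add: distrib_right)
  qed
  moreover have "0 < 2 * C / r + 1"
    using divide_nonneg_pos[of "2 * C" r] C r by linarith
  ultimately show thesis using that by blast
qed

definition basis_norm :: "'k \<Rightarrow> real" where
  "basis_norm k = S.nrm (unit_fun k)"

lemma finite_support_mem: "finite F \<Longrightarrow> cutoff F u \<in> hcarrier S"
proof (rule H1_sub_S, unfold weighted_ell2_simps)
  assume F: "finite F"
  have "(\<lambda>k. (w1 k * cmod (cutoff F u k))\<^sup>2) summable_on F"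
    using F by (rule summable_on_finite)
  then show "(\<lambda>k. (w1 k * cmod (cutoff F u k))\<^sup>2) summable_on UNIV"
    by (subst summable_on_cong_neutral[where T = F]) (auto simp: cutoff_def)
qed

lemma unit_fun_mem: "unit_fun k \<in> hcarrier S"
proof -
  have "unit_fun k = cutoff {k} (\<lambda>_. 1)" by (auto simp: unit_fun_def cutoff_def)
  then show ?thesis using finite_support_mem[of "{k}"] by simp
qed

lemma basis_norm_pos: "0 < basis_norm k"
proof -
  have "unit_fun k \<noteq> (\<lambda>_. 0)" by (metis unit_fun_def zero_neq_one)
  then show ?thesis
    using S.nrm_nonneg[OF unit_fun_mem] S.nrm_eq_0[OF unit_fun_mem] unfolding basis_norm_def
    by (metis less_le)
qed

text \<open>
  Multiplication by signs is its own inverse and bounded by \<open>C\<close>, so the norm of a finitely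
  supported function is compared with that of the function with favourable signs. With
  multipliers that are indicator functions the last bound follows as well.
\<close>

lemma cutoff_norm:
  obtains C where "C > 0"
    "\<And>F u. finite F \<Longrightarrow> S.nrm (cutoff F u) \<le> C * sqrt (\<Sum>k\<in>F. (basis_norm k * cmod (u k))\<^sup>2)"
    "\<And>F u. finite F \<Longrightarrow> sqrt (\<Sum>k\<in>F. (basis_norm k * cmod (u k))\<^sup>2) \<le> C * S.nrm (cutoff F u)"
    "\<And>F u. u \<in> hcarrier S \<Longrightarrow> S.nrm (cutoff F u) \<le> C * S.nrm u"
proof -
  obtain C where C: "C > 0" and mult:
    "\<And>m u. (\<And>k. cmod (m k) \<le> 1) \<Longrightarrow> u \<in> hcarrier S \<Longrightarrow> S.nrm (mult_fun m u) \<le> C * S.nrm u"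
    using uniform_multiplier_bound by metis
  define v where "v u k = (\<lambda>l. u k * unit_fun k l)" for u and k :: 'k
  have vmem: "v u k \<in> hcarrier S" for u k
    unfolding v_def by (intro S.scale_mem unit_fun_mem)
  have vnorm: "(S.nrm (v u k))\<^sup>2 = (basis_norm k * cmod (u k))\<^sup>2" for u k
    unfolding v_def using S.nrm_scale[OF unit_fun_mem] by (simp add: basis_norm_def mult_ac)
  have vsum: "(\<lambda>l. \<Sum>k\<in>F. \<epsilon> k * v u k l) = mult_fun \<epsilon> (cutoff F u)" if "finite F" for F \<epsilon> u
  proof
    fix l
    have "(\<Sum>k\<in>F. \<epsilon> k * v u k l) = (\<Sum>k\<in>F. if l = k then \<epsilon> l * u l else 0)"
      by (intro sum.cong) (auto simp: v_def unit_fun_def)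
    then show "(\<Sum>k\<in>F. \<epsilon> k * v u k l) = mult_fun \<epsilon> (cutoff F u) l"
      using that by (simp add: mult_fun_def cutoff_def)
  qed
  have up: "S.nrm (cutoff F u) \<le> C * sqrt (\<Sum>k\<in>F. (basis_norm k * cmod (u k))\<^sup>2)" if F: "finite F" for F u
  proof -
    obtain \<epsilon> where \<epsilon>: "\<forall>k. \<epsilon> k = 1 \<or> \<epsilon> k = (-1::complex)"
      "(S.nrm (mult_fun \<epsilon> (cutoff F u)))\<^sup>2 \<le> (\<Sum>k\<in>F. (basis_norm k * cmod (u k))\<^sup>2)"
      using S.exists_signs[OF F, of "v u" 1] vmem unfolding vsum[OF F] vnorm by auto
    have le1: "cmod (\<epsilon> k) \<le> 1" for k using \<epsilon>(1)[rule_format, of k] by auto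
    have "\<epsilon> k * \<epsilon> k = 1" for k using \<epsilon>(1)[rule_format, of k] by auto
    then have "mult_fun \<epsilon> (mult_fun \<epsilon> (cutoff F u)) = cutoff F u"
      by (simp add: mult_fun_def flip: mult.assoc)
    then have "S.nrm (cutoff F u) \<le> C * S.nrm (mult_fun \<epsilon> (cutoff F u))"
      using mult[of \<epsilon>, OF le1 mult_fun_on_S(1)[of \<epsilon>, OF le1 finite_support_mem[OF F, of u]]] by simp
    also have "S.nrm (mult_fun \<epsilon> (cutoff F u)) \<le> sqrt (\<Sum>k\<in>F. (basis_norm k * cmod (u k))\<^sup>2)"
      using \<epsilon>(2) by (rule real_le_rsqrt)
    finally show ?thesis using C by simp
  qed
  have low: "sqrt (\<Sum>k\<in>F. (basis_norm k * cmod (u k))\<^sup>2) \<le> C * S.nrm (cutoff F u)" if F: "finite F" for F u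
  proof -
    obtain \<epsilon> where \<epsilon>: "\<forall>k. \<epsilon> k = 1 \<or> \<epsilon> k = (-1::complex)"
      "(\<Sum>k\<in>F. (basis_norm k * cmod (u k))\<^sup>2) \<le> (S.nrm (mult_fun \<epsilon> (cutoff F u)))\<^sup>2"
      using S.exists_signs[OF F, of "v u" "-1"] vmem unfolding vsum[OF F] vnorm by auto
    have le1: "cmod (\<epsilon> k) \<le> 1" for k using \<epsilon>(1)[rule_format, of k] by auto
    have "sqrt (\<Sum>k\<in>F. (basis_norm k * cmod (u k))\<^sup>2) \<le> S.nrm (mult_fun \<epsilon> (cutoff F u))"
      by (rule real_le_lsqrt[OF S.nrm_nonneg \<epsilon>(2)]) (intro mult_fun_on_S(1)[OF le1] finite_support_mem F)
    also have "\<dots> \<le> C * S.nrm (cutoff F u)"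
      by (rule mult[OF le1 finite_support_mem[OF F]])
    finally show ?thesis .
  qed
  have "S.nrm (cutoff F u) \<le> C * S.nrm u" if u: "u \<in> hcarrier S" for F u
  proof -
    have "cutoff F u = mult_fun (\<lambda>k. if k \<in> F then 1 else 0) u"
      by (auto simp: cutoff_def mult_fun_def)
    then show ?thesis using mult[OF _ u, of "\<lambda>k. if k \<in> F then 1 else 0"] by simp
  qed
  with C up low show thesis by (rule that)
qed

text \<open>
  A function in \<open>S\<close> has uniformly bounded finite sections, which puts it into the weighted space.
  Conversely, the finite sections of a function in the weighted space form a Cauchy sequence in
  \<open>S\<close>, whose limit is the function itself.
\<close>

lemma S_equal_weighted_ell2: "equal_up_to_norm_equivalence S (weighted_ell2 basis_norm)"
proof -
  obtain C where C: "C > 0"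
    and up: "\<And>F u. finite F \<Longrightarrow> S.nrm (cutoff F u) \<le> C * sqrt (\<Sum>k\<in>F. (basis_norm k * cmod (u k))\<^sup>2)"
    and low: "\<And>F u. finite F \<Longrightarrow> sqrt (\<Sum>k\<in>F. (basis_norm k * cmod (u k))\<^sup>2) \<le> C * S.nrm (cutoff F u)"
    and cutoff: "\<And>F u. u \<in> hcarrier S \<Longrightarrow> S.nrm (cutoff F u) \<le> C * S.nrm u"
    by (rule cutoff_norm) (rule that)
  have into: "u \<in> hcarrier (weighted_ell2 basis_norm) \<and>
      hnorm (weighted_ell2 basis_norm) u \<le> C\<^sup>2 * S.nrm u" if u: "u \<in> hcarrier S" for u
  proof -
    have bound: "(\<Sum>k\<in>F. (basis_norm k * cmod (u k))\<^sup>2) \<le> (C\<^sup>2 * S.nrm u)\<^sup>2" if F: "finite F" for F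
    proof -
      have "sqrt (\<Sum>k\<in>F. (basis_norm k * cmod (u k))\<^sup>2) \<le> C * (C * S.nrm u)"
        using low[OF F, of u] mult_left_mono[OF cutoff[OF u, of F], of C] C by linarith
      then have "(sqrt (\<Sum>k\<in>F. (basis_norm k * cmod (u k))\<^sup>2))\<^sup>2 \<le> (C * (C * S.nrm u))\<^sup>2"
        by (intro power_mono) (auto intro: sum_nonneg)
      then show ?thesis by (simp add: sum_nonneg power2_eq_square mult_ac)
    qed
    show ?thesis
      by (intro conjI weighted_ell2_memI[where B = "C\<^sup>2 * S.nrm u"] mult_nonneg_nonneg
          S.nrm_nonneg[OF u] zero_le_power2 bound)
  qed
  have onto: "u \<in> hcarrier S \<and> S.nrm u \<le> C * hnorm (weighted_ell2 basis_norm) u"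
    if u: "u \<in> hcarrier (weighted_ell2 basis_norm)" for u
  proof -
    define G where "G n = {k::'k. to_nat k < n}" for n
    have finG: "finite (G n)" for n
      using finite_vimageI[of "{..<n}" "to_nat :: 'k \<Rightarrow> nat"] by (simp add: G_def vimage_def)
    define s where "s n = (\<Sum>k\<in>G n. (basis_norm k * cmod (u k))\<^sup>2)" for n
    have Gmono: "m \<le> n \<Longrightarrow> G m \<subseteq> G n" for m n by (auto simp: G_def)
    have diff: "(\<Sum>k\<in>G n - G m. (basis_norm k * cmod (u k))\<^sup>2) = s n - s m" if "m \<le> n" for m n
      unfolding s_def by (rule sum_diff[OF finG Gmono[OF that]])
    have "incseq s"
      unfolding s_def by (intro monoI sum_mono2 finG Gmono) auto
    moreover have "s n \<le> (hnorm (weighted_ell2 basis_norm) u)\<^sup>2" for n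
      unfolding s_def by (rule weighted_ell2_sum_le[OF u finG])
    ultimately obtain L where "s \<longlonglongrightarrow> L"
      using incseq_convergent by metis
    then have cs: "Cauchy s" by (rule LIMSEQ_imp_Cauchy)
    define f where "f n = cutoff (G n) u" for n
    have fmem: "f n \<in> hcarrier S" for n
      unfolding f_def by (rule finite_support_mem[OF finG])
    have cauchy: "\<exists>N. \<forall>m\<ge>N. \<forall>n\<ge>m. S.nrm (\<lambda>k. f n k - f m k) \<le> e" if e: "e > 0" for e
    proof -
      have "(e / C)\<^sup>2 > 0" using e C by simp
      then obtain N where N: "\<And>m n. m \<ge> N \<Longrightarrow> n \<ge> N \<Longrightarrow> norm (s m - s n) < (e / C)\<^sup>2"
        using CauchyD[OF cs] by blast
      have "S.nrm (\<lambda>k. f n k - f m k) \<le> e" if "m \<ge> N" "n \<ge> m" for m n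
      proof -
        have "(\<lambda>k. f n k - f m k) = cutoff (G n - G m) u"
          using Gmono[OF that(2)] by (auto simp: f_def cutoff_def fun_eq_iff)
        then have "S.nrm (\<lambda>k. f n k - f m k) \<le> C * sqrt (s n - s m)"
          using up[of "G n - G m" u] finG diff[OF that(2)] by simp
        also have "sqrt (s n - s m) \<le> e / C"
          using N[of n m] that C e by (intro real_le_lsqrt) auto
        finally show ?thesis using C by simp
      qed
      then show ?thesis by blast
    qed
    have lim: "(\<lambda>n. f n k) \<longlonglongrightarrow> u k" for k
    proof (rule tendsto_eventually)
      show "\<forall>\<^sub>F n in sequentially. f n k = u k"
        using eventually_gt_at_top[of "to_nat k"] by eventually_elim (simp add: f_def cutoff_def G_def)
    qed
    note L = S.limit_is_pointwise_limit[OF S_complete S_eval fmem cauchy lim]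
    have "S.nrm u \<le> C * hnorm (weighted_ell2 basis_norm) u + S.nrm (\<lambda>k. f n k - u k)" for n
    proof -
      have "sqrt (s n) \<le> hnorm (weighted_ell2 basis_norm) u"
        unfolding s_def by (intro real_le_lsqrt hnorm_weighted_ell2_nonneg weighted_ell2_sum_le[OF u finG])
      then have "S.nrm (f n) \<le> C * hnorm (weighted_ell2 basis_norm) u"
        using up[OF finG, of n u] C unfolding f_def s_def by (meson less_imp_le mult_left_mono order_trans)
      then show ?thesis
        using S.triangle_diff[OF L(1) fmem[of n]] S.nrm_minus[OF fmem[of n] L(1)] by linarith
    qed
    then have "S.nrm u \<le> C * hnorm (weighted_ell2 basis_norm) u + 0"
      by (intro LIMSEQ_le_const[OF tendsto_add[OF tendsto_const L(2)]] exI allI impI)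
    then show ?thesis using L(1) by simp
  qed
  have carrier: "hcarrier S = hcarrier (weighted_ell2 basis_norm)"
    using into onto by blast
  have "inverse (C\<^sup>2) * hnorm (weighted_ell2 basis_norm) u \<le> S.nrm u \<and>
      S.nrm u \<le> C * hnorm (weighted_ell2 basis_norm) u" if "u \<in> hcarrier S" for u
    using into[OF that] onto[of u] C by (simp add: field_simps)
  then have "\<exists>c>0. \<exists>C>0. \<forall>u\<in>hcarrier S. c * hnorm (weighted_ell2 basis_norm) u \<le> S.nrm u \<and>
      S.nrm u \<le> C * hnorm (weighted_ell2 basis_norm) u"
    using C by (intro exI[of _ "inverse (C\<^sup>2)"], intro conjI exI[of _ C]) auto
  moreover have "same_vector_space S (weighted_ell2 basis_norm)"
    unfolding same_vector_space_def
    by (intro conjI carrier) (simp_all add: S.hzero_pointwise S.hadd_pointwise S.hscale_pointwise)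
  ultimately show ?thesis
    unfolding equal_up_to_norm_equivalence_def by blast
qed

end

section \<open>The weight of an interpolation space\<close>

text \<open>
  The series \<open>\<Sum>i. (1/2)^i / M i * R i\<close>, where \<open>R i\<close> maps \<open>u\<close> to \<open>u (J i)\<close> times the unit
  vector at \<open>K i\<close>, evaluated at the point \<open>k\<close>. The points \<open>K i\<close> may repeat.
\<close>

definition rank_one_series ::
    "(nat \<Rightarrow> 'k) \<Rightarrow> (nat \<Rightarrow> 'k) \<Rightarrow> (nat \<Rightarrow> real) \<Rightarrow> ('k \<Rightarrow> complex) \<Rightarrow> 'k \<Rightarrow> complex" where
  "rank_one_series J K M u k = (\<Sum>i. if K i = k then of_real ((1/2)^i / M i) * u (J i) else 0)"

lemma rank_one_series_terms:
  assumes w: "\<And>k. 0 < w k" and M: "\<And>i. 0 < M i" and ratio: "\<And>i. w (K i) / w (J i) \<le> M i"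
    and u: "u \<in> hcarrier (weighted_ell2 w)"
  shows "w k * cmod (if K i = k then of_real ((1/2)^i / M i) * u (J i) else 0)
      \<le> (if K i = k then (1/2)^i else 0) * hnorm (weighted_ell2 w) u" (is "w k * cmod ?t \<le> _")
    and "summable (\<lambda>i. if K i = k then of_real ((1/2)^i / M i) * u (J i) else 0 :: complex)"
proof -
  show le: "w k * cmod (if K i = k then of_real ((1/2)^i / M i) * u (J i) else 0)
      \<le> (if K i = k then (1/2)^i else 0) * hnorm (weighted_ell2 w) u" for i
  proof (cases "K i = k")
    case True
    have "w k / M i \<le> w (J i)"
      using ratio[of i] M[of i] w[of "J i"] True by (simp add: field_simps)
    then have "(w k / M i) * cmod (u (J i)) \<le> w (J i) * cmod (u (J i))"
      by (intro mult_right_mono) auto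
    also have "\<dots> \<le> hnorm (weighted_ell2 w) u"
      by (rule weighted_ell2_eval_le[OF u])
    finally have "(1/2)^i * ((w k / M i) * cmod (u (J i))) \<le> (1/2)^i * hnorm (weighted_ell2 w) u"
      by (intro mult_left_mono) auto
    then show ?thesis using True M[of i] by (simp add: norm_mult norm_divide norm_power mult_ac)
  qed simp
  show "summable (\<lambda>i. if K i = k then of_real ((1/2)^i / M i) * u (J i) else 0 :: complex)"
  proof (rule summable_comparison_test')
    show "summable (\<lambda>i. (1/2)^i * (hnorm (weighted_ell2 w) u / w k))"
      by (intro summable_mult2 summable_geometric) simp
    fix i
    have "(if K i = k then (1/2)^i else 0) * hnorm (weighted_ell2 w) u \<le> (1/2)^i * hnorm (weighted_ell2 w) u"
      by (intro mult_right_mono hnorm_weighted_ell2_nonneg) auto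
    with le[of i] have "w k * cmod (if K i = k then of_real ((1/2)^i / M i) * u (J i) else 0)
        \<le> (1/2)^i * hnorm (weighted_ell2 w) u" by (rule order_trans)
    then show "norm (if K i = k then of_real ((1/2)^i / M i) * u (J i) else 0 :: complex)
        \<le> (1/2)^i * (hnorm (weighted_ell2 w) u / w k)"
      using w[of k] by (simp add: pos_le_divide_eq mult_ac)
  qed
qed

text \<open>
  At \<open>k\<close> the weighted value of the image is at most \<open>\<theta> k * \<parallel>u\<parallel>\<close>, where \<open>\<theta> k\<close> is the sum
  of the \<open>(1/2)^i\<close> with \<open>K i = k\<close>. The total of \<open>\<theta>\<close> is 2, so the total of \<open>\<theta>\<^sup>2\<close> is at
  most 4.
\<close>

lemma bounded_linear_operator_rank_one_series:
  fixes w :: "'k \<Rightarrow> real"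
  assumes w: "\<And>k. 0 < w k" and M: "\<And>i. 0 < M i" and ratio: "\<And>i. w (K i) / w (J i) \<le> M i"
  shows "bounded_linear_operator (weighted_ell2 w) (weighted_ell2 w) (rank_one_series J K M)"
proof -
  define \<theta> where "\<theta> k = (\<Sum>i. if K i = k then (1/2::real)^i else 0)" for k
  have geo: "summable (\<lambda>i. (1/2::real)^i)" "(\<Sum>i. (1/2::real)^i) = 2"
    by (simp_all add: summable_geometric suminf_geometric)
  have summ: "summable (\<lambda>i. if K i = k then (1/2::real)^i else 0)" for k
    by (rule summable_comparison_test'[OF geo(1)]) auto
  have \<theta>_nonneg: "0 \<le> \<theta> k" for k unfolding \<theta>_def by (intro suminf_nonneg summ) auto
  have \<theta>_sum: "sum \<theta> F \<le> 2" if F: "finite F" for F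
  proof -
    have "sum \<theta> F = (\<Sum>i. \<Sum>k\<in>F. if K i = k then (1/2::real)^i else 0)"
      unfolding \<theta>_def by (rule suminf_sum[symmetric]) (rule summ)
    also have "\<dots> \<le> (\<Sum>i. (1/2::real)^i)"
      using F by (intro suminf_le geo summable_sum summ) auto
    finally show ?thesis using geo(2) by simp
  qed
  have \<theta>_le: "\<theta> k \<le> 2" for k using \<theta>_sum[of "{k}"] by simp
  have bound: "(\<Sum>k\<in>F. (w k * cmod (rank_one_series J K M u k))\<^sup>2) \<le> (2 * hnorm (weighted_ell2 w) u)\<^sup>2"
    if u: "u \<in> hcarrier (weighted_ell2 w)" and F: "finite F" for u F
  proof -
    let ?N = "hnorm (weighted_ell2 w) u"
    let ?t = "\<lambda>k i. if K i = k then of_real ((1/2)^i / M i) * u (J i) else 0 :: complex"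
    have terms: "w k * cmod (?t k i) \<le> (if K i = k then (1/2)^i else 0) * ?N" for k i
      by (rule rank_one_series_terms(1)[OF w M ratio u])
    have "w k * cmod (rank_one_series J K M u k) \<le> \<theta> k * ?N" for k
    proof -
      have s: "summable (\<lambda>i. cmod (?t k i))"
      proof (rule summable_comparison_test'[OF summable_mult2[OF summ, of k "?N / w k"]])
        fix i
        show "norm (cmod (?t k i)) \<le> (if K i = k then (1/2)^i else 0) * (?N / w k)"
          using terms[of k i] w[of k] by (simp add: pos_le_divide_eq mult_ac)
      qed
      have "w k * cmod (rank_one_series J K M u k) \<le> w k * (\<Sum>i. cmod (?t k i))"
        unfolding rank_one_series_def using summable_norm[OF s] w[of k] by (intro mult_left_mono) auto
      also have "\<dots> = (\<Sum>i. w k * cmod (?t k i))"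
        by (rule suminf_mult[OF s, symmetric])
      also have "\<dots> \<le> (\<Sum>i. (if K i = k then (1/2)^i else 0) * ?N)"
        by (intro suminf_le terms summable_mult s summable_mult2 summ)
      also have "\<dots> = \<theta> k * ?N"
        unfolding \<theta>_def by (rule suminf_mult2[OF summ, symmetric])
      finally show ?thesis .
    qed
    then have "(w k * cmod (rank_one_series J K M u k))\<^sup>2 \<le> (\<theta> k * ?N)\<^sup>2" for k
      using w[of k] by (intro power_mono) (auto intro: mult_nonneg_nonneg less_imp_le)
    also have "(\<theta> k * ?N)\<^sup>2 \<le> \<theta> k * (2 * ?N\<^sup>2)" for k
    proof -
      have "\<theta> k * \<theta> k \<le> \<theta> k * 2" by (intro mult_left_mono \<theta>_le \<theta>_nonneg)
      then have "\<theta> k * \<theta> k * ?N\<^sup>2 \<le> \<theta> k * 2 * ?N\<^sup>2" by (intro mult_right_mono) auto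
      then show ?thesis by (simp add: power2_eq_square mult_ac)
    qed
    finally have "(\<Sum>k\<in>F. (w k * cmod (rank_one_series J K M u k))\<^sup>2) \<le> sum \<theta> F * (2 * ?N\<^sup>2)"
      unfolding sum_distrib_right by (intro sum_mono)
    also have "\<dots> \<le> 2 * (2 * ?N\<^sup>2)"
      by (intro mult_right_mono \<theta>_sum F) auto
    finally show ?thesis by (simp add: power_mult_distrib)
  qed
  have mem: "rank_one_series J K M u \<in> hcarrier (weighted_ell2 w) \<and>
      hnorm (weighted_ell2 w) (rank_one_series J K M u) \<le> 2 * hnorm (weighted_ell2 w) u"
    if u: "u \<in> hcarrier (weighted_ell2 w)" for u
    by (intro conjI weighted_ell2_memI[where B = "2 * hnorm (weighted_ell2 w) u"]
        mult_nonneg_nonneg hnorm_weighted_ell2_nonneg bound[OF u]) auto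
  have add: "rank_one_series J K M (\<lambda>k. u k + v k) = (\<lambda>k. rank_one_series J K M u k + rank_one_series J K M v k)"
    if u: "u \<in> hcarrier (weighted_ell2 w)" and v: "v \<in> hcarrier (weighted_ell2 w)" for u v
  proof
    fix k
    show "rank_one_series J K M (\<lambda>k. u k + v k) k = rank_one_series J K M u k + rank_one_series J K M v k"
      unfolding rank_one_series_def
        suminf_add[OF rank_one_series_terms(2)[OF w M ratio u] rank_one_series_terms(2)[OF w M ratio v]]
      by (intro suminf_cong) (simp add: distrib_left)
  qed
  have scale: "rank_one_series J K M (\<lambda>k. c * u k) = (\<lambda>k. c * rank_one_series J K M u k)"
    if u: "u \<in> hcarrier (weighted_ell2 w)" for u c
  proof
    fix k
    show "rank_one_series J K M (\<lambda>k. c * u k) k = c * rank_one_series J K M u k"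
      unfolding rank_one_series_def suminf_mult[OF rank_one_series_terms(2)[OF w M ratio u], symmetric]
      by (intro suminf_cong) simp
  qed
  show ?thesis
    unfolding bounded_linear_operator_def weighted_ell2_simps(2,3) using mem add scale by blast
qed

text \<open>
  If the constants \<open>4 ^ i\<close> all fail, at the pairs \<open>(J i, K i)\<close>, the series of the corresponding
  normalized rank-one operators is bounded on the end spaces. It has nonnegative entries, so no
  cancellation occurs, and it stretches the unit vector at \<open>J i\<close> by at least \<open>4 ^ i * (1/2) ^ i\<close>.
\<close>

lemma interpolated_weight_necessary:
  fixes w0 w1 w :: "'k \<Rightarrow> real"
  assumes w0: "\<And>k. 0 < w0 k" and w1: "\<And>k. 0 < w1 k" and w: "\<And>k. 0 < w k"
    and inter: "\<And>T. bounded_linear_operator (weighted_ell2 w0) (weighted_ell2 w0) T \<Longrightarrow>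
        bounded_linear_operator (weighted_ell2 w1) (weighted_ell2 w1) T \<Longrightarrow>
        bounded_linear_operator (weighted_ell2 w) (weighted_ell2 w) T"
  shows "interpolated_weight w0 w1 w"
proof (rule ccontr)
  assume "\<not> interpolated_weight w0 w1 w"
  then have "\<exists>j k. \<not> w k \<le> 4 ^ i * max (w0 k / w0 j) (w1 k / w1 j) * w j" for i :: nat
    unfolding interpolated_weight_def by (metis zero_less_numeral zero_less_power)
  then obtain J K where JK: "\<And>i. 4 ^ i * max (w0 (K i) / w0 (J i)) (w1 (K i) / w1 (J i)) * w (J i) < w (K i)"
    by (metis not_le)
  define M where "M i = max (w0 (K i) / w0 (J i)) (w1 (K i) / w1 (J i))" for i
  have M: "0 < M i" for i unfolding M_def using w0 by (simp add: less_max_iff_disj)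
  have "bounded_linear_operator (weighted_ell2 w) (weighted_ell2 w) (rank_one_series J K M)"
    by (intro inter bounded_linear_operator_rank_one_series w0 w1 M) (auto simp: M_def)
  then obtain C where C: "\<And>u. u \<in> hcarrier (weighted_ell2 w) \<Longrightarrow>
      rank_one_series J K M u \<in> hcarrier (weighted_ell2 w) \<and>
      hnorm (weighted_ell2 w) (rank_one_series J K M u) \<le> C * hnorm (weighted_ell2 w) u"
    unfolding bounded_linear_operator_def by blast
  have "2 ^ i \<le> C" for i
  proof -
    let ?e = "unit_fun (J i)"
    have single: "(\<Sum>k\<in>F. (v k * cmod (?e k))\<^sup>2) \<le> (v (J i))\<^sup>2" if "finite F" for F and v :: "'k \<Rightarrow> real"
    proof -
      have "(\<Sum>k\<in>F. (v k * cmod (?e k))\<^sup>2) = (\<Sum>k\<in>F. if k = J i then (v (J i))\<^sup>2 else 0)"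
        by (intro sum.cong) (auto simp: unit_fun_def)
      then show ?thesis using that by simp
    qed
    have e: "?e \<in> hcarrier (weighted_ell2 w)" "hnorm (weighted_ell2 w) ?e \<le> w (J i)"
      by (rule weighted_ell2_memI; use w[of "J i"] single in \<open>auto simp: less_imp_le\<close>)+
    have e0: "?e \<in> hcarrier (weighted_ell2 w0)"
      by (rule weighted_ell2_memI(1)[where B = "w0 (J i)"]; use w0[of "J i"] single in \<open>auto simp: less_imp_le\<close>)
    let ?t = "\<lambda>l. if K l = K i then of_real ((1/2)^l / M l) * ?e (J l) else 0 :: complex"
    have summ: "summable ?t"
      by (rule rank_one_series_terms(2)[where w = w0, OF w0 M _ e0]) (simp add: M_def)
    have "(1/2)^i / M i \<le> (\<Sum>l. Re (?t l))"
    proof -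
      have "(\<Sum>l\<in>{i}. Re (?t l)) \<le> (\<Sum>l. Re (?t l))"
      proof (rule sum_le_suminf)
        show "summable (\<lambda>l. Re (?t l))" by (rule summable_Re[OF summ])
        show "0 \<le> Re (?t l)" for l using M[of l] by (auto simp: unit_fun_def)
      qed simp
      then show ?thesis by (simp add: unit_fun_def)
    qed
    also have "\<dots> = Re (rank_one_series J K M ?e (K i))"
      unfolding rank_one_series_def by (rule bounded_linear.suminf[OF bounded_linear_Re summ, symmetric])
    also have "\<dots> \<le> cmod (rank_one_series J K M ?e (K i))"
      by (rule complex_Re_le_cmod)
    finally have low: "w (K i) * ((1/2)^i / M i) \<le> w (K i) * cmod (rank_one_series J K M ?e (K i))"
      using w[of "K i"] by (intro mult_left_mono) auto
    also have "\<dots> \<le> hnorm (weighted_ell2 w) (rank_one_series J K M ?e)"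
      using C[OF e(1)] by (intro weighted_ell2_eval_le) blast
    also have "\<dots> \<le> C * hnorm (weighted_ell2 w) ?e"
      using C[OF e(1)] by blast
    finally have 1: "w (K i) * ((1/2)^i / M i) \<le> C * hnorm (weighted_ell2 w) ?e" .
    have "0 < w (K i) * ((1/2)^i / M i)" using w[of "K i"] M[of i] by simp
    with 1 have "0 < C * hnorm (weighted_ell2 w) ?e" by linarith
    then have "0 \<le> C" using hnorm_weighted_ell2_nonneg[of w ?e] by (simp add: zero_less_mult_iff)
    then have "w (K i) * ((1/2)^i / M i) \<le> C * w (J i)"
      using 1 mult_left_mono[OF e(2)] by fastforce
    moreover have "(4 ^ i * M i * w (J i)) * ((1/2)^i / M i) \<le> w (K i) * ((1/2)^i / M i)"
      using JK[of i] M[of i] unfolding M_def[symmetric] by (intro mult_right_mono) auto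
    moreover have "(4 ^ i * M i * w (J i)) * ((1/2)^i / M i) = 2 ^ i * w (J i)"
    proof -
      have "(4::real) ^ i * (1/2) ^ i = 2 ^ i" by (simp flip: power_mult_distrib)
      then show ?thesis using M[of i] by (simp add: field_simps)
    qed
    ultimately show ?thesis using w[of "J i"] by (metis mult_le_cancel_right_pos order_trans)
  qed
  moreover obtain i where "C < 2 ^ i" using real_arch_pow[of 2 C] by auto
  ultimately show False by (meson not_le)
qed

section \<open>The lattice and its Sobolev spaces\<close>

definition sq_length :: "int ^ 'n \<Rightarrow> nat" where
  "sq_length k = nat (\<Sum>i\<in>UNIV. (k $ i)\<^sup>2)"

lemma jbracket_sq: "(jbracket k)\<^sup>2 = 1 + real (sq_length k)"
proof -
  have "(lattice_norm k)\<^sup>2 = (\<Sum>i\<in>UNIV. (real_of_int (k $ i))\<^sup>2)"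
    by (simp add: lattice_norm_def sum_nonneg)
  also have "\<dots> = real (sq_length k)"
    by (simp add: sq_length_def sum_nonneg)
  finally have sq: "(lattice_norm k)\<^sup>2 = real (sq_length k)" .
  have "(jbracket k)\<^sup>2 = (1 + real (sq_length k)) powr (1/2) * (1 + real (sq_length k)) powr (1/2)"
    unfolding jbracket_def sq by (rule power2_eq_square)
  also have "\<dots> = 1 + real (sq_length k)"
    by (simp flip: powr_add)
  finally show ?thesis .
qed

lemma jbracket_ge_1: "1 \<le> jbracket k"
  unfolding jbracket_def by (rule ge_one_powr_ge_zero) simp_all

lemma jbracket_pos: "0 < jbracket k"
  using jbracket_ge_1[of k] by linarith

text \<open>
  A power as lower bound of the weight turns the bounded weighted values of \<open>u\<close> into polynomial
  growth of \<open>u\<close>. This identifies the Sobolev and Hoermander spaces with weighted spaces.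
\<close>

lemma tempered_if_weighted_ell2:
  assumes c: "0 < c" and lower: "\<And>k. c * jbracket k powr s \<le> w k"
    and u: "u \<in> hcarrier (weighted_ell2 w)"
  shows "u \<in> tempered"
proof -
  let ?N = "hnorm (weighted_ell2 w) u"
  define n where "n = nat \<lceil>- s\<rceil>"
  have "cmod (u k) \<le> (?N / c) * jbracket k ^ n" for k
  proof -
    have "c * jbracket k powr s * cmod (u k) \<le> w k * cmod (u k)"
      by (intro mult_right_mono lower) simp
    also have "\<dots> \<le> ?N" by (rule weighted_ell2_eval_le[OF u])
    finally have "cmod (u k) \<le> (?N / c) * jbracket k powr (-s)"
      using c jbracket_pos[of k] by (simp add: powr_minus field_simps)
    also have "\<dots> \<le> (?N / c) * jbracket k powr real n"
      using c jbracket_ge_1[of k] unfolding n_def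
      by (intro mult_left_mono powr_mono divide_nonneg_pos hnorm_weighted_ell2_nonneg) linarith+
    also have "jbracket k powr real n = jbracket k ^ n"
      by (rule powr_realpow[OF jbracket_pos])
    finally show ?thesis .
  qed
  then show ?thesis unfolding tempered_def by blast
qed

lemma carrier_eq_weighted_ell2:
  fixes w :: "int ^ 'n \<Rightarrow> real"
  assumes "0 < c" and "\<And>k. c * jbracket k powr s \<le> w k"
  shows "{u \<in> tempered. (\<lambda>k. complex_of_real (w k) * u k) \<in> ell2}
    = {u. (\<lambda>k. (w k * cmod (u k))\<^sup>2) summable_on UNIV}"
proof -
  have "(cmod (complex_of_real (w k) * u k))\<^sup>2 = (w k * cmod (u k))\<^sup>2" for u k
    by (simp add: norm_mult power_mult_distrib)
  then have "(\<lambda>k. complex_of_real (w k) * u k) \<in> ell2 \<longleftrightarrow> u \<in> hcarrier (weighted_ell2 w)" for u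
    by (simp add: ell2_def)
  then show ?thesis
    using tempered_if_weighted_ell2[OF assms] by (auto simp del: weighted_ell2_simps) auto
qed

lemma Sobolev_eq_weighted_ell2:
  "(Sobolev s :: (int ^ 'n \<Rightarrow> complex) inner_space) = weighted_ell2 (\<lambda>k. jbracket k powr s)"
proof -
  have "ell2_inner (\<lambda>k. complex_of_real (jbracket k powr s) * u k) (\<lambda>k. complex_of_real (jbracket k powr s) * v k)
      = (\<Sum>\<^sub>\<infinity>k. complex_of_real ((jbracket k powr s)\<^sup>2) * u k * cnj (v k))" for u v :: "int ^ 'n \<Rightarrow> complex"
    unfolding ell2_inner_def by (intro infsum_cong) (simp add: power2_eq_square)
  then show ?thesis
    unfolding Sobolev_def weighted_ell2_def
    by (subst carrier_eq_weighted_ell2[where c = 1 and s = s]) simp_all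
qed

lemma Hoermander_eq_weighted_ell2:
  assumes "0 < c" and "\<And>k :: int ^ 'n. c * jbracket k powr s \<le> \<phi> (jbracket k)"
  shows "(Hoermander \<phi> :: (int ^ 'n \<Rightarrow> complex) inner_space) = weighted_ell2 (\<lambda>k. \<phi> (jbracket k))"
  unfolding Hoermander_def weighted_ell2_def carrier_eq_weighted_ell2[OF assms] ..

text \<open>
  With \<open>d = s1 - s0\<close> these are the possible values of \<open>(w1 / w0)\<^sup>2\<close> for the Sobolev weights,
  indexed by the squared length of the lattice point.
\<close>

definition lattice_ratio :: "real \<Rightarrow> nat \<Rightarrow> real" where
  "lattice_ratio d m = (1 + real m) powr d"

lemma interpolation_Sobolev_weighted_ell2:
  fixes w :: "int ^ 'n \<Rightarrow> real"
  assumes s: "s0 < s1" and w: "\<And>k. 0 < w k"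
    and inter: "interpolated_weight (\<lambda>k. jbracket k powr s0) (\<lambda>k. jbracket k powr s1) w"
  shows "interpolation_space (Sobolev s0) (Sobolev s1) (weighted_ell2 w)"
  unfolding Sobolev_eq_weighted_ell2
proof (rule interpolation_weighted_ell2[where x = "lattice_ratio (s1 - s0)" and \<iota> = sq_length])
  show "strict_mono (lattice_ratio (s1 - s0))"
    using s by (intro strict_monoI) (simp add: lattice_ratio_def powr_less_mono2)
  show "(jbracket k powr s1 / jbracket k powr s0)\<^sup>2 = lattice_ratio (s1 - s0) (sq_length k)" for k :: "int ^ 'n"
  proof -
    have "(jbracket k powr s1 / jbracket k powr s0)\<^sup>2 = (jbracket k powr (s1 - s0))\<^sup>2"
      by (simp add: powr_diff)
    also have "\<dots> = ((jbracket k)\<^sup>2) powr (s1 - s0)"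
      using jbracket_pos[of k] by (simp add: power2_eq_square powr_mult)
    finally show ?thesis by (simp only: jbracket_sq lattice_ratio_def)
  qed
  show "jbracket k powr s0 \<le> jbracket k powr s1" for k :: "int ^ 'n"
    using s jbracket_ge_1[of k] by (intro powr_mono) auto
qed (use w inter jbracket_pos in \<open>auto simp: lattice_ratio_def less_le\<close>)

section \<open>Weights given by functions of controlled growth\<close>

text \<open>
  If \<open>\<langle>j\<rangle> \<le> \<langle>k\<rangle>\<close>, the upper growth bound with \<open>l = \<langle>k\<rangle> / \<langle>j\<rangle>\<close> gives the second term of the
  maximum; otherwise the lower bound with the inverse quotient gives the first.
\<close>

lemma interpolated_weight_of_growth:
  fixes \<phi> :: "real \<Rightarrow> real"
  assumes pos: "\<And>t. 1 \<le> t \<Longrightarrow> 0 < \<phi> t" and c: "1 \<le> c"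
    and growth: "\<And>t l. 1 \<le> t \<Longrightarrow> 1 \<le> l \<Longrightarrow> inverse c * l powr s0 \<le> \<phi> (l * t) / \<phi> t \<and>
        \<phi> (l * t) / \<phi> t \<le> c * l powr s1"
  shows "interpolated_weight (\<lambda>k :: int ^ 'n. jbracket k powr s0) (\<lambda>k. jbracket k powr s1)
      (\<lambda>k. \<phi> (jbracket k))"
  unfolding interpolated_weight_def
proof (intro exI[of _ c] conjI allI)
  fix j k :: "int ^ 'n"
  define p q where "p = jbracket j" and "q = jbracket k"
  have p: "1 \<le> p" and q: "1 \<le> q" by (simp_all add: p_def q_def jbracket_ge_1)
  let ?m = "max (q powr s0 / p powr s0) (q powr s1 / p powr s1)"
  have "\<phi> q \<le> c * ?m * \<phi> p"
  proof (cases "p \<le> q")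
    case True
    then have "\<phi> q / \<phi> p \<le> c * (q / p) powr s1"
      using growth[of p "q / p"] p by simp
    also have "(q / p) powr s1 = q powr s1 / p powr s1"
      using p q by (simp add: powr_divide)
    also have "c * \<dots> \<le> c * ?m"
      using c by (intro mult_left_mono) auto
    finally show ?thesis using pos[OF p] by (simp add: pos_divide_le_eq)
  next
    case False
    then have "inverse c * (p / q) powr s0 \<le> \<phi> p / \<phi> q"
      using growth[of q "p / q"] q by simp
    also have "(p / q) powr s0 = p powr s0 / q powr s0"
      using p q by (simp add: powr_divide)
    finally have "\<phi> q \<le> c * (q powr s0 / p powr s0) * \<phi> p"
      using pos[OF q] p q c by (simp add: field_simps)
    also have "\<dots> \<le> c * ?m * \<phi> p"
      using c pos[OF p] by (intro mult_right_mono mult_left_mono) auto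
    finally show ?thesis .
  qed
  then show "\<phi> (jbracket k) \<le> c * max (jbracket k powr s0 / jbracket j powr s0)
      (jbracket k powr s1 / jbracket j powr s1) * \<phi> (jbracket j)"
    by (simp only: p_def q_def)
qed (use c in simp)

text \<open>
  The function \<open>\<phi>\<close> is the infimum of the functions
  \<open>t \<mapsto> w j * max ((t / \<langle>j\<rangle>) powr s0) ((t / \<langle>j\<rangle>) powr s1)\<close>. Each of them gains a factor between
  \<open>l powr s0\<close> and \<open>l powr s1\<close> when \<open>t\<close> is multiplied by \<open>l \<ge> 1\<close>, and so does \<open>\<phi>\<close>. At
  \<open>t = \<langle>k\<rangle>\<close> the choice \<open>j = k\<close> gives \<open>\<phi> \<langle>k\<rangle> \<le> w k\<close>, and the condition on the weight is
  the reverse bound up to its constant.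
\<close>

lemma growth_function_of_interpolated_weight:
  fixes w :: "int ^ 'n \<Rightarrow> real"
  assumes s: "s0 < s1" and w: "\<And>k. 0 < w k"
    and inter: "interpolated_weight (\<lambda>k. jbracket k powr s0) (\<lambda>k. jbracket k powr s1) w"
  obtains \<phi> c d where "\<phi> \<in> RO"
    "\<And>t l. 1 \<le> t \<Longrightarrow> 1 \<le> l \<Longrightarrow> l powr s0 \<le> \<phi> (l * t) / \<phi> t \<and> \<phi> (l * t) / \<phi> t \<le> l powr s1"
    "0 < c" "\<And>k. \<phi> (jbracket k) \<le> w k" "\<And>k. w k \<le> c * \<phi> (jbracket k)"
    "0 < d" "\<And>t. 1 \<le> t \<Longrightarrow> d * t powr s0 \<le> \<phi> t"
proof -
  obtain c where c: "0 < c" and cw: "\<And>j k. w k \<le> c * max (jbracket k powr s0 / jbracket j powr s0)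
      (jbracket k powr s1 / jbracket j powr s1) * w j"
    using inter unfolding interpolated_weight_def by blast
  define E where "E j t = w j * max ((t / jbracket j) powr s0) ((t / jbracket j) powr s1)" for j t
  define \<phi> where "\<phi> t = (INF j. E j t)" for t
  have E_nonneg: "0 \<le> E j t" for j t
    unfolding E_def using w[of j] by (intro mult_nonneg_nonneg) (auto simp: le_max_iff_disj)
  have le: "\<phi> t \<le> E j t" for j t
    unfolding \<phi>_def using E_nonneg by (intro cINF_lower bdd_belowI2[of _ 0]) auto
  have ge: "(\<And>j. r \<le> E j t) \<Longrightarrow> r \<le> \<phi> t" for r t
    unfolding \<phi>_def by (intro cINF_greatest) auto
  have scale: "l powr s0 * E j t \<le> E j (l * t)" "E j (l * t) \<le> l powr s1 * E j t"
    if t: "1 \<le> t" and l: "1 \<le> l" for j l t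
  proof -
    let ?a = "(t / jbracket j) powr s0" and ?b = "(t / jbracket j) powr s1"
    have split: "(l * t / jbracket j) powr r = l powr r * (t / jbracket j) powr r" for r
      using l t jbracket_pos[of j] powr_mult[of l "t / jbracket j" r] by simp
    have l01: "l powr s0 \<le> l powr s1" using s l by (intro powr_mono) auto
    have "l powr s0 * max ?a ?b \<le> max (l powr s0 * ?a) (l powr s1 * ?b)"
      using mult_right_mono[OF l01, of ?b] by (auto simp: max_def)
    moreover have "max (l powr s0 * ?a) (l powr s1 * ?b) \<le> l powr s1 * max ?a ?b"
      using mult_right_mono[OF l01, of ?a] mult_left_mono[of ?a "max ?a ?b" "l powr s1"]
        mult_left_mono[of ?b "max ?a ?b" "l powr s1"] by auto
    ultimately show "l powr s0 * E j t \<le> E j (l * t)" "E j (l * t) \<le> l powr s1 * E j t"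
      using w[of j] by (auto simp: E_def split mult.left_commute[of _ "w j"] intro!: mult_left_mono)
  qed
  obtain k0 :: "int ^ 'n" where True by simp
  define d where "d = w k0 / (c * jbracket k0 powr s1)"
  have d: "0 < d" unfolding d_def using w[of k0] c jbracket_pos[of k0] by simp
  have lower: "d * t powr s0 \<le> \<phi> t" if t: "1 \<le> t" for t
  proof (rule ge)
    fix j :: "int ^ 'n"
    let ?p = "jbracket j" and ?b = "jbracket k0"
    have "?b powr s0 / ?p powr s0 \<le> ?b powr s1 / ?p powr s0"
      using s jbracket_ge_1[of k0] by (intro divide_right_mono powr_mono) auto
    moreover have "?b powr s1 / ?p powr s1 \<le> ?b powr s1 / ?p powr s0"
      using s jbracket_ge_1[of j] by (intro divide_left_mono powr_mono) auto
    ultimately have "max (?b powr s0 / ?p powr s0) (?b powr s1 / ?p powr s1) \<le> ?b powr s1 / ?p powr s0"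
      by simp
    then have "c * max (?b powr s0 / ?p powr s0) (?b powr s1 / ?p powr s1) * w j \<le> c * (?b powr s1 / ?p powr s0) * w j"
      using c w[of j] by (intro mult_right_mono mult_left_mono) auto
    with cw[of k0 j] have "w k0 \<le> c * (?b powr s1 / ?p powr s0) * w j" by linarith
    then have "d * ?p powr s0 \<le> w j"
      using c jbracket_pos[of j] jbracket_pos[of k0] by (simp add: d_def field_simps)
    then have "d * ?p powr s0 * (t / ?p) powr s0 \<le> w j * max ((t / ?p) powr s0) ((t / ?p) powr s1)"
      using w[of j] d by (intro mult_mono) auto
    moreover have "?p powr s0 * (t / ?p) powr s0 = t powr s0"
      using jbracket_pos[of j] t by (simp flip: powr_mult)
    ultimately show "d * t powr s0 \<le> E j t"
      by (simp add: E_def mult.assoc)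
  qed
  have pos: "0 < \<phi> t" if t: "1 \<le> t" for t
  proof -
    have "0 < d * t powr s0" using d t by simp
    then show ?thesis using lower[OF t] by linarith
  qed
  have growth: "l powr s0 * \<phi> t \<le> \<phi> (l * t)" "\<phi> (l * t) \<le> l powr s1 * \<phi> t"
    if t: "1 \<le> t" and l: "1 \<le> l" for t l
  proof -
    show "l powr s0 * \<phi> t \<le> \<phi> (l * t)"
    proof (rule ge)
      fix j
      have "l powr s0 * \<phi> t \<le> l powr s0 * E j t" by (intro mult_left_mono le) simp
      then show "l powr s0 * \<phi> t \<le> E j (l * t)" using scale(1)[OF t l, of j] by linarith
    qed
    have "\<phi> (l * t) / l powr s1 \<le> \<phi> t"
    proof (rule ge)
      fix j
      have "\<phi> (l * t) \<le> l powr s1 * E j t" using le[of "l * t" j] scale(2)[OF t l, of j] by linarith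
      then show "\<phi> (l * t) / l powr s1 \<le> E j t" using l by (simp add: divide_le_eq mult_ac)
    qed
    then show "\<phi> (l * t) \<le> l powr s1 * \<phi> t" using l by (simp add: divide_le_eq mult_ac)
  qed
  have quotient: "l powr s0 \<le> \<phi> (l * t) / \<phi> t" "\<phi> (l * t) / \<phi> t \<le> l powr s1"
    if "1 \<le> t" "1 \<le> l" for t l
    using growth[OF that] pos[OF that(1)] by (simp_all add: pos_le_divide_eq pos_divide_le_eq)
  have measurable: "\<phi> \<in> borel_measurable (restrict_space borel {1..})"
  proof -
    \<comment> \<open>measurability is that of a monotone function times a power\<close>
    have "mono_on {1..} (\<lambda>t. t powr (-s0) * \<phi> t)"
    proof (rule mono_onI)
      fix t t' :: real assume tt: "t \<in> {1..}" "t' \<in> {1..}" "t \<le> t'"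
      then have "(t' / t) powr s0 * \<phi> t \<le> \<phi> t'"
        using growth(1)[of t "t' / t"] by simp
      then show "t powr (-s0) * \<phi> t \<le> t' powr (-s0) * \<phi> t'"
        using tt by (simp add: powr_divide powr_minus field_simps)
    qed
    then have "(\<lambda>t. t powr (-s0) * \<phi> t) \<in> borel_measurable (restrict_space borel {1..})"
      by (rule borel_measurable_mono_on_fnc)
    moreover have "(\<lambda>t::real. t powr s0) \<in> borel_measurable (restrict_space borel {1..})"
      by (rule measurable_restrict_space1) measurable
    ultimately have "(\<lambda>t. t powr s0 * (t powr (-s0) * \<phi> t)) \<in> borel_measurable (restrict_space borel {1..})"
      by (rule borel_measurable_times[rotated])
    then show ?thesis
      by (rule measurable_cong[THEN iffD1, rotated]) (auto simp: space_restrict_space powr_minus)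
  qed
  have "\<phi> \<in> RO"
  proof -
    define K where "K = 2 powr (\<bar>s0\<bar> + \<bar>s1\<bar>)"
    have K: "1 \<le> K" unfolding K_def by (intro ge_one_powr_ge_zero) auto
    have "inverse K \<le> \<phi> (l * t) / \<phi> t \<and> \<phi> (l * t) / \<phi> t \<le> K"
      if t: "1 \<le> t" and l: "l \<in> {1..2}" for t l
    proof -
      have "inverse K = 2 powr (- (\<bar>s0\<bar> + \<bar>s1\<bar>))" unfolding K_def by (rule powr_minus[symmetric])
      also have "\<dots> \<le> 2 powr (- \<bar>s0\<bar>)" by (intro powr_mono) auto
      also have "\<dots> \<le> l powr (- \<bar>s0\<bar>)" using l by (intro powr_mono2') auto
      also have "\<dots> \<le> l powr s0" using l by (intro powr_mono) auto
      finally have 1: "inverse K \<le> l powr s0" .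
      have "l powr s1 \<le> l powr \<bar>s1\<bar>" using l by (intro powr_mono) auto
      also have "\<dots> \<le> 2 powr \<bar>s1\<bar>" using l by (intro powr_mono2) auto
      also have "\<dots> \<le> K" unfolding K_def by (intro powr_mono) auto
      finally show ?thesis using 1 quotient[OF t, of l] l by auto
    qed
    then have "\<exists>a>1. \<exists>c\<ge>1. \<forall>t\<ge>1. \<forall>l\<in>{1..a}. inverse c \<le> \<phi> (l * t) / \<phi> t \<and> \<phi> (l * t) / \<phi> t \<le> c"
      using K by (intro exI[of _ 2], intro conjI exI[of _ K]) auto
    then show ?thesis unfolding RO_def using measurable pos by blast
  qed
  moreover have "l powr s0 \<le> \<phi> (l * t) / \<phi> t \<and> \<phi> (l * t) / \<phi> t \<le> l powr s1" if "1 \<le> t" "1 \<le> l" for t l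
    using quotient[OF that] by (rule conjI)
  moreover have "\<phi> (jbracket k) \<le> w k" for k
    using le[of "jbracket k" k] jbracket_pos[of k] by (simp add: E_def)
  moreover have "w k \<le> c * \<phi> (jbracket k)" for k
  proof -
    have "w k / c \<le> \<phi> (jbracket k)"
    proof (rule ge)
      fix j :: "int ^ 'n"
      have "(jbracket k / jbracket j) powr r = jbracket k powr r / jbracket j powr r" for r
        using jbracket_pos[of k] jbracket_pos[of j] by (simp add: powr_divide)
      then show "w k / c \<le> E j (jbracket k)"
        using cw[of k j] c by (simp add: E_def pos_divide_le_eq mult_ac)
    qed
    then show ?thesis using c by (simp add: pos_divide_le_eq mult_ac)
  qed
  ultimately show thesis using c d lower by (intro that[of \<phi> c d])
qed

section \<open>Characterization of the interpolation spaces\<close>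

theorem theorem2p1:
  fixes s0 s1 :: real and S :: "(int ^ 'n \<Rightarrow> complex) inner_space"
  assumes "s0 < s1" and "hilbert_space S"
  shows "interpolation_space (Sobolev s0) (Sobolev s1) S \<longleftrightarrow>
    (\<exists>\<phi>\<in>RO.
       (\<exists>c\<ge>1. \<forall>t\<ge>1. \<forall>l\<ge>1. inverse c * l powr s0 \<le> \<phi> (l * t) / \<phi> t \<and>
                             \<phi> (l * t) / \<phi> t \<le> c * l powr s1) \<and>
       equal_up_to_norm_equivalence S (Hoermander \<phi>))"
proof
  assume inter: "interpolation_space (Sobolev s0) (Sobolev s1) S"
  let ?w0 = "\<lambda>k :: int ^ 'n. jbracket k powr s0" and ?w1 = "\<lambda>k :: int ^ 'n. jbracket k powr s1"
  have pos: "0 < ?w0 k" "0 < ?w1 k" for k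
    using jbracket_pos[of k] by simp_all
  interpret weighted_interpolation ?w0 ?w1 S
    by unfold_locales (use pos inter in \<open>simp_all add: Sobolev_eq_weighted_ell2\<close>)
  have "bounded_linear_operator (weighted_ell2 basis_norm) (weighted_ell2 basis_norm) T"
    if "bounded_linear_operator (weighted_ell2 ?w0) (weighted_ell2 ?w0) T"
      "bounded_linear_operator (weighted_ell2 ?w1) (weighted_ell2 ?w1) T" for T
    by (rule bounded_linear_operator_norm_equivalence[OF hilbert_space.axioms(1)[OF S_hilbert]
        S_equal_weighted_ell2 S_equal_weighted_ell2 operator_bounded_on_S[OF that]])
  then have "interpolated_weight ?w0 ?w1 basis_norm"
    by (rule interpolated_weight_necessary[OF pos basis_norm_pos])
  then obtain \<phi> c d where \<phi>: "\<phi> \<in> RO"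
    and growth: "\<And>t l. 1 \<le> t \<Longrightarrow> 1 \<le> l \<Longrightarrow> l powr s0 \<le> \<phi> (l * t) / \<phi> t \<and> \<phi> (l * t) / \<phi> t \<le> l powr s1"
    and c: "0 < c" "\<And>k. \<phi> (jbracket k) \<le> basis_norm k" "\<And>k. basis_norm k \<le> c * \<phi> (jbracket k)"
    and d: "0 < d" "\<And>t. 1 \<le> t \<Longrightarrow> d * t powr s0 \<le> \<phi> t"
    by (rule growth_function_of_interpolated_weight[OF assms(1) basis_norm_pos]) (rule that)
  have \<phi>_nonneg: "0 \<le> \<phi> (jbracket k)" for k :: "int ^ 'n"
    using \<phi> jbracket_ge_1[of k] unfolding RO_def by (auto intro: less_imp_le)
  have "equal_up_to_norm_equivalence (weighted_ell2 basis_norm) (weighted_ell2 (\<lambda>k. \<phi> (jbracket k)))"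
    by (rule equal_up_to_norm_equivalence_weighted_ell2[where C = c and D = 1])
      (use c basis_norm_pos \<phi>_nonneg in \<open>auto intro: less_imp_le\<close>)
  moreover have "Hoermander \<phi> = weighted_ell2 (\<lambda>k :: int ^ 'n. \<phi> (jbracket k))"
    by (rule Hoermander_eq_weighted_ell2[OF d(1) d(2)[OF jbracket_ge_1]])
  ultimately have "equal_up_to_norm_equivalence S (Hoermander \<phi>)"
    using equal_up_to_norm_equivalence_trans[OF S_equal_weighted_ell2] by simp
  then show "\<exists>\<phi>\<in>RO. (\<exists>c\<ge>1. \<forall>t\<ge>1. \<forall>l\<ge>1. inverse c * l powr s0 \<le> \<phi> (l * t) / \<phi> t \<and>
        \<phi> (l * t) / \<phi> t \<le> c * l powr s1) \<and> equal_up_to_norm_equivalence S (Hoermander \<phi>)"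
    using \<phi> growth by (intro bexI[of _ \<phi>] conjI exI[of _ 1]) auto
next
  assume "\<exists>\<phi>\<in>RO. (\<exists>c\<ge>1. \<forall>t\<ge>1. \<forall>l\<ge>1. inverse c * l powr s0 \<le> \<phi> (l * t) / \<phi> t \<and>
        \<phi> (l * t) / \<phi> t \<le> c * l powr s1) \<and> equal_up_to_norm_equivalence S (Hoermander \<phi>)"
  then obtain \<phi> c where \<phi>: "\<phi> \<in> RO" and c: "1 \<le> c"
    and growth: "\<And>t l. 1 \<le> t \<Longrightarrow> 1 \<le> l \<Longrightarrow> inverse c * l powr s0 \<le> \<phi> (l * t) / \<phi> t \<and>
        \<phi> (l * t) / \<phi> t \<le> c * l powr s1"
    and eq: "equal_up_to_norm_equivalence S (Hoermander \<phi>)"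
    by blast
  have pos: "0 < \<phi> t" if "1 \<le> t" for t
    using \<phi> that unfolding RO_def by blast
  have lower: "(inverse c * \<phi> 1) * jbracket k powr s0 \<le> \<phi> (jbracket k)" for k :: "int ^ 'n"
    using growth[of 1 "jbracket k"] jbracket_ge_1[of k] pos[of 1] by (simp add: pos_le_divide_eq mult_ac)
  have "0 < inverse c * \<phi> 1" using c pos[of 1] by simp
  then have H: "Hoermander \<phi> = weighted_ell2 (\<lambda>k :: int ^ 'n. \<phi> (jbracket k))"
    by (rule Hoermander_eq_weighted_ell2[OF _ lower])
  have "interpolation_space (Sobolev s0) (Sobolev s1) (weighted_ell2 (\<lambda>k :: int ^ 'n. \<phi> (jbracket k)))"
    by (intro interpolation_Sobolev_weighted_ell2 interpolated_weight_of_growth[where c = c]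
        assms(1) pos jbracket_ge_1 c growth)
  then show "interpolation_space (Sobolev s0) (Sobolev s1) S"
    using interpolation_space_norm_equivalence[OF _ assms(2) equal_up_to_norm_equivalence_sym[OF eq]]
    by (simp add: H)
qed

end
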